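(* Let $Y$ be the CIR process $dY_t=\mu(\theta-Y_t)\,dt+\sigma\sqrt{Y_t}\,dB_t$ with constants $\mu,\theta,\sigma>0$, let $r>0$ and $c_s>0$, and let $$V(y)=\sup_{\tau\in\mathcal T}\mathbb E_y\{e^{-r\tau}(Y_\tau-c_s)\},\qquad y\ge 0.$$ Let $y_s=\frac{\mu\theta+rc_s}{\mu+r}$. Then there is a level $b^*\in(c_s\vee y_s,\infty)$ satisfying $F(b^* )=(b^*-c_s)F'(b^* )$, and $$V(y)=\begin{cases}\dfrac{b^*-c_s}{F(b^* )}F(y), & y\in[0,b^* ),\\[2mm] y-c_s, & y\in[b^*,\infty).\end{cases}$$
   Context: Let $(\Omega,\mathcal F,\mathbb P)$ be a probability space carrying a standard Brownian motion $B$; $\mathbb F$ is the filtration generated by $B$ and $\mathcal T$ the set of all $\mathbb F$-stopping times. $Y$ solves $dY_t=\mu(\theta-Y_t)dt+\sigma\sqrt{Y_t}dB_t$ with $Y_0=y\ge0$ (if $2\mu\theta<\sigma^2$ the level $0$ is a reflecting boundary; if $2\mu\theta\ge\sigma^2$ it is inaccessible), and $\mathbb E_y$ denotes expectation given $Y_0=y$. Kummer's function is $M(a,b;z)=\sum_{n\ge0}\frac{(a)_n z^n}{(b)_n n!}$ with $(a)_0=1$, $(a)_n=a(a+1)\cdots(a+n-1)$. Define $F(y)=M\big(\tfrac{r}{\mu},\tfrac{2\mu\theta}{\sigma^2};\tfrac{2\mu y}{\sigma^2}\big)$; it is the strictly positive, strictly increasing solution of $\frac{\sigma^2y}{2}u''+\mu(\theta-y)u'=ru$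 on $y\ge0$. *)

theory Defs
  imports "HOL-Probability.Probability"
begin

definition kummerM :: "real \<Rightarrow> real \<Rightarrow> real \<Rightarrow> real" where
  "kummerM a b z = (\<Sum>n. pochhammer a n * z ^ n / (pochhammer b n * fact n))"

definition cirF :: "real \<Rightarrow> real \<Rightarrow> real \<Rightarrow> real \<Rightarrow> real \<Rightarrow> real" where
  "cirF \<mu> \<theta> \<sigma> r y = kummerM (r / \<mu>) (2 * \<mu> * \<theta> / \<sigma>\<^sup>2) (2 * \<mu> * y / \<sigma>\<^sup>2)"

definition std_brownian_motion :: "'a measure \<Rightarrow> (real \<Rightarrow> 'a \<Rightarrow> real) \<Rightarrow> bool" where
  "std_brownian_motion M B \<longleftrightarrow>
     (\<forall>t. B t \<in> borel_measurable M) \<and>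
     (\<forall>\<omega>\<in>space M. B 0 \<omega> = 0 \<and> continuous_on {0..} (\<lambda>t. B t \<omega>)) \<and>
     (\<forall>s t. 0 \<le> s \<and> s < t \<longrightarrow>
        distributed M lborel (\<lambda>\<omega>. B t \<omega> - B s \<omega>) (normal_density 0 (sqrt (t - s)))) \<and>
     (\<forall>(n::nat) (ts::nat \<Rightarrow> real). 0 \<le> ts 0 \<and> (\<forall>i<n. ts i < ts (Suc i)) \<longrightarrow>
        prob_space.indep_vars M (\<lambda>_. borel) (\<lambda>i \<omega>. B (ts (Suc i)) \<omega> - B (ts i) \<omega>) {..<n})"

definition nat_filtration :: "'a measure \<Rightarrow> (real \<Rightarrow> 'a \<Rightarrow> real) \<Rightarrow> real \<Rightarrow> 'a measure" where
  "nat_filtration M B t =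
     sigma (space M) (\<Union>s\<in>{0..t}. {B s -` A \<inter> space M | A. A \<in> sets borel})"

definition stopping_times :: "'a measure \<Rightarrow> (real \<Rightarrow> 'a \<Rightarrow> real) \<Rightarrow> ('a \<Rightarrow> ereal) set" where
  "stopping_times M B = {\<tau>. (\<forall>\<omega>\<in>space M. 0 \<le> \<tau> \<omega>) \<and>
      (\<forall>t\<ge>0. {\<omega>\<in>space M. \<tau> \<omega> \<le> ereal t} \<in> sets (nat_filtration M B t))}"

definition adapted_aug :: "'a measure \<Rightarrow> (real \<Rightarrow> 'a \<Rightarrow> real) \<Rightarrow> (real \<Rightarrow> 'a \<Rightarrow> real) \<Rightarrow> bool" where
  "adapted_aug M B Y \<longleftrightarrow> (\<forall>t\<ge>0. \<exists>Z. Z \<in> borel_measurable (nat_filtration M B t) \<and>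
      (AE \<omega> in M. Y t \<omega> = Z \<omega>))"

text \<open>Y is a (strong) solution of dY = mu(theta - Y)dt + sigma sqrt(Y) dB, Y_0 = y.
  The Ito integral of the continuous adapted integrand sigma sqrt(Y) is expressed as
  the limit in probability of left-point Riemann sums over uniform partitions.\<close>
definition cir_solution ::
  "'a measure \<Rightarrow> (real \<Rightarrow> 'a \<Rightarrow> real) \<Rightarrow> real \<Rightarrow> real \<Rightarrow> real \<Rightarrow> real \<Rightarrow> (real \<Rightarrow> 'a \<Rightarrow> real) \<Rightarrow> bool" where
  "cir_solution M B \<mu> \<theta> \<sigma> y Y \<longleftrightarrow>
     (\<forall>t. Y t \<in> borel_measurable M) \<and>
     adapted_aug M B Y \<and>
     (\<forall>\<omega>\<in>space M. Y 0 \<omega> = y \<and> continuous_on {0..} (\<lambda>t. Y t \<omega>) \<and> (\<forall>t\<ge>0. 0 \<le> Y t \<omega>)) \<and>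
     (\<forall>t\<ge>0. \<forall>\<epsilon>>0.
        (\<lambda>n::nat. measure M {\<omega>\<in>space M.
            \<bar>(\<Sum>k<n. \<sigma> * sqrt (Y (real k * t / real n) \<omega>) *
                      (B (real (Suc k) * t / real n) \<omega> - B (real k * t / real n) \<omega>))
             - (Y t \<omega> - y - integral {0..t} (\<lambda>s. \<mu> * (\<theta> - Y s \<omega>)))\<bar> > \<epsilon>})
        \<longlonglongrightarrow> 0)"

definition stop_payoff :: "(real \<Rightarrow> 'a \<Rightarrow> real) \<Rightarrow> real \<Rightarrow> real \<Rightarrow> ('a \<Rightarrow> ereal) \<Rightarrow> 'a \<Rightarrow> real" where
  "stop_payoff Y r c \<tau> \<omega> =
     (if \<tau> \<omega> = \<infinity> then 0
      else exp (- r * real_of_ereal (\<tau> \<omega>)) * (Y (real_of_ereal (\<tau> \<omega>)) \<omega> - c))"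

definition value_fn ::
  "'a measure \<Rightarrow> (real \<Rightarrow> 'a \<Rightarrow> real) \<Rightarrow> (real \<Rightarrow> 'a \<Rightarrow> real) \<Rightarrow> real \<Rightarrow> real \<Rightarrow> real" where
  "value_fn M B Y r c = (SUP \<tau>\<in>stopping_times M B. integral\<^sup>L M (stop_payoff Y r c \<tau>))"

end

theory Submission
  imports Defs
begin

text \<open>For the optimal level \<open>b\<close> the multiple \<open>K F\<close> with \<open>K = (b - c) / F b\<close> is the tangent
  majorant of \<open>x - c\<close>: \<open>F\<close> is convex and \<open>F b = (b - c) F' b\<close>. The upper bound comes from the supermartingale
  property of \<open>exp (- r t) W (Y t)\<close> for smooth supersolutions \<open>W \<ge> x - c\<close> that decrease to the candidate value
  function, the lower bound from stopping at grid approximations of the first time above a level just below \<open>b\<close>.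

  Both rest on a one-sided Dynkin formula for bounded discretised stopping times. No stochastic calculus is needed for it:
  run the Euler scheme whose coefficients are frozen values of the true solution and whose noise is the true
  Brownian noise. Its steps have exact conditional moments, so a second-order Taylor expansion controls the
  expectation, while the hypothesis on Riemann sums, an \<open>L\<^sup>2\<close> bound between coarse grid
  points and stochastic continuity of the paths show that the scheme stays close to the solution until it is stopped.\<close>

section \<open>Riemann sums and the Taylor step\<close>

text \<open>Freezing the coefficients at the solution matters because the square root is not
  Lipschitz at 0: coefficients of two different processes are never compared, and the scheme misses
  \<open>Y\<close> only by the Riemann-sum errors of the two integrals. Those errors vanish in
  probability at each fixed time, without rate and without uniformity in time. Hence two grids:
  closeness is demanded at the finitely many points of a coarse grid, and each coarse cell is cut
  into \<open>l\<close> steps with \<open>l\<close> chosen last; inside a cell both scheme and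
  solution move little, by bounds independent of \<open>l\<close>. An error of
  \<open>o(1) * \<delta>\<close> per step is then affordable, since the number of steps times
  \<open>\<delta>\<close> is the fixed horizon. No moment of \<open>Y\<close> is known in advance.
  Distances are therefore measured by \<open>E min(1, x^2)\<close>, the scheme stops when the
  solution leaves \<open>[0, m]\<close>, and for the upper bound \<open>m\<close> is sent to
  infinity by Fatou's lemma. The inequality is one-sided so that it serves twice: for
  supersolutions, and for \<open>- F\<close>, whose equation holds with equality.\<close>

lemma riemann_sum_error:
  fixes g :: "real \<Rightarrow> real"
  assumes "0 \<le> d" "continuous_on {0..real n * d} g"
    and "\<And>s s'. s \<in> {0..real n * d} \<Longrightarrow> s' \<in> {0..real n * d} \<Longrightarrow> \<bar>s - s'\<bar> \<le> d \<Longrightarrow> \<bar>g s - g s'\<bar> \<le> e"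
  shows "\<bar>(\<Sum>k<n. g (real k * d) * d) - integral {0..real n * d} g\<bar> \<le> real n * d * e"
  using assms(2,3)
proof (induction n)
  case (Suc n)
  have sub: "{0..real n * d} \<subseteq> {0..real (Suc n) * d}" using assms(1) by (auto simp: algebra_simps)
  have le: "real n * d \<le> real (Suc n) * d" "0 \<le> real n * d" using assms(1) by (auto simp: algebra_simps)
  have IH: "\<bar>(\<Sum>k<n. g (real k * d) * d) - integral {0..real n * d} g\<bar> \<le> real n * d * e"
    using sub by (intro Suc.IH continuous_on_subset[OF Suc.prems(1)] Suc.prems(2)) auto
  have int: "g integrable_on {0..real (Suc n) * d}"
    by (rule integrable_continuous_real[OF Suc.prems(1)])
  have int': "g integrable_on {real n * d..real (Suc n) * d}"
    by (rule integrable_on_subinterval[OF int]) (use le in auto)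
  have c: "integral {0..real n * d} g + integral {real n * d..real (Suc n) * d} g = integral {0..real (Suc n) * d} g"
    by (rule Henstock_Kurzweil_Integration.integral_combine[OF le(2,1) int])
  have len: "real (Suc n) * d - real n * d = d" by (simp add: algebra_simps)
  let ?I = "{real n * d..real (Suc n) * d}"
  have "integral ?I (\<lambda>s. g s - g (real n * d)) = integral ?I g - integral ?I (\<lambda>s. g (real n * d))"
    by (rule Henstock_Kurzweil_Integration.integral_diff[OF int']) (rule integrable_const_ivl)
  also have "integral ?I (\<lambda>s. g (real n * d)) = g (real n * d) * d"
    using le(1) len by simp
  finally have "\<bar>integral ?I g - g (real n * d) * d\<bar> = norm (integral ?I (\<lambda>s. g s - g (real n * d)))"
    by simp
  also have "\<dots> \<le> e * (real (Suc n) * d - real n * d)"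
  proof (rule integral_bound[OF le(1)])
    show "continuous_on ?I (\<lambda>s. g s - g (real n * d))"
      by (intro continuous_intros continuous_on_subset[OF Suc.prems(1)]) (use le in auto)
    show "norm (g s - g (real n * d)) \<le> e" if "s \<in> ?I" for s
    proof -
      have "\<bar>s - real n * d\<bar> \<le> d" using that len by auto
      moreover have "s \<in> {0..real (Suc n) * d}" "real n * d \<in> {0..real (Suc n) * d}"
        using that le by auto
      ultimately show ?thesis using Suc.prems(2) by simp
    qed
  qed
  finally have "\<bar>integral {real n * d..real (Suc n) * d} g - g (real n * d) * d\<bar> \<le> e * d" unfolding len .
  moreover have "real (Suc n) * d * e = real n * d * e + e * d" by (simp add: algebra_simps)
  moreover have "(\<Sum>k<Suc n. g (real k * d) * d) = (\<Sum>k<n. g (real k * d) * d) + g (real n * d) * d" by simp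
  ultimately show ?case using IH c by linarith
qed simp

lemma riemann_sum_tendsto:
  fixes g :: "real \<Rightarrow> real"
  assumes "0 \<le> t" "continuous_on {0..t} g"
  shows "(\<lambda>n. \<Sum>k<n. g (real k * t / real n) * (t / real n)) \<longlonglongrightarrow> integral {0..t} g"
proof (rule LIMSEQ_I)
  fix e :: real assume e: "0 < e"
  have uc: "uniformly_continuous_on {0..t} g" using assms(2) by (rule compact_uniformly_continuous) simp
  \<comment> \<open>The \<open>+ 1\<close> admits \<open>t = 0\<close> and makes the final bound
    \<open>t * e / (t + 1) < e\<close> strict.\<close>
  have "0 < e / (t + 1)" using e assms by simp
  then obtain d where d: "d > 0" "\<And>s s'. s \<in> {0..t} \<Longrightarrow> s' \<in> {0..t} \<Longrightarrow> dist s' s < d \<Longrightarrow> dist (g s') (g s) < e / (t + 1)"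
    using uc unfolding uniformly_continuous_on_def by meson
  obtain N where N: "t / d < real N" using reals_Archimedean2 by blast
  have "norm ((\<Sum>k<n. g (real k * t / real n) * (t / real n)) - integral {0..t} g) < e" if "n \<ge> Suc N" for n
  proof -
    have n: "real n > 0" "t / d < real n" using that N by auto
    then have "t / real n < d" using d(1) by (simp add: field_simps)
    then have "\<bar>(\<Sum>k<n. g (real k * (t / real n)) * (t / real n)) - integral {0..real n * (t / real n)} g\<bar> \<le> real n * (t / real n) * (e / (t + 1))"
      using n assms d(2) by (intro riemann_sum_error) (force simp: dist_real_def)+
    also have "\<dots> < e" using n e assms by (simp add: field_simps)
    finally show ?thesis using n by (simp add: mult.assoc)
  qed
  then show "\<exists>no. \<forall>n\<ge>no. norm ((\<Sum>k<n. g (real k * t / real n) * (t / real n)) - integral {0..t} g) < e"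
    by blast
qed

text \<open>The truncated squared distance replaces the indicator of a large deviation: it is
  small in expectation exactly when the distance is small in probability.\<close>
abbreviation trunc_sq :: "real \<Rightarrow> real" where "trunc_sq x \<equiv> min 1 (x\<^sup>2)"

text \<open>Quasi-triangle inequality: the factor 2 is the price of squares, and the truncation
  passes through because \<open>min 1\<close> is monotone and subadditive on nonnegative
  numbers.\<close>

lemma trunc_sq_add: "trunc_sq (a + b) \<le> 2 * trunc_sq a + 2 * trunc_sq b"
proof -
  have "(a + b)\<^sup>2 \<le> 2 * a\<^sup>2 + 2 * b\<^sup>2" using sum_squares_bound[of a b] by (simp add: power2_sum)
  moreover have "min 1 u \<le> 2 * min 1 p + 2 * min 1 q" if "u \<le> 2 * p + 2 * q" "0 \<le> p" "0 \<le> q" for u p q :: real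
    using that by (auto simp: min_def)
  ultimately show ?thesis by simp
qed

text \<open>Close to \<open>z\<close> uniform continuity on a compact interval gives \<eta>; far
  from \<open>z\<close> the oscillation, at most \<open>2 * K\<close>, is absorbed by a large
  multiple of the truncated square. The point \<open>x\<close> ranges over the whole line because
  the scheme may leave \<open>[0, m]\<close>.\<close>

lemma bounded_continuous_modulus:
  fixes g :: "real \<Rightarrow> real"
  assumes "continuous_on UNIV g" "\<And>x. \<bar>g x\<bar> \<le> K" "\<eta> > 0"
  shows "\<exists>C\<ge>0. \<forall>z\<in>{0..m}. \<forall>x. \<bar>g x - g z\<bar> \<le> \<eta> + C * trunc_sq (x - z)"
proof -
  \<comment> \<open>The margin 1 keeps every \<open>x\<close> within \<open>d' \<le> 1\<close> of a
    point of \<open>[0, m]\<close> inside the compact interval.\<close>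
  have "uniformly_continuous_on {-1..m+1} g"
    by (rule compact_uniformly_continuous[OF continuous_on_subset[OF assms(1)]]) auto
  then obtain d where d: "d > 0" "\<And>s s'. s \<in> {-1..m+1} \<Longrightarrow> s' \<in> {-1..m+1} \<Longrightarrow> dist s' s < d \<Longrightarrow> dist (g s') (g s) < \<eta>"
    using assms(3) unfolding uniformly_continuous_on_def by meson
  define d' where "d' = min d 1"
  have d': "0 < d'" "d' \<le> 1" "d' \<le> d" using d(1) unfolding d'_def by auto
  have K: "K \<ge> 0" using assms(2)[of 0] by linarith
  define C where "C = 2 * K / d'\<^sup>2"
  have C: "C \<ge> 0" unfolding C_def using K by simp
  have "\<bar>g x - g z\<bar> \<le> \<eta> + C * trunc_sq (x - z)" if z: "z \<in> {0..m}" for x z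
  proof (cases "\<bar>x - z\<bar> < d'")
    case True
    then have "dist (g x) (g z) < \<eta>" using z d' by (intro d(2)) (auto simp: dist_real_def)
    moreover have "0 \<le> C * trunc_sq (x - z)" using C by simp
    ultimately show ?thesis by (auto simp: dist_real_def)
  next
    case False
    then have "d'\<^sup>2 \<le> (x - z)\<^sup>2" using d'(1) by (metis abs_le_square_iff abs_of_pos not_less)
    moreover have "d'\<^sup>2 \<le> 1" using d'(1,2) by (simp add: power_le_one)
    ultimately have "C * d'\<^sup>2 \<le> C * trunc_sq (x - z)" using C by (intro mult_left_mono) auto
    moreover have "C * d'\<^sup>2 = 2 * K" unfolding C_def using d'(1) by simp
    moreover have "\<bar>g x - g z\<bar> \<le> 2 * K" using assms(2)[of x] assms(2)[of z] by linarith
    ultimately show ?thesis using assms(3) by linarith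
  qed
  then show ?thesis using C by blast
qed

text \<open>Defined and bounded on the whole line: the Gaussian noise can drive the scheme below 0
  or above \<open>m\<close>, and the global bound makes all expectations finite.\<close>

locale test_function =
  fixes f f' f'' :: "real \<Rightarrow> real" and K :: real
  assumes f_deriv: "\<And>x. (f has_real_derivative f' x) (at x)"
    and f'_deriv: "\<And>x. (f' has_real_derivative f'' x) (at x)"
    and f''_cont: "continuous_on UNIV f''"
    and f_bound: "\<And>x. \<bar>f x\<bar> \<le> K" and f'_bound: "\<And>x. \<bar>f' x\<bar> \<le> K" and f''_bound: "\<And>x. \<bar>f'' x\<bar> \<le> K"
begin

lemma f_cont: "continuous_on UNIV f" and f'_cont: "continuous_on UNIV f'"
  using f_deriv f'_deriv by (auto intro!: DERIV_continuous_on intro: has_field_derivative_at_within)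

lemma f_meas[measurable]: "f \<in> borel_measurable borel" "f' \<in> borel_measurable borel" "f'' \<in> borel_measurable borel"
  using f_cont f'_cont f''_cont by (auto intro: borel_measurable_continuous_onI)

lemma K_nonneg: "K \<ge> 0" using f_bound[of 0] by linarith

lemma taylor2: "\<exists>w. \<bar>w\<bar> \<le> \<bar>v\<bar> \<and> f (x + v) = f x + f' x * v + f'' (x + w) / 2 * v\<^sup>2"
proof (cases "v = 0")
  case False
  define diff where "diff n = (if n = 0 then f else if n = 1 then f' else f'')" for n :: nat
  have "\<exists>t. (if x + v < x then x + v < t \<and> t < x else x < t \<and> t < x + v) \<and>
      f (x + v) = (\<Sum>i<2. diff i x / fact i * (x + v - x) ^ i) + diff 2 t / fact 2 * (x + v - x)\<^sup>2"
    by (rule Taylor[where a = "x - \<bar>v\<bar>" and b = "x + \<bar>v\<bar>"])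
       (use False f_deriv f'_deriv in \<open>auto simp: diff_def less_Suc_eq numeral_2_eq_2\<close>)
  then obtain t where t: "if x + v < x then x + v < t \<and> t < x else x < t \<and> t < x + v"
    "f (x + v) = f x + f' x * v + f'' t / 2 * v\<^sup>2"
    by (auto simp: diff_def numeral_2_eq_2)
  then show ?thesis by (intro exI[of _ "t - x"]) (auto split: if_splits)
qed (auto intro!: exI[of _ 0])

text \<open>The coefficients \<open>a\<close>, \<open>b\<close> belong to the value \<open>z\<close>
  of the solution, while the expansion is made at the position \<open>x\<close> of the scheme. The
  supersolution inequality holds at \<open>z\<close>; the moduli carry it to \<open>x\<close> at the
  cost \<open>\<eta> + C * trunc_sq (x - z)\<close>. The terms in \<open>\<xi>\<close> and in
  \<open>\<xi>^2 - d\<close> are kept exact, since their means vanish after multiplication by a past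
  factor. The fourth power arises because the modulus of \<open>f''\<close> at the intermediate
  point contributes \<open>v^2\<close>, which meets the factor \<open>v^2\<close> of the
  remainder.\<close>

lemma step_bound:
  assumes z: "z \<in> {0..m}" and super: "f' z * a + f'' z * b\<^sup>2 / 2 - r * f z \<le> 0"
    and mod: "\<And>x. \<bar>f x - f z\<bar> \<le> \<eta> + C * trunc_sq (x - z)" "\<And>x. \<bar>f' x - f' z\<bar> \<le> \<eta> + C * trunc_sq (x - z)"
      "\<And>x. \<bar>f'' x - f'' z\<bar> \<le> \<eta> + C * trunc_sq (x - z)"
    and C: "C \<ge> 0" and eta: "\<eta> \<ge> 0" and d: "0 < d" "r * d \<le> 1" and r: "r > 0"
    and ab: "\<bar>a\<bar> \<le> Ca" "\<bar>b\<bar> \<le> Cb"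
  shows "exp (r * d) * (exp (- r * d) * f (x + (a * d + b * \<xi>)) - f x) \<le>
     d * (Ca + Cb\<^sup>2 / 2 + r) * (\<eta> + C * trunc_sq (x - z))
     + \<xi> * (f' x * b + f'' x * a * b * d) + f'' x * b\<^sup>2 / 2 * (\<xi>\<^sup>2 - d)
     + (K * Ca\<^sup>2 / 2 + K * r\<^sup>2) * d\<^sup>2
     + (\<eta> + 3 / 2 * C * trunc_sq (x - z)) * (2 * Ca\<^sup>2 * d\<^sup>2 + 2 * Cb\<^sup>2 * \<xi>\<^sup>2)
     + 8 * C * (Ca ^ 4 * d ^ 4 + Cb ^ 4 * \<xi> ^ 4)"
proof -
  define v where "v = a * d + b * \<xi>"
  define N where "N = trunc_sq (x - z)"
  have N0: "N \<ge> 0" unfolding N_def by simp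
  obtain w where w: "\<bar>w\<bar> \<le> \<bar>v\<bar>" "f (x + v) = f x + f' x * v + f'' (x + w) / 2 * v\<^sup>2"
    using taylor2 by blast
  define R where "R = (f'' (x + w) - f'' x) / 2 * v\<^sup>2"
  have fx: "f (x + v) = f x + f' x * v + f'' x / 2 * v\<^sup>2 + R"
    unfolding R_def w(2) by (simp add: field_simps)
  have Ca0: "0 \<le> Ca" "0 \<le> Cb" using ab by auto
  have a2: "a\<^sup>2 \<le> Ca\<^sup>2" "b\<^sup>2 \<le> Cb\<^sup>2"
    using ab Ca0 by (auto intro: abs_le_square_iff[THEN iffD1])
  have a4: "a ^ 4 \<le> Ca ^ 4" "b ^ 4 \<le> Cb ^ 4"
    using power_mono[OF a2(1), of 2] power_mono[OF a2(2), of 2] by (auto simp: power_mult[symmetric])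
  have v2: "v\<^sup>2 \<le> 2 * Ca\<^sup>2 * d\<^sup>2 + 2 * Cb\<^sup>2 * \<xi>\<^sup>2"
  proof -
    have "v\<^sup>2 \<le> 2 * (a * d)\<^sup>2 + 2 * (b * \<xi>)\<^sup>2"
      unfolding v_def using sum_squares_bound[of "a * d" "b * \<xi>"] by (simp add: power2_sum)
    moreover have "(a * d)\<^sup>2 \<le> Ca\<^sup>2 * d\<^sup>2" "(b * \<xi>)\<^sup>2 \<le> Cb\<^sup>2 * \<xi>\<^sup>2"
      using a2 by (auto simp: power_mult_distrib intro: mult_right_mono)
    ultimately show ?thesis by linarith
  qed
  have v4: "v ^ 4 \<le> 8 * (Ca ^ 4 * d ^ 4 + Cb ^ 4 * \<xi> ^ 4)"
  proof -
    have "v ^ 4 = (v\<^sup>2)\<^sup>2" by (simp add: power_mult[symmetric])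
    also have "\<dots> \<le> (2 * Ca\<^sup>2 * d\<^sup>2 + 2 * Cb\<^sup>2 * \<xi>\<^sup>2)\<^sup>2"
      using v2 by (intro power_mono) auto
    also have "\<dots> \<le> 2 * (2 * Ca\<^sup>2 * d\<^sup>2)\<^sup>2 + 2 * (2 * Cb\<^sup>2 * \<xi>\<^sup>2)\<^sup>2"
      using sum_squares_bound[of "2 * Ca\<^sup>2 * d\<^sup>2" "2 * Cb\<^sup>2 * \<xi>\<^sup>2"] by (simp add: power2_sum)
    also have "\<dots> = 8 * (Ca ^ 4 * d ^ 4 + Cb ^ 4 * \<xi> ^ 4)"
      by (simp add: power_mult_distrib power_mult[symmetric] algebra_simps)
    finally show ?thesis .
  qed
  \<comment> \<open>The factor 3 is 2 + 1: \<open>x + w - z\<close> contributes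
    \<open>2 * N + 2 * v^2\<close> by the quasi-triangle inequality, and \<open>x - z\<close>
    contributes another \<open>N\<close>.\<close>
  have R: "R \<le> (\<eta> + 3 / 2 * C * N) * v\<^sup>2 + C * v ^ 4"
  proof -
    have "trunc_sq (x + w - z) \<le> 2 * N + 2 * v\<^sup>2"
    proof -
      have "trunc_sq (x + w - z) \<le> 2 * N + 2 * trunc_sq w"
        using trunc_sq_add[of "x - z" w] unfolding N_def by (simp add: algebra_simps)
      moreover have "trunc_sq w \<le> v\<^sup>2" using w(1) by (meson abs_le_square_iff min.coboundedI2)
      ultimately show ?thesis by linarith
    qed
    then have "C * trunc_sq (x + w - z) \<le> C * (2 * N + 2 * v\<^sup>2)" using C by (rule mult_left_mono)
    then have "f'' (x + w) - f'' x \<le> 2 * \<eta> + C * (3 * N + 2 * v\<^sup>2)"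
      using mod(3)[of "x + w"] mod(3)[of x] unfolding N_def[symmetric] by (simp add: algebra_simps abs_le_iff)
    then have "R \<le> (2 * \<eta> + C * (3 * N + 2 * v\<^sup>2)) / 2 * v\<^sup>2"
      unfolding R_def by (intro mult_right_mono divide_right_mono) auto
    also have "\<dots> = (\<eta> + 3 / 2 * C * N) * v\<^sup>2 + C * v ^ 4"
      by (simp add: field_simps power_add[symmetric] flip: power2_eq_square)
    finally show ?thesis .
  qed
  also have "\<dots> \<le> (\<eta> + 3 / 2 * C * N) * (2 * Ca\<^sup>2 * d\<^sup>2 + 2 * Cb\<^sup>2 * \<xi>\<^sup>2) + 8 * C * (Ca ^ 4 * d ^ 4 + Cb ^ 4 * \<xi> ^ 4)"
  proof (rule add_mono)
    show "C * v ^ 4 \<le> 8 * C * (Ca ^ 4 * d ^ 4 + Cb ^ 4 * \<xi> ^ 4)"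
      using mult_left_mono[OF v4 C] by (simp only: mult.assoc mult.left_commute[of C])
  qed (use v2 C eta N0 in \<open>auto intro!: mult_left_mono\<close>)
  finally have R': "R \<le> (\<eta> + 3 / 2 * C * N) * (2 * Ca\<^sup>2 * d\<^sup>2 + 2 * Cb\<^sup>2 * \<xi>\<^sup>2) + 8 * C * (Ca ^ 4 * d ^ 4 + Cb ^ 4 * \<xi> ^ 4)" .
  have gen: "f' x * a + f'' x * b\<^sup>2 / 2 - r * f x \<le> (Ca + Cb\<^sup>2 / 2 + r) * (\<eta> + C * N)"
  proof -
    have "f' x * a + f'' x * b\<^sup>2 / 2 - r * f x \<le> (f' x - f' z) * a + (f'' x - f'' z) * (b\<^sup>2 / 2) + r * (f z - f x)"
      using super by (simp add: field_simps)
    also have "\<dots> \<le> (\<eta> + C * N) * Ca + (\<eta> + C * N) * (Cb\<^sup>2 / 2) + r * (\<eta> + C * N)"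
    proof (intro add_mono)
      have "(f' x - f' z) * a \<le> \<bar>f' x - f' z\<bar> * \<bar>a\<bar>" by (metis abs_ge_self abs_mult)
      also have "\<dots> \<le> (\<eta> + C * N) * Ca" using mod(2)[of x] ab(1) unfolding N_def by (intro mult_mono) auto
      finally show "(f' x - f' z) * a \<le> (\<eta> + C * N) * Ca" .
      have "(f'' x - f'' z) * (b\<^sup>2 / 2) \<le> \<bar>f'' x - f'' z\<bar> * (b\<^sup>2 / 2)" by (intro mult_right_mono) auto
      also have "\<dots> \<le> (\<eta> + C * N) * (Cb\<^sup>2 / 2)" using mod(3)[of x] a2(2) unfolding N_def by (intro mult_mono) auto
      finally show "(f'' x - f'' z) * (b\<^sup>2 / 2) \<le> (\<eta> + C * N) * (Cb\<^sup>2 / 2)" .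
      show "r * (f z - f x) \<le> r * (\<eta> + C * N)" using mod(1)[of x] r unfolding N_def by (intro mult_left_mono) auto
    qed
    finally show ?thesis by (simp add: algebra_simps)
  qed
  have ex: "0 \<le> exp (r * d) - 1 - r * d" "exp (r * d) - 1 - r * d \<le> r\<^sup>2 * d\<^sup>2"
  proof -
    have "1 + r * d \<le> exp (r * d)" by (rule exp_ge_add_one_self)
    then show "0 \<le> exp (r * d) - 1 - r * d" by linarith
    have "exp (r * d) \<le> 1 + r * d + (r * d)\<^sup>2" using d r by (intro exp_bound) auto
    then show "exp (r * d) - 1 - r * d \<le> r\<^sup>2 * d\<^sup>2" by (simp add: power_mult_distrib)
  qed
  have exf: "- (exp (r * d) - 1 - r * d) * f x \<le> K * r\<^sup>2 * d\<^sup>2"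
  proof -
    have "- (exp (r * d) - 1 - r * d) * f x \<le> (exp (r * d) - 1 - r * d) * K"
      using mult_left_mono[OF _ ex(1), of "- f x" K] f_bound[of x] by (auto simp: abs_le_iff algebra_simps)
    also have "\<dots> \<le> r\<^sup>2 * d\<^sup>2 * K" using ex(2) K_nonneg by (rule mult_right_mono)
    finally show ?thesis by (simp add: mult_ac)
  qed
  have f2: "f'' x * a\<^sup>2 / 2 * d\<^sup>2 \<le> K * Ca\<^sup>2 / 2 * d\<^sup>2"
  proof -
    have "f'' x * a\<^sup>2 \<le> K * a\<^sup>2" using f''_bound[of x] by (intro mult_right_mono) auto
    also have "\<dots> \<le> K * Ca\<^sup>2" using a2(1) K_nonneg by (rule mult_left_mono)
    finally have "f'' x * a\<^sup>2 \<le> K * Ca\<^sup>2" .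
    then show ?thesis by (intro mult_right_mono divide_right_mono) auto
  qed
  \<comment> \<open>The factor \<open>exp (r * d)\<close> takes the discount off the new value, so
    that only \<open>f (x + v)\<close> is expanded; the exponential left on \<open>f x\<close> is
    linearised using \<open>r * d \<le> 1\<close>.\<close>
  have "exp (r * d) * (exp (- r * d) * f (x + v) - f x) = f (x + v) - exp (r * d) * f x"
    by (simp add: right_diff_distrib mult.assoc[symmetric] exp_add[symmetric])
  also have "\<dots> = d * (f' x * a + f'' x * b\<^sup>2 / 2 - r * f x) + \<xi> * (f' x * b + f'' x * a * b * d)
     + f'' x * b\<^sup>2 / 2 * (\<xi>\<^sup>2 - d) + f'' x * a\<^sup>2 / 2 * d\<^sup>2 + R + (- (exp (r * d) - 1 - r * d) * f x)"
    unfolding fx by (simp add: v_def field_simps power2_eq_square)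
  also have "\<dots> \<le> d * ((Ca + Cb\<^sup>2 / 2 + r) * (\<eta> + C * N)) + \<xi> * (f' x * b + f'' x * a * b * d)
     + f'' x * b\<^sup>2 / 2 * (\<xi>\<^sup>2 - d) + K * Ca\<^sup>2 / 2 * d\<^sup>2
     + ((\<eta> + 3 / 2 * C * N) * (2 * Ca\<^sup>2 * d\<^sup>2 + 2 * Cb\<^sup>2 * \<xi>\<^sup>2) + 8 * C * (Ca ^ 4 * d ^ 4 + Cb ^ 4 * \<xi> ^ 4))
     + K * r\<^sup>2 * d\<^sup>2"
    using gen d(1) R' exf f2 by (intro add_mono mult_left_mono order_refl) auto
  finally show ?thesis unfolding v_def N_def by (simp add: algebra_simps)
qed

end

section \<open>Brownian increments\<close>

lemma space_nat_filtration[simp]: "space (nat_filtration M B t) = space M"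
  unfolding nat_filtration_def by (auto simp: space_measure_of_conv)

lemma sets_nat_filtration:
  "sets (nat_filtration M B t) =
     sigma_sets (space M) (\<Union>s\<in>{0..t}. {B s -` A \<inter> space M | A. A \<in> sets borel})"
  unfolding nat_filtration_def by (subst sets_measure_of) auto

lemma nat_filtration_subset:
  assumes "\<And>s. B s \<in> borel_measurable M"
  shows "sets (nat_filtration M B t) \<subseteq> sets M"
  unfolding sets_nat_filtration
  by (rule sets.sigma_sets_subset) (use assms in \<open>auto intro: measurable_sets\<close>)

lemma nat_filtration_mono:
  assumes "s \<le> t"
  shows "sets (nat_filtration M B s) \<subseteq> sets (nat_filtration M B t)"
  unfolding sets_nat_filtration by (rule sigma_sets_mono', rule UN_mono) (use assms in auto)

lemma measurable_nat_filtration_mono: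
  assumes "s \<le> t" "X \<in> borel_measurable (nat_filtration M B s)"
  shows "X \<in> borel_measurable (nat_filtration M B t)"
proof (rule measurableI)
  fix A :: "'b set" assume "A \<in> sets borel"
  then have "X -` A \<inter> space (nat_filtration M B s) \<in> sets (nat_filtration M B s)"
    by (rule measurable_sets[OF assms(2)])
  then show "X -` A \<inter> space (nat_filtration M B t) \<in> sets (nat_filtration M B t)"
    using nat_filtration_mono[OF assms(1), of M B] by auto
qed simp

lemma measurable_nat_filtration:
  assumes "\<And>s. B s \<in> borel_measurable M" "X \<in> borel_measurable (nat_filtration M B s)"
  shows "X \<in> borel_measurable M"
proof (rule measurableI)
  fix A :: "'b set" assume "A \<in> sets borel"
  then have "X -` A \<inter> space (nat_filtration M B s) \<in> sets (nat_filtration M B s)"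
    by (rule measurable_sets[OF assms(2)])
  then show "X -` A \<inter> space M \<in> sets M"
    using nat_filtration_subset[of B M s] assms(1) by auto
qed simp

lemma measurable_nat_filtration_B:
  assumes "0 \<le> s" "s \<le> t"
  shows "B s \<in> borel_measurable (nat_filtration M B t)"
proof (rule measurableI)
  fix A :: "real set" assume "A \<in> sets borel"
  with assms show "B s -` A \<inter> space (nat_filtration M B t) \<in> sets (nat_filtration M B t)"
    unfolding sets_nat_filtration by (auto intro!: sigma_sets.Basic bexI[of _ s] exI[of _ A])
qed simp

section \<open>Independence of the next increment from the past\<close>

locale brownian = prob_space M for M :: "'a measure" +
  fixes B :: "real \<Rightarrow> 'a \<Rightarrow> real"
  assumes bm: "std_brownian_motion M B"
begin

abbreviation "\<F> t \<equiv> nat_filtration M B t"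

lemma B_meas[measurable]: "B t \<in> borel_measurable M"
  using bm by (simp add: std_brownian_motion_def)

lemma B_zero: "\<omega> \<in> space M \<Longrightarrow> B 0 \<omega> = 0"
  using bm by (simp add: std_brownian_motion_def)

lemma B_incr: "0 \<le> s \<Longrightarrow> s < t \<Longrightarrow>
   distributed M lborel (\<lambda>\<omega>. B t \<omega> - B s \<omega>) (normal_density 0 (sqrt (t - s)))"
  using bm unfolding std_brownian_motion_def by blast

lemma B_indep:
  assumes "0 \<le> ts 0" "\<And>i. i < n \<Longrightarrow> ts i < ts (Suc i)"
  shows "indep_vars (\<lambda>_. borel) (\<lambda>i \<omega>. B (ts (Suc i)) \<omega> - B (ts i) \<omega>) {..<n::nat}"
  using bm assms unfolding std_brownian_motion_def by blast

text \<open>Finite-dimensional cylinder events, a pi-system generating the past up to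
  \<open>s\<close>. \<open>J\<close> is nonempty because an empty intersection would be
  \<open>UNIV\<close> instead of the sample space.\<close>

definition cyl :: "real \<Rightarrow> 'a set set" where
  "cyl s = {\<Inter>u\<in>J. B u -` A u \<inter> space M | J A. finite J \<and> J \<noteq> {} \<and> J \<subseteq> {0..s} \<and> (\<forall>u. A u \<in> sets borel)}"

lemma Int_stable_cyl: "Int_stable (cyl s)"
proof (rule Int_stableI)
  fix a b assume "a \<in> cyl s" "b \<in> cyl s"
  then obtain J A J' A' where J: "finite J" "J \<noteq> {}" "J \<subseteq> {0..s}" "\<And>u. A u \<in> sets borel" "a = (\<Inter>u\<in>J. B u -` A u \<inter> space M)"
    and J': "finite J'" "J' \<noteq> {}" "J' \<subseteq> {0..s}" "\<And>u. A' u \<in> sets borel" "b = (\<Inter>u\<in>J'. B u -` A' u \<inter> space M)"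
    unfolding cyl_def by blast
  define C where "C u = (if u \<in> J then A u else UNIV) \<inter> (if u \<in> J' then A' u else UNIV)" for u
  have "a \<inter> b = (\<Inter>u\<in>J \<union> J'. B u -` C u \<inter> space M)"
    unfolding J(5) J'(5) C_def using J(2) J'(2) by (auto split: if_splits)
  moreover have "\<And>u. C u \<in> sets borel" unfolding C_def using J(4) J'(4) by auto
  ultimately show "a \<inter> b \<in> cyl s" unfolding cyl_def using J J'
    by (auto intro!: exI[of _ "J \<union> J'"] exI[of _ C])
qed

lemma sets_filtration_cyl: "0 \<le> s \<Longrightarrow> sets (\<F> s) = sigma_sets (space M) (cyl s)"
proof (rule antisym)
  show "sets (\<F> s) \<subseteq> sigma_sets (space M) (cyl s)"
    unfolding sets_nat_filtration
  proof (rule sigma_sets_mono, safe)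
    fix u A assume "u \<in> {0..s}" "A \<in> sets (borel::real measure)"
    then have "B u -` A \<inter> space M \<in> cyl s" unfolding cyl_def
      by (auto intro!: exI[of _ "{u}"] exI[of _ "\<lambda>_. A"])
    then show "B u -` A \<inter> space M \<in> sigma_sets (space M) (cyl s)" by (rule sigma_sets.Basic)
  qed
  show "sigma_sets (space M) (cyl s) \<subseteq> sets (\<F> s)"
  proof -
    have "cyl s \<subseteq> sets (\<F> s)"
    proof
      fix a assume "a \<in> cyl s"
      then obtain J A where J: "finite J" "J \<noteq> {}" "J \<subseteq> {0..s}" "\<And>u. A u \<in> sets borel" "a = (\<Inter>u\<in>J. B u -` A u \<inter> space M)"
        unfolding cyl_def by blast
      have "B u -` A u \<inter> space M \<in> sets (\<F> s)" if "u \<in> J" for u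
        using measurable_sets[OF measurable_nat_filtration_B[of u s B M] J(4)[of u]] J(3) that by auto
      then show "a \<in> sets (\<F> s)" unfolding J(5) using J(1,2) by (intro sets.finite_INT) auto
    qed
    from sets.sigma_sets_subset[OF this] show ?thesis by simp
  qed
qed

text \<open>Since \<open>B\<close> starts at 0, its values at the sorted times of the cylinder are
  partial sums of successive increments. The cylinder is therefore an event of the earlier
  increments, and the increment from \<open>s\<close> to \<open>t\<close> is the next one in the
  same independent family.\<close>

lemma cyl_indep_incr:
  assumes "0 \<le> s" "s < t" "a \<in> cyl s" "C \<in> sets borel"
  shows "prob (a \<inter> ((\<lambda>\<omega>. B t \<omega> - B s \<omega>) -` C \<inter> space M)) =
    prob a * prob ((\<lambda>\<omega>. B t \<omega> - B s \<omega>) -` C \<inter> space M)"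
proof -
  obtain J A where J: "finite J" "J \<noteq> {}" "J \<subseteq> {0..s}" "\<And>u. A u \<in> sets borel" "a = (\<Inter>u\<in>J. B u -` A u \<inter> space M)"
    using assms unfolding cyl_def by blast
  \<comment> \<open>The added times are 0, so that values become sums of increments, and
    \<open>s\<close>, so that the last increment starts exactly at \<open>s\<close>.\<close>
  define xs where "xs = sorted_list_of_set (J \<union> {0, s})"
  have fin: "finite (J \<union> {0, s})" using J by auto
  have xs: "sorted xs" "distinct xs" "set xs = J \<union> {0, s}"
    unfolding xs_def by (rule sorted_sorted_list_of_set distinct_sorted_list_of_set set_sorted_list_of_set[OF fin])+
  have sx: "sorted_wrt (<) xs" using xs by (simp add: strict_sorted_iff)
  define n where "n = length xs - 1"
  have len: "length xs = Suc n" using xs(3) unfolding n_def by (cases xs) auto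
  have lt: "xs ! i < xs ! j" if "i < j" "j \<le> n" for i j
    using sx len that by (simp add: sorted_wrt_nth_less)
  have rng: "0 \<le> xs ! i \<and> xs ! i \<le> s" if "i \<le> n" for i
    using nth_mem[of i xs] that len xs(3) J(3) assms(1) by auto
  have x0: "xs ! 0 = 0"
  proof -
    obtain i where "i \<le> n" "xs ! i = 0" proof -
      have "0 \<in> set xs" using xs(3) by auto
      then show ?thesis using that len unfolding in_set_conv_nth by (auto simp: less_Suc_eq_le)
    qed
    then show ?thesis using lt[of 0 i] rng[of 0] by (cases "i = 0") auto
  qed
  have xn: "xs ! n = s"
  proof -
    obtain i where "i \<le> n" "xs ! i = s" proof -
      have "s \<in> set xs" using xs(3) by auto
      then show ?thesis using that len unfolding in_set_conv_nth by (auto simp: less_Suc_eq_le)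
    qed
    then show ?thesis using lt[of i n] rng[of n] by (cases "i = n") auto
  qed
  define ts where "ts i = (if i \<le> n then xs ! i else t)" for i
  define D where "D i \<omega> = B (ts (Suc i)) \<omega> - B (ts i) \<omega>" for i \<omega>
  have ind: "indep_vars (\<lambda>_. borel) D {..<Suc n}"
    unfolding D_def
  proof (rule B_indep)
    show "0 \<le> ts 0" unfolding ts_def using x0 by simp
    fix i assume "i < Suc n"
    then show "ts i < ts (Suc i)"
      using lt[of i "Suc i"] xn assms(2) unfolding ts_def by (cases "i = n") auto
  qed
  have Bsum: "B (xs ! i) \<omega> = (\<Sum>j<i. D j \<omega>)" if "\<omega> \<in> space M" "i \<le> n" for i \<omega>
    using that(2)
  proof (induction i)
    case 0 then show ?case using x0 B_zero that by simp
  next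
    case (Suc i) then show ?case unfolding D_def ts_def by simp
  qed
  have Dn: "D n = (\<lambda>\<omega>. B t \<omega> - B s \<omega>)" unfolding D_def ts_def using xn by (auto simp: fun_eq_iff)
  have iv: "indep_var (PiM {..<n} (\<lambda>_. borel)) (\<lambda>\<omega>. restrict (\<lambda>i. D i \<omega>) {..<n})
      (PiM {n} (\<lambda>_. borel)) (\<lambda>\<omega>. restrict (\<lambda>i. D i \<omega>) {n})"
    by (rule indep_var_restrict[OF ind]) auto
  \<comment> \<open>The cylinder rewritten in the increments. The premise
    \<open>xs ! i \<in> J\<close> spares the auxiliary times 0 and \<open>s\<close>, which may carry
    no constraint.\<close>
  define E where "E = {x \<in> space (PiM {..<n} (\<lambda>_. borel :: real measure)). \<forall>i\<in>{..n}. xs ! i \<in> J \<longrightarrow> (\<Sum>j<i. x j) \<in> A (xs ! i)}"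
  have Em: "E \<in> sets (PiM {..<n} (\<lambda>_. borel))"
  proof -
    have m: "(\<lambda>x. \<Sum>j<i. x j) \<in> borel_measurable (PiM {..<n} (\<lambda>_. borel :: real measure))" if "i \<le> n" for i
      using that by (intro borel_measurable_sum measurable_component_singleton) auto
    have "{x \<in> space (PiM {..<n} (\<lambda>_. borel :: real measure)). xs ! i \<in> J \<longrightarrow> (\<Sum>j<i. x j) \<in> A (xs ! i)} \<in> sets (PiM {..<n} (\<lambda>_. borel))"
      if "i \<in> {..n}" for i
    proof (cases "xs ! i \<in> J")
      case True
      have "i \<le> n" using that by simp
      from measurable_sets[OF m[OF this] J(4)[of "xs ! i"]] show ?thesis
        using True by (simp add: vimage_def Int_def conj_commute)
    qed simp
    then show ?thesis unfolding E_def by (intro sets.sets_Collect_finite_All') auto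
  qed
  define C' where "C' = {x \<in> space (PiM {n} (\<lambda>_. borel :: real measure)). x n \<in> C}"
  have Cm: "C' \<in> sets (PiM {n} (\<lambda>_. borel))"
    using measurable_sets[OF measurable_component_singleton[of n "{n}" "\<lambda>_. borel :: real measure"] assms(4)]
    by (simp add: C'_def vimage_def Int_def conj_commute)
  have a_eq: "a = (\<lambda>\<omega>. restrict (\<lambda>i. D i \<omega>) {..<n}) -` E \<inter> space M"
  proof (rule set_eqI)
    fix \<omega>
    have "\<omega> \<in> a \<longleftrightarrow> \<omega> \<in> space M \<and> (\<forall>u\<in>J. B u \<omega> \<in> A u)" unfolding J(5) using J(2) by auto
    also have "\<dots> \<longleftrightarrow> \<omega> \<in> space M \<and> (\<forall>i\<in>{..n}. xs ! i \<in> J \<longrightarrow> B (xs ! i) \<omega> \<in> A (xs ! i))"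
    proof -
      have "\<exists>i\<in>{..n}. u = xs ! i" if "u \<in> J" for u
      proof -
        have "u \<in> set xs" using xs(3) that by auto
        then show ?thesis using len unfolding in_set_conv_nth by (auto simp: less_Suc_eq_le)
      qed
      then show ?thesis by blast
    qed
    also have "\<dots> \<longleftrightarrow> \<omega> \<in> (\<lambda>\<omega>. restrict (\<lambda>i. D i \<omega>) {..<n}) -` E \<inter> space M"
      unfolding E_def by (auto simp: Bsum space_PiM)
    finally show "\<omega> \<in> a \<longleftrightarrow> \<omega> \<in> (\<lambda>\<omega>. restrict (\<lambda>i. D i \<omega>) {..<n}) -` E \<inter> space M" .
  qed
  have c_eq: "(\<lambda>\<omega>. B t \<omega> - B s \<omega>) -` C \<inter> space M = (\<lambda>\<omega>. restrict (\<lambda>i. D i \<omega>) {n}) -` C' \<inter> space M"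
    unfolding C'_def by (auto simp: space_PiM Dn)
  show ?thesis unfolding a_eq c_eq
  proof -
    let ?f = "\<lambda>\<omega>. restrict (\<lambda>i. D i \<omega>) {..<n}" and ?g = "\<lambda>\<omega>. restrict (\<lambda>i. D i \<omega>) {n}"
    have "(\<lambda>\<omega>. (?f \<omega>, ?g \<omega>)) -` (E \<times> C') \<inter> space M = (?f -` E \<inter> space M) \<inter> (?g -` C' \<inter> space M)"
      by auto
    with indep_varD[OF iv Em Cm] show "prob ((?f -` E \<inter> space M) \<inter> (?g -` C' \<inter> space M)) =
      prob (?f -` E \<inter> space M) * prob (?g -` C' \<inter> space M)" by simp
  qed
qed

text \<open>Independence extends from two intersection-stable families to the sigma-algebras that
  they generate.\<close>

lemma indep_incr:
  assumes "0 \<le> s" "s < t" "X \<in> borel_measurable (\<F> s)"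
  shows "indep_var borel X borel (\<lambda>\<omega>. B t \<omega> - B s \<omega>)"
proof -
  let ?\<xi> = "\<lambda>\<omega>. B t \<omega> - B s \<omega>"
  let ?G = "{?\<xi> -` A \<inter> space M | A. A \<in> sets borel}"
  have cylM: "cyl s \<subseteq> sets M"
    using nat_filtration_subset[of B M s] sets_filtration_cyl[OF assms(1)] by auto
  have "indep_set (cyl s) ?G"
  proof (rule indep_setI)
    show "?G \<subseteq> events" by auto
    fix a b assume "a \<in> cyl s" "b \<in> ?G"
    then show "prob (a \<inter> b) = prob a * prob b"
      using cyl_indep_incr[OF assms(1,2)] by auto
  qed (rule cylM)
  moreover have "Int_stable ?G"
  proof (rule Int_stableI, safe)
    fix A C assume "A \<in> sets (borel::real measure)" "C \<in> sets (borel::real measure)"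
    then show "\<exists>D. (?\<xi> -` A \<inter> space M) \<inter> (?\<xi> -` C \<inter> space M) = ?\<xi> -` D \<inter> space M \<and> D \<in> sets borel"
      by (intro exI[of _ "A \<inter> C"]) auto
  qed
  ultimately have *: "indep_set (sigma_sets (space M) (cyl s)) (sigma_sets (space M) ?G)"
    by (intro indep_set_sigma_sets Int_stable_cyl)
  have XM: "X \<in> borel_measurable M" by (rule measurable_nat_filtration[OF B_meas assms(3)])
  have "sigma_sets (space M) {X -` A \<inter> space M | A. A \<in> sets borel} \<subseteq> sigma_sets (space M) (cyl s)"
  proof (rule sigma_sets_mono, safe)
    fix A assume "A \<in> sets (borel::real measure)"
    from measurable_sets[OF assms(3) this] show "X -` A \<inter> space M \<in> sigma_sets (space M) (cyl s)"
      using sets_filtration_cyl[OF assms(1)] by simp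
  qed
  then have "indep_set (sigma_sets (space M) {X -` A \<inter> space M | A. A \<in> sets borel}) (sigma_sets (space M) ?G)"
    using * unfolding indep_set_def
    by (auto intro!: indep_sets_mono_sets[where F="case_bool (sigma_sets (space M) (cyl s)) (sigma_sets (space M) ?G)"] split: bool.splits)
  then show ?thesis unfolding indep_var_eq using XM by simp
qed

section \<open>Gaussian moments of the increments\<close>

lemma incr_power:
  assumes "0 \<le> s" "s < t"
  shows "integrable M (\<lambda>\<omega>. (B t \<omega> - B s \<omega>) ^ k)"
    and "expectation (\<lambda>\<omega>. (B t \<omega> - B s \<omega>) ^ k) = (\<integral>x. normal_density 0 (sqrt (t - s)) x * x ^ k \<partial>lborel)"
proof -
  note D = B_incr[OF assms]
  show "integrable M (\<lambda>\<omega>. (B t \<omega> - B s \<omega>) ^ k)"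
    using distributed_integrable[OF D, of "\<lambda>x. x ^ k"] integrable_normal_moment[of "sqrt (t - s)" 0 k] assms by simp
  show "expectation (\<lambda>\<omega>. (B t \<omega> - B s \<omega>) ^ k) = (\<integral>x. normal_density 0 (sqrt (t - s)) x * x ^ k \<partial>lborel)"
    using distributed_integral[OF D, of "\<lambda>x. x ^ k"] by simp
qed

lemma incr_moments:
  assumes "0 \<le> s" "s < t"
  shows "expectation (\<lambda>\<omega>. B t \<omega> - B s \<omega>) = 0"
    and "expectation (\<lambda>\<omega>. (B t \<omega> - B s \<omega>)\<^sup>2) = t - s"
    and "expectation (\<lambda>\<omega>. (B t \<omega> - B s \<omega>) ^ 4) = 3 * (t - s)\<^sup>2"
proof -
  have p: "0 < sqrt (t - s)" using assms by simp
  show "expectation (\<lambda>\<omega>. B t \<omega> - B s \<omega>) = 0"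
    using incr_power(2)[OF assms, of 1] integral_normal_moment_odd[OF p, of 0 0] by simp
  show "expectation (\<lambda>\<omega>. (B t \<omega> - B s \<omega>)\<^sup>2) = t - s"
    using incr_power(2)[OF assms, of 2] integral_normal_moment_even[OF p, of 0 1] assms by simp
  show "expectation (\<lambda>\<omega>. (B t \<omega> - B s \<omega>) ^ 4) = 3 * (t - s)\<^sup>2"
    using incr_power(2)[OF assms, of 4] integral_normal_moment_even[OF p, of 0 2] assms
    by (simp add: fact_numeral power_divide)
qed

text \<open>This stands in for conditioning on the past: every term of the Taylor step is a past
  factor times a power of the next increment.\<close>

lemma expectation_mult_incr_power:
  assumes "0 \<le> s" "s < t" "X \<in> borel_measurable (\<F> s)" "integrable M X"
  shows "integrable M (\<lambda>\<omega>. X \<omega> * (B t \<omega> - B s \<omega>) ^ k)"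
    and "expectation (\<lambda>\<omega>. X \<omega> * (B t \<omega> - B s \<omega>) ^ k) = expectation X * expectation (\<lambda>\<omega>. (B t \<omega> - B s \<omega>) ^ k)"
proof -
  have "indep_var borel ((\<lambda>x. x) \<circ> X) borel ((\<lambda>x. x ^ k) \<circ> (\<lambda>\<omega>. B t \<omega> - B s \<omega>))"
    by (rule indep_var_compose[OF indep_incr[OF assms(1-3)]]) auto
  then have i: "indep_var borel X borel (\<lambda>\<omega>. (B t \<omega> - B s \<omega>) ^ k)" by (simp add: comp_def)
  show "integrable M (\<lambda>\<omega>. X \<omega> * (B t \<omega> - B s \<omega>) ^ k)"
    by (rule indep_var_integrable[OF i assms(4) incr_power(1)[OF assms(1,2)]])
  show "expectation (\<lambda>\<omega>. X \<omega> * (B t \<omega> - B s \<omega>) ^ k) = expectation X * expectation (\<lambda>\<omega>. (B t \<omega> - B s \<omega>) ^ k)"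
    by (rule indep_var_lebesgue_integral[OF i assms(4) incr_power(1)[OF assms(1,2)]])
qed

end

section \<open>Euler sums along the solution\<close>

locale cir = brownian M B for M :: "'a measure" and B +
  fixes \<mu> \<theta> \<sigma> y :: real and Y :: "real \<Rightarrow> 'a \<Rightarrow> real"
  assumes params: "\<mu> > 0" "\<theta> > 0" "\<sigma> > 0" "y \<ge> 0"
    and sol: "cir_solution M B \<mu> \<theta> \<sigma> y Y"
begin

lemma Y_meas[measurable]: "Y t \<in> borel_measurable M"
  using sol by (simp add: cir_solution_def)

lemma Y_zero: "\<omega> \<in> space M \<Longrightarrow> Y 0 \<omega> = y"
  and Y_cont: "\<omega> \<in> space M \<Longrightarrow> continuous_on {0..} (\<lambda>t. Y t \<omega>)"
  and Y_nonneg: "\<omega> \<in> space M \<Longrightarrow> 0 \<le> t \<Longrightarrow> 0 \<le> Y t \<omega>"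
  using sol by (auto simp: cir_solution_def)

text \<open>\<open>Y\<close> is adapted to the augmented filtration only, whereas the increments are independent of the raw one;
  \<open>Z t\<close> is a raw version of \<open>Y t\<close>.\<close>
definition Z :: "real \<Rightarrow> 'a \<Rightarrow> real" where
  "Z t = (SOME Z. Z \<in> borel_measurable (\<F> t) \<and> (AE \<omega> in M. Y t \<omega> = Z \<omega>))"

lemma Z_filt: "0 \<le> t \<Longrightarrow> Z t \<in> borel_measurable (\<F> t)"
  and Z_eq: "0 \<le> t \<Longrightarrow> AE \<omega> in M. Y t \<omega> = Z t \<omega>"
proof -
  assume "0 \<le> t"
  then have "\<exists>Z. Z \<in> borel_measurable (\<F> t) \<and> (AE \<omega> in M. Y t \<omega> = Z \<omega>)"
    using sol unfolding cir_solution_def adapted_aug_def by blast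
  from someI_ex[OF this] show "Z t \<in> borel_measurable (\<F> t)" "AE \<omega> in M. Y t \<omega> = Z t \<omega>"
    unfolding Z_def by auto
qed

lemma Z_meas[measurable]: "0 \<le> t \<Longrightarrow> Z t \<in> borel_measurable M"
  by (rule measurable_nat_filtration[OF B_meas Z_filt])

abbreviation "drift z \<equiv> \<mu> * (\<theta> - z)"
abbreviation "vol z \<equiv> \<sigma> * sqrt z"

definition incr :: "real \<Rightarrow> nat \<Rightarrow> 'a \<Rightarrow> real" where
  "incr \<delta> k \<omega> = B (real (Suc k) * \<delta>) \<omega> - B (real k * \<delta>) \<omega>"

lemma incr_meas[measurable]: "incr \<delta> k \<in> borel_measurable M"
  unfolding incr_def by measurable

text \<open>The coefficients are evaluated at \<open>Y\<close> itself, not at the previous Euler value.\<close>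
definition euler :: "real \<Rightarrow> nat \<Rightarrow> 'a \<Rightarrow> real" where
  "euler \<delta> k \<omega> = y + (\<Sum>i<k. drift (Y (real i * \<delta>) \<omega>) * \<delta> + vol (Y (real i * \<delta>) \<omega>) * incr \<delta> i \<omega>)"

lemma euler_meas[measurable]: "euler \<delta> k \<in> borel_measurable M"
  unfolding euler_def by measurable

section \<open>Truncated distances and their limits\<close>

abbreviation "tdist X X' \<equiv> expectation (\<lambda>\<omega>. trunc_sq (X \<omega> - X' \<omega>))"

lemma integrable_trunc: "X \<in> borel_measurable M \<Longrightarrow> integrable M (\<lambda>\<omega>. trunc_sq (X \<omega>))"
  by (rule integrable_const_bound[where B=1]) auto

lemma trunc_expectation_tendsto_AE:
  assumes "\<And>n. X n \<in> borel_measurable M" "\<And>\<omega>. \<omega> \<in> space M \<Longrightarrow> (\<lambda>n. X n \<omega>) \<longlonglongrightarrow> 0"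
  shows "(\<lambda>n. expectation (\<lambda>\<omega>. trunc_sq (X n \<omega>))) \<longlonglongrightarrow> 0"
proof -
  have "(\<lambda>n. expectation (\<lambda>\<omega>. trunc_sq (X n \<omega>))) \<longlonglongrightarrow> expectation (\<lambda>\<omega>. 0)"
  proof (rule integral_dominated_convergence[where w="\<lambda>_. 1"])
    show "AE \<omega> in M. (\<lambda>n. trunc_sq (X n \<omega>)) \<longlonglongrightarrow> 0"
    proof (rule AE_I2)
      fix \<omega> assume "\<omega> \<in> space M"
      from tendsto_min[OF tendsto_const[of 1] tendsto_power[OF assms(2)[OF this], of 2]]
      show "(\<lambda>n. trunc_sq (X n \<omega>)) \<longlonglongrightarrow> 0" by simp
    qed
  qed (use assms(1) in auto)
  then show ?thesis by simp
qed

text \<open>Split at \<epsilon>: below it the square is at most \<open>\<epsilon>^2\<close>, above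
  it the truncation is at most 1. This turns the convergence in probability of
  \<open>cir_solution\<close> into convergence of expectations.\<close>

lemma trunc_expectation_le:
  assumes [measurable]: "X \<in> borel_measurable M" and "\<epsilon> > 0"
  shows "expectation (\<lambda>\<omega>. trunc_sq (X \<omega>)) \<le> \<epsilon>\<^sup>2 + prob {\<omega> \<in> space M. \<bar>X \<omega>\<bar> > \<epsilon>}"
proof -
  define A where "A = {\<omega> \<in> space M. \<bar>X \<omega>\<bar> > \<epsilon>}"
  have A: "A \<in> events" unfolding A_def by measurable
  then have int: "integrable M (indicat_real A)" by (simp add: emeasure_eq_measure)
  have "expectation (\<lambda>\<omega>. trunc_sq (X \<omega>)) \<le> expectation (\<lambda>\<omega>. \<epsilon>\<^sup>2 + indicator A \<omega>)"
  proof (rule integral_mono)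
    show "trunc_sq (X \<omega>) \<le> \<epsilon>\<^sup>2 + indicator A \<omega>" if "\<omega> \<in> space M" for \<omega>
      using that assms(2) by (auto simp: A_def indicator_def min_le_iff_disj not_less power2_le_iff_abs_le)
  qed (use int in \<open>auto intro: integrable_trunc\<close>)
  also have "\<dots> = \<epsilon>\<^sup>2 + prob A"
    using int A by (subst Bochner_Integration.integral_add) (auto simp: prob_space)
  finally show ?thesis unfolding A_def .
qed

lemma trunc_expectation_tendsto_prob:
  assumes "\<And>n. X n \<in> borel_measurable M"
    "\<And>\<epsilon>. \<epsilon> > 0 \<Longrightarrow> (\<lambda>n. prob {\<omega> \<in> space M. \<bar>X n \<omega>\<bar> > \<epsilon>}) \<longlonglongrightarrow> 0"
  shows "(\<lambda>n. expectation (\<lambda>\<omega>. trunc_sq (X n \<omega>))) \<longlonglongrightarrow> 0"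
proof (rule LIMSEQ_I)
  fix e :: real assume e: "0 < e"
  define \<epsilon> where "\<epsilon> = sqrt (e / 2)"
  have eps: "\<epsilon> > 0" "\<epsilon>\<^sup>2 = e / 2" unfolding \<epsilon>_def using e by auto
  obtain N where N: "\<And>n. n \<ge> N \<Longrightarrow> prob {\<omega> \<in> space M. \<bar>X n \<omega>\<bar> > \<epsilon>} < e / 2"
    using LIMSEQ_D[OF assms(2)[OF eps(1)], of "e / 2"] e by auto
  have "norm (expectation (\<lambda>\<omega>. trunc_sq (X n \<omega>)) - 0) < e" if "n \<ge> N" for n
  proof -
    have "0 \<le> expectation (\<lambda>\<omega>. trunc_sq (X n \<omega>))" by (rule integral_nonneg_AE) auto
    with trunc_expectation_le[OF assms(1)[of n] eps(1)] N[OF that] eps(2) show ?thesis by simp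
  qed
  then show "\<exists>no. \<forall>n\<ge>no. norm (expectation (\<lambda>\<omega>. trunc_sq (X n \<omega>)) - 0) < e" by blast
qed

lemma drift_path_cont: "\<omega> \<in> space M \<Longrightarrow> continuous_on {0..t} (\<lambda>s. drift (Y s \<omega>))"
  by (intro continuous_intros continuous_on_subset[OF Y_cont]) auto

lemma drift_riemann: "\<omega> \<in> space M \<Longrightarrow> 0 \<le> t \<Longrightarrow>
    (\<lambda>n. \<Sum>k<n. drift (Y (real k * t / real n) \<omega>) * (t / real n)) \<longlonglongrightarrow> integral {0..t} (\<lambda>s. drift (Y s \<omega>))"
  by (intro riemann_sum_tendsto drift_path_cont)

text \<open>The integral inherits measurability as the pointwise limit of its Riemann sums.\<close>

lemma drift_integral_meas[measurable]:
  assumes "0 \<le> t"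
  shows "(\<lambda>\<omega>. integral {0..t} (\<lambda>s. drift (Y s \<omega>))) \<in> borel_measurable M"
  by (rule borel_measurable_LIMSEQ_real[OF drift_riemann]) (use assms in auto)

text \<open>The partition of \<open>[0, j * h]\<close> into \<open>j * l\<close> steps has mesh
  \<open>h / l\<close> for every \<open>j\<close>, so one and the same scheme serves all coarse
  times. Its error is \<open>P\<close>, the defect in the hypothesis on stochastic Riemann sums,
  plus \<open>Q\<close>, the pathwise Riemann error of the drift. The case \<open>j = 0\<close>
  stands apart because \<open>j * l\<close> is then no subsequence.\<close>

lemma euler_tendsto:
  assumes "0 < h"
  shows "(\<lambda>l. expectation (\<lambda>\<omega>. trunc_sq (euler (h / real l) (j * l) \<omega> - Y (real j * h) \<omega>))) \<longlonglongrightarrow> 0"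
proof (cases "j = 0")
  case True
  have "expectation (\<lambda>\<omega>. trunc_sq (euler (h / real l) (j * l) \<omega> - Y (real j * h) \<omega>)) = expectation (\<lambda>_. 0)" for l
    using True by (intro Bochner_Integration.integral_cong) (auto simp: euler_def Y_zero)
  then show ?thesis by simp
next
  case False
  define t where "t = real j * h"
  have t: "t \<ge> 0" unfolding t_def using assms by simp
  define P where "P n \<omega> = (\<Sum>k<n. \<sigma> * sqrt (Y (real k * t / real n) \<omega>) *
                      (B (real (Suc k) * t / real n) \<omega> - B (real k * t / real n) \<omega>))
             - (Y t \<omega> - y - integral {0..t} (\<lambda>s. \<mu> * (\<theta> - Y s \<omega>)))" for n :: nat and \<omega>
  define Q where "Q n \<omega> = (\<Sum>k<n. drift (Y (real k * t / real n) \<omega>) * (t / real n)) - integral {0..t} (\<lambda>s. drift (Y s \<omega>))" for n :: nat and \<omega>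
  have Pm: "P n \<in> borel_measurable M" for n unfolding P_def
    using drift_integral_meas[OF t] by measurable
  have Qm: "Q n \<in> borel_measurable M" for n unfolding Q_def
    using drift_integral_meas[OF t] by measurable
  have P: "(\<lambda>n. expectation (\<lambda>\<omega>. trunc_sq (P n \<omega>))) \<longlonglongrightarrow> 0"
  proof (rule trunc_expectation_tendsto_prob[OF Pm])
    fix \<epsilon> :: real assume "\<epsilon> > 0"
    then show "(\<lambda>n. prob {\<omega> \<in> space M. \<epsilon> < \<bar>P n \<omega>\<bar>}) \<longlonglongrightarrow> 0"
      using sol t unfolding cir_solution_def P_def by blast
  qed
  have Q: "(\<lambda>n. expectation (\<lambda>\<omega>. trunc_sq (Q n \<omega>))) \<longlonglongrightarrow> 0"
  proof (rule trunc_expectation_tendsto_AE[OF Qm])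
    fix \<omega> assume "\<omega> \<in> space M"
    from LIM_zero[OF drift_riemann[OF this t]] show "(\<lambda>n. Q n \<omega>) \<longlonglongrightarrow> 0"
      unfolding Q_def .
  qed
  have sm: "strict_mono (\<lambda>l. j * l)" using False by (auto simp: strict_mono_def)
  have lim: "(\<lambda>l. 2 * expectation (\<lambda>\<omega>. trunc_sq (P (j * l) \<omega>)) + 2 * expectation (\<lambda>\<omega>. trunc_sq (Q (j * l) \<omega>))) \<longlonglongrightarrow> 0"
    using LIMSEQ_subseq_LIMSEQ[OF P sm] LIMSEQ_subseq_LIMSEQ[OF Q sm]
    by (auto intro!: tendsto_eq_intros simp: comp_def)
  show ?thesis
  proof (rule tendsto_sandwich[OF _ _ tendsto_const lim])
    show "\<forall>\<^sub>F l in sequentially. 0 \<le> expectation (\<lambda>\<omega>. trunc_sq (euler (h / real l) (j * l) \<omega> - Y (real j * h) \<omega>))"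
      by (intro always_eventually allI integral_nonneg_AE) auto
    show "\<forall>\<^sub>F l in sequentially. expectation (\<lambda>\<omega>. trunc_sq (euler (h / real l) (j * l) \<omega> - Y (real j * h) \<omega>))
       \<le> 2 * expectation (\<lambda>\<omega>. trunc_sq (P (j * l) \<omega>)) + 2 * expectation (\<lambda>\<omega>. trunc_sq (Q (j * l) \<omega>))"
      using eventually_gt_at_top[of 0]
    proof eventually_elim
      case (elim l)
      have c: "real k * t / real (j * l) = real k * (h / real l)" for k
        unfolding t_def using False elim by simp
      have c': "t / real (j * l) = h / real l" unfolding t_def using False elim by simp
      have e: "euler (h / real l) (j * l) \<omega> - Y (real j * h) \<omega> = P (j * l) \<omega> + Q (j * l) \<omega>" for \<omega>
        unfolding euler_def P_def Q_def incr_def sum.distrib c c' t_def by simp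
      have "expectation (\<lambda>\<omega>. trunc_sq (P (j * l) \<omega> + Q (j * l) \<omega>)) \<le>
          expectation (\<lambda>\<omega>. 2 * trunc_sq (P (j * l) \<omega>) + 2 * trunc_sq (Q (j * l) \<omega>))"
        using Pm Qm by (intro integral_mono trunc_sq_add integrable_trunc Bochner_Integration.integrable_add
           integrable_mult_right borel_measurable_add)
      also have "\<dots> = 2 * expectation (\<lambda>\<omega>. trunc_sq (P (j * l) \<omega>)) + 2 * expectation (\<lambda>\<omega>. trunc_sq (Q (j * l) \<omega>))"
        using Pm Qm integrable_trunc by simp
      finally show ?case unfolding e .
    qed
  qed
qed

text \<open>By dominated convergence and continuity of paths the distance is a continuous function
  of the two times, hence uniformly continuous on a compact square, and it vanishes on the
  diagonal.\<close>

lemma Y_modulus: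
  assumes "0 < e" "0 \<le> T"
  shows "\<exists>d>0. \<forall>s\<in>{0..T}. \<forall>s'\<in>{0..T}. \<bar>s - s'\<bar> < d \<longrightarrow> tdist (Y s) (Y s') < e"
proof -
  define \<psi> where "\<psi> p = tdist (Y (fst p)) (Y (snd p))" for p
  have "continuous_on ({0..T} \<times> {0..T}) \<psi>"
    unfolding continuous_on_sequentially
  proof (intro ballI allI impI)
    fix p q assume p: "p \<in> {0..T} \<times> {0..T}" and q: "(\<forall>n::nat. q n \<in> {0..T} \<times> {0..T}) \<and> q \<longlonglongrightarrow> p"
    show "(\<psi> \<circ> q) \<longlonglongrightarrow> \<psi> p"
      unfolding comp_def \<psi>_def
    proof (rule integral_dominated_convergence[where w="\<lambda>_. 1"])
      show "AE \<omega> in M. (\<lambda>n. trunc_sq (Y (fst (q n)) \<omega> - Y (snd (q n)) \<omega>)) \<longlonglongrightarrow> trunc_sq (Y (fst p) \<omega> - Y (snd p) \<omega>)"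
      proof (rule AE_I2)
        fix \<omega> assume w: "\<omega> \<in> space M"
        have "(\<lambda>n. Y (fst (q n)) \<omega>) \<longlonglongrightarrow> Y (fst p) \<omega>"
          by (rule continuous_on_tendsto_compose[OF Y_cont[OF w]]) (use p q in \<open>auto intro: tendsto_fst always_eventually simp: mem_Times_iff\<close>)
        moreover have "(\<lambda>n. Y (snd (q n)) \<omega>) \<longlonglongrightarrow> Y (snd p) \<omega>"
          by (rule continuous_on_tendsto_compose[OF Y_cont[OF w]]) (use p q in \<open>auto intro: tendsto_snd always_eventually simp: mem_Times_iff\<close>)
        ultimately show "(\<lambda>n. trunc_sq (Y (fst (q n)) \<omega> - Y (snd (q n)) \<omega>)) \<longlonglongrightarrow> trunc_sq (Y (fst p) \<omega> - Y (snd p) \<omega>)"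
          by (intro tendsto_intros)
      qed
    qed auto
  qed
  then have "uniformly_continuous_on ({0..T} \<times> {0..T}) \<psi>"
    by (rule compact_uniformly_continuous) (intro compact_Times compact_Icc)
  then obtain d where d: "d > 0" "\<And>p q. p \<in> {0..T} \<times> {0..T} \<Longrightarrow> q \<in> {0..T} \<times> {0..T} \<Longrightarrow> dist q p < d \<Longrightarrow> dist (\<psi> q) (\<psi> p) < e"
    using assms unfolding uniformly_continuous_on_def by meson
  have "tdist (Y s) (Y s') < e" if "s \<in> {0..T}" "s' \<in> {0..T}" "\<bar>s - s'\<bar> < d" for s s'
  proof -
    \<comment> \<open>Comparison with the diagonal point \<open>(s', s')\<close>, where \<psi> is
      0.\<close>
    have "dist (s, s') (s', s') < d" using that by (simp add: dist_prod_def dist_real_def)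
    from d(2)[OF _ _ this] that have "dist (\<psi> (s, s')) (\<psi> (s', s')) < e" by auto
    then show ?thesis unfolding \<psi>_def by (simp add: dist_real_def)
  qed
  then show ?thesis using d(1) by blast
qed

end

section \<open>The stopped Euler scheme\<close>

context brownian
begin

text \<open>Bounded and known at time \<open>t\<close>: exactly what a past factor needs for
  integrability and for the moment formulas. The class is closed under arithmetic, so long
  coefficients are settled by \<open>bdd_rv_intros\<close>.\<close>

definition bdd_rv :: "real \<Rightarrow> ('a \<Rightarrow> real) \<Rightarrow> bool" where
  "bdd_rv t X \<longleftrightarrow> X \<in> borel_measurable (\<F> t) \<and> (\<exists>K. \<forall>\<omega>\<in>space M. \<bar>X \<omega>\<bar> \<le> K)"

lemma bdd_rv_meas: "bdd_rv t X \<Longrightarrow> X \<in> borel_measurable (\<F> t)"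
  by (simp add: bdd_rv_def)

lemma bdd_rv_const: "bdd_rv t (\<lambda>_. c)"
  unfolding bdd_rv_def by auto

lemma bdd_rv_add: "bdd_rv t X \<Longrightarrow> bdd_rv t X' \<Longrightarrow> bdd_rv t (\<lambda>\<omega>. X \<omega> + X' \<omega>)"
  unfolding bdd_rv_def
proof (elim conjE exE, intro conjI)
  fix K K' assume "\<forall>\<omega>\<in>space M. \<bar>X \<omega>\<bar> \<le> K" "\<forall>\<omega>\<in>space M. \<bar>X' \<omega>\<bar> \<le> K'"
  then show "\<exists>K. \<forall>\<omega>\<in>space M. \<bar>X \<omega> + X' \<omega>\<bar> \<le> K"
    by (intro exI[of _ "K + K'"]) (auto intro: order_trans[OF abs_triangle_ineq add_mono])
qed auto

lemma bdd_rv_mult: "bdd_rv t X \<Longrightarrow> bdd_rv t X' \<Longrightarrow> bdd_rv t (\<lambda>\<omega>. X \<omega> * X' \<omega>)"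
  unfolding bdd_rv_def
proof (elim conjE exE, intro conjI)
  fix K K' assume "\<forall>\<omega>\<in>space M. \<bar>X \<omega>\<bar> \<le> K" "\<forall>\<omega>\<in>space M. \<bar>X' \<omega>\<bar> \<le> K'"
  then show "\<exists>K. \<forall>\<omega>\<in>space M. \<bar>X \<omega> * X' \<omega>\<bar> \<le> K"
    by (intro exI[of _ "K * K'"]) (auto simp: abs_mult intro!: mult_mono intro: order_trans[OF abs_ge_zero])
qed auto

lemma bdd_rv_minus: "bdd_rv t X \<Longrightarrow> bdd_rv t X' \<Longrightarrow> bdd_rv t (\<lambda>\<omega>. X \<omega> - X' \<omega>)"
  using bdd_rv_add[OF _ bdd_rv_mult[OF bdd_rv_const[of t "-1"]], of X X'] by simp

lemma bdd_rv_divide: "bdd_rv t X \<Longrightarrow> bdd_rv t (\<lambda>\<omega>. X \<omega> / c)"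
  using bdd_rv_mult[OF _ bdd_rv_const[of t "1 / c"], of X] by simp

lemma bdd_rv_power: "bdd_rv t X \<Longrightarrow> bdd_rv t (\<lambda>\<omega>. X \<omega> ^ n)"
  by (induction n) (auto intro: bdd_rv_const bdd_rv_mult)

lemma bdd_rv_comp:
  "g \<in> borel_measurable borel \<Longrightarrow> (\<And>x. \<bar>g x\<bar> \<le> K) \<Longrightarrow> X \<in> borel_measurable (\<F> t) \<Longrightarrow> bdd_rv t (\<lambda>\<omega>. g (X \<omega>))"
  unfolding bdd_rv_def by (auto intro: measurable_compose)

lemmas bdd_rv_intros = bdd_rv_const bdd_rv_add bdd_rv_mult bdd_rv_minus bdd_rv_divide bdd_rv_power

lemma bdd_rv_integrable: "bdd_rv t X \<Longrightarrow> integrable M X"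
proof -
  assume "bdd_rv t X"
  then obtain K where X: "X \<in> borel_measurable (\<F> t)" and K: "\<forall>\<omega>\<in>space M. \<bar>X \<omega>\<bar> \<le> K"
    unfolding bdd_rv_def by auto
  have "X \<in> borel_measurable M" by (rule measurable_nat_filtration[OF B_meas X])
  then show ?thesis using K by (intro integrable_const_bound[where B=K]) auto
qed

end

locale scheme = cir M B \<mu> \<theta> \<sigma> y Y for M :: "'a measure" and B \<mu> \<theta> \<sigma> y Y +
  fixes \<tau> :: "'a \<Rightarrow> real" and m \<delta> :: real
  assumes stop: "\<And>t. 0 \<le> t \<Longrightarrow> {\<omega> \<in> space M. \<tau> \<omega> \<le> t} \<in> sets (\<F> t)"
    and m_nonneg: "m \<ge> 0" and \<delta>_pos: "\<delta> > 0"
begin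

text \<open>\<open>D k\<close> indicates that the scheme is still running at step \<open>k\<close>. The truncation to \<open>[0, m]\<close> keeps the
  coefficients bounded, since no moment bound on \<open>Y\<close> is available beforehand.\<close>
definition D :: "nat \<Rightarrow> 'a \<Rightarrow> real" where
  "D k \<omega> = of_bool (real k * \<delta> < \<tau> \<omega> \<and> (\<forall>i\<le>k. Z (real i * \<delta>) \<omega> \<in> {0..m}))"

text \<open>Both coefficients use the raw version \<open>Z\<close>, so that each is independent of
  the increment it multiplies.\<close>

definition a :: "nat \<Rightarrow> 'a \<Rightarrow> real" where "a k \<omega> = D k \<omega> * drift (Z (real k * \<delta>) \<omega>)"
definition b :: "nat \<Rightarrow> 'a \<Rightarrow> real" where "b k \<omega> = D k \<omega> * vol (Z (real k * \<delta>) \<omega>)"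

text \<open>Almost surely this is \<open>euler\<close> for as long as \<open>D\<close> has been 1,
  and it stays constant afterwards.\<close>

definition X :: "nat \<Rightarrow> 'a \<Rightarrow> real" where
  "X k \<omega> = y + (\<Sum>i<k. a i \<omega> * \<delta> + b i \<omega> * incr \<delta> i \<omega>)"

abbreviation "\<G> k \<equiv> \<F> (real k * \<delta>)"
abbreviation "bdd k \<equiv> bdd_rv (real k * \<delta>)"

definition "Ca = \<mu> * (\<theta> + m)"
definition "Cb = \<sigma> * sqrt m"

lemma D_01: "D k \<omega> = 0 \<or> D k \<omega> = 1" and D_nonneg: "0 \<le> D k \<omega>"
  by (auto simp: D_def)

lemma D_mono: "i \<le> k \<Longrightarrow> D k \<omega> = 1 \<Longrightarrow> D i \<omega> = 1"
proof -
  assume "i \<le> k" "D k \<omega> = 1"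
  then have "real i * \<delta> \<le> real k * \<delta>" "real k * \<delta> < \<tau> \<omega>" "\<forall>i\<le>k. Z (real i * \<delta>) \<omega> \<in> {0..m}"
    using \<delta>_pos by (auto simp: D_def split: if_splits)
  then show ?thesis using \<open>i \<le> k\<close> by (auto simp: D_def)
qed

lemma a_bound: "\<bar>a k \<omega>\<bar> \<le> Ca" and b_bound: "\<bar>b k \<omega>\<bar> \<le> Cb" and Ca_nonneg: "0 \<le> Ca" and Cb_nonneg: "0 \<le> Cb"
proof -
  show 1: "0 \<le> Ca" "0 \<le> Cb" using params m_nonneg by (auto simp: Ca_def Cb_def)
  show "\<bar>a k \<omega>\<bar> \<le> Ca"
  proof (cases "D k \<omega> = 0")
    case False
    then have "Z (real k * \<delta>) \<omega> \<in> {0..m}" by (auto simp: D_def)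
    then show ?thesis using params D_01[of k \<omega>] False by (auto simp: a_def Ca_def abs_mult)
  qed (use 1 in \<open>simp add: a_def\<close>)
  show "\<bar>b k \<omega>\<bar> \<le> Cb"
  proof (cases "D k \<omega> = 0")
    case False
    then have "Z (real k * \<delta>) \<omega> \<in> {0..m}" by (auto simp: D_def)
    then show ?thesis using params D_01[of k \<omega>] False by (auto simp: b_def Cb_def abs_mult)
  qed (use 1 in \<open>simp add: b_def\<close>)
qed

lemma Z_\<G>: "i \<le> k \<Longrightarrow> Z (real i * \<delta>) \<in> borel_measurable (\<G> k)"
  using \<delta>_pos by (intro measurable_nat_filtration_mono[OF _ Z_filt]) auto

lemma D_meas: "D k \<in> borel_measurable (\<G> k)"
proof -
  let ?A = "{\<omega> \<in> space (\<G> k). real k * \<delta> < \<tau> \<omega> \<and> (\<forall>i\<in>{..k}. Z (real i * \<delta>) \<omega> \<in> {0..m})}"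
  have "{\<omega> \<in> space (\<G> k). \<not> \<tau> \<omega> \<le> real k * \<delta>} \<in> sets (\<G> k)"
    using stop[of "real k * \<delta>"] \<delta>_pos by (intro sets.sets_Collect_neg) auto
  then have "{\<omega> \<in> space (\<G> k). real k * \<delta> < \<tau> \<omega>} \<in> sets (\<G> k)" by (simp add: not_le)
  moreover have "{\<omega> \<in> space (\<G> k). Z (real i * \<delta>) \<omega> \<in> {0..m}} \<in> sets (\<G> k)" if "i \<in> {..k}" for i
    using that measurable_sets[OF Z_\<G>[of i k], of "{0..m}"] by (simp add: vimage_def Int_def conj_commute)
  ultimately have "?A \<in> sets (\<G> k)"
    by (intro sets.sets_Collect_conj sets.sets_Collect_finite_All') auto
  then have "indicator ?A \<in> borel_measurable (\<G> k)" by simp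
  moreover have "D k \<omega> = indicator ?A \<omega>" if "\<omega> \<in> space (\<G> k)" for \<omega>
    using that by (auto simp: D_def indicator_def)
  ultimately show ?thesis using measurable_cong[of "\<G> k" "D k" "indicator ?A"] by blast
qed

lemma D_bdd: "bdd k (D k)"
  unfolding bdd_rv_def using D_meas D_01 by (auto intro!: exI[of _ 1] simp: D_def)

lemma a_bdd: "bdd k (a k)" and b_bdd: "bdd k (b k)"
proof -
  note [measurable] = D_meas[of k] Z_\<G>[OF order_refl, of k]
  have "a k \<in> borel_measurable (\<G> k)" "b k \<in> borel_measurable (\<G> k)"
    unfolding a_def[abs_def] b_def[abs_def] by measurable
  then show "bdd k (a k)" "bdd k (b k)"
    unfolding bdd_rv_def using a_bound[of k] b_bound[of k] by blast+
qed

lemma \<G>_mono: "i \<le> k \<Longrightarrow> W \<in> borel_measurable (\<G> i) \<Longrightarrow> W \<in> borel_measurable (\<G> k)"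
  using \<delta>_pos by (intro measurable_nat_filtration_mono[of "real i * \<delta>" "real k * \<delta>"]) auto

lemma incr_\<G>: "i < k \<Longrightarrow> incr \<delta> i \<in> borel_measurable (\<G> k)"
proof -
  assume i: "i < k"
  have "real (Suc i) * \<delta> \<le> real k * \<delta>" "real i * \<delta> \<le> real k * \<delta>"
    using i \<delta>_pos by (auto intro!: mult_right_mono)
  then have [measurable]: "B (real (Suc i) * \<delta>) \<in> borel_measurable (\<G> k)" "B (real i * \<delta>) \<in> borel_measurable (\<G> k)"
    using \<delta>_pos by (auto intro!: measurable_nat_filtration_B simp del: of_nat_Suc)
  show ?thesis unfolding incr_def[abs_def] by measurable
qed

lemma part_\<G>: "k \<le> n \<Longrightarrow> (\<lambda>\<omega>. \<Sum>i=j..<k. b i \<omega> * incr \<delta> i \<omega>) \<in> borel_measurable (\<G> n)"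
  by (intro borel_measurable_sum borel_measurable_times incr_\<G> \<G>_mono[OF _ bdd_rv_meas[OF b_bdd]]) auto

lemma X_\<G>: "X k \<in> borel_measurable (\<G> k)"
  unfolding X_def[abs_def]
  by (intro borel_measurable_add borel_measurable_sum borel_measurable_times borel_measurable_const incr_\<G>
      \<G>_mono[OF _ bdd_rv_meas[OF b_bdd]] \<G>_mono[OF _ bdd_rv_meas[OF a_bdd]]) auto

lemma \<G>_M: "W \<in> borel_measurable (\<G> k) \<Longrightarrow> W \<in> borel_measurable M"
  by (rule measurable_nat_filtration[OF B_meas])

lemmas scheme_meas[measurable] = \<G>_M[OF X_\<G>] \<G>_M[OF D_meas] \<G>_M[OF bdd_rv_meas[OF a_bdd]] \<G>_M[OF bdd_rv_meas[OF b_bdd]]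

lemma incr_expectation:
  assumes "W \<in> borel_measurable (\<G> k)" "integrable M W"
  shows "integrable M (\<lambda>\<omega>. W \<omega> * incr \<delta> k \<omega> ^ p)"
    and "expectation (\<lambda>\<omega>. W \<omega> * incr \<delta> k \<omega>) = 0"
    and "expectation (\<lambda>\<omega>. W \<omega> * (incr \<delta> k \<omega>)\<^sup>2) = \<delta> * expectation W"
    and "expectation (\<lambda>\<omega>. W \<omega> * incr \<delta> k \<omega> ^ 4) = 3 * \<delta>\<^sup>2 * expectation W"
proof -
  have s: "0 \<le> real k * \<delta>" "real k * \<delta> < real (Suc k) * \<delta>" "real (Suc k) * \<delta> - real k * \<delta> = \<delta>"
    using \<delta>_pos by (auto simp: algebra_simps)
  note e = expectation_mult_incr_power[OF s(1,2) assms, folded incr_def]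
  show "integrable M (\<lambda>\<omega>. W \<omega> * incr \<delta> k \<omega> ^ p)" by (rule e(1))
  show "expectation (\<lambda>\<omega>. W \<omega> * incr \<delta> k \<omega>) = 0"
    using e(2)[of 1] incr_moments(1)[OF s(1,2), folded incr_def] by simp
  show "expectation (\<lambda>\<omega>. W \<omega> * (incr \<delta> k \<omega>)\<^sup>2) = \<delta> * expectation W"
    using e(2)[of 2] incr_moments(2)[OF s(1,2), folded incr_def] s(3) by simp
  show "expectation (\<lambda>\<omega>. W \<omega> * incr \<delta> k \<omega> ^ 4) = 3 * \<delta>\<^sup>2 * expectation W"
    using e(2)[of 4] incr_moments(3)[OF s(1,2), folded incr_def] s(3) by simp
qed

lemma incr_integrable1: "W \<in> borel_measurable (\<G> k) \<Longrightarrow> integrable M W \<Longrightarrow> integrable M (\<lambda>\<omega>. W \<omega> * incr \<delta> k \<omega>)"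
  using incr_expectation(1)[of W k 1] by simp

text \<open>Discrete Ito isometry by induction: the cross term vanishes because the next increment
  has mean zero and is independent of the past. Integrability is carried along since the partial sum
  is not bounded.\<close>

lemma martingale_part_L2:
  "integrable M (\<lambda>\<omega>. \<Sum>i=j..<j+n. b i \<omega> * incr \<delta> i \<omega>) \<and>
   integrable M (\<lambda>\<omega>. (\<Sum>i=j..<j+n. b i \<omega> * incr \<delta> i \<omega>)\<^sup>2) \<and>
   expectation (\<lambda>\<omega>. (\<Sum>i=j..<j+n. b i \<omega> * incr \<delta> i \<omega>)\<^sup>2) \<le> Cb\<^sup>2 * (real n * \<delta>)"
proof (induction n)
  case (Suc n)
  define S where "S \<omega> = (\<Sum>i=j..<j+n. b i \<omega> * incr \<delta> i \<omega>)" for \<omega>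
  define k where "k = j + n"
  have Sm: "S \<in> borel_measurable (\<G> k)" unfolding S_def[abs_def] k_def by (rule part_\<G>) simp
  have IH: "integrable M S" "integrable M (\<lambda>\<omega>. (S \<omega>)\<^sup>2)" "expectation (\<lambda>\<omega>. (S \<omega>)\<^sup>2) \<le> Cb\<^sup>2 * (real n * \<delta>)"
    using Suc unfolding S_def[abs_def] by auto
  have bm: "b k \<in> borel_measurable (\<G> k)" "integrable M (b k)" using b_bdd bdd_rv_meas bdd_rv_integrable by blast+
  have b2: "(\<lambda>\<omega>. (b k \<omega>)\<^sup>2) \<in> borel_measurable (\<G> k)" "integrable M (\<lambda>\<omega>. (b k \<omega>)\<^sup>2)"
    using bdd_rv_power[OF b_bdd, of k 2] bdd_rv_meas bdd_rv_integrable by blast+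
  have Sb: "(\<lambda>\<omega>. 2 * S \<omega> * b k \<omega>) \<in> borel_measurable (\<G> k)" "integrable M (\<lambda>\<omega>. 2 * S \<omega> * b k \<omega>)"
  proof -
    show "(\<lambda>\<omega>. 2 * S \<omega> * b k \<omega>) \<in> borel_measurable (\<G> k)" using Sm bm by simp
    show "integrable M (\<lambda>\<omega>. 2 * S \<omega> * b k \<omega>)"
    \<comment> \<open>\<open>S\<close> is unbounded, so this factor lies outside
      \<open>bdd_rv\<close>; the bound on \<open>b\<close> dominates it by a multiple of
      \<open>S\<close>.\<close>
    proof (rule Bochner_Integration.integrable_bound[where f="\<lambda>\<omega>. 2 * Cb * S \<omega>"])
      show "AE \<omega> in M. norm (2 * S \<omega> * b k \<omega>) \<le> norm (2 * Cb * S \<omega>)"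
        using b_bound[of k] Cb_nonneg by (auto simp: abs_mult mult_ac intro!: AE_I2 mult_left_mono)
    qed (use IH(1) \<G>_M[OF Sm] \<G>_M[OF bm(1)] in auto)
  qed
  have eq: "(\<Sum>i=j..<j+Suc n. b i \<omega> * incr \<delta> i \<omega>) = S \<omega> + b k \<omega> * incr \<delta> k \<omega>" for \<omega>
    unfolding S_def k_def by simp
  have eq2: "(S \<omega> + b k \<omega> * incr \<delta> k \<omega>)\<^sup>2 = (S \<omega>)\<^sup>2 + (2 * S \<omega> * b k \<omega>) * incr \<delta> k \<omega> + (b k \<omega>)\<^sup>2 * (incr \<delta> k \<omega>)\<^sup>2" for \<omega>
    by (simp add: power2_eq_square algebra_simps)
  note int = IH(1,2) incr_integrable1[OF bm] incr_integrable1[OF Sb] incr_expectation(1)[OF b2, of 2]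
  have "expectation (\<lambda>\<omega>. (S \<omega> + b k \<omega> * incr \<delta> k \<omega>)\<^sup>2) = expectation (\<lambda>\<omega>. (S \<omega>)\<^sup>2) + \<delta> * expectation (\<lambda>\<omega>. (b k \<omega>)\<^sup>2)"
    unfolding eq2 using int incr_expectation(2)[OF Sb] incr_expectation(3)[OF b2] by simp
  also have "expectation (\<lambda>\<omega>. (b k \<omega>)\<^sup>2) \<le> expectation (\<lambda>_. Cb\<^sup>2)"
    using b2 b_bound[of k] Cb_nonneg by (intro integral_mono) (auto simp: power2_le_iff_abs_le)
  finally have "expectation (\<lambda>\<omega>. (S \<omega> + b k \<omega> * incr \<delta> k \<omega>)\<^sup>2) \<le> Cb\<^sup>2 * (real (Suc n) * \<delta>)"
    using IH(3) \<delta>_pos by (simp add: prob_space algebra_simps)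
  then show ?case unfolding eq using int by (auto simp: eq2)
qed simp

text \<open>The bound depends on the elapsed time only, not on the number of steps in between, so a
  coarse cell may be refined at will.\<close>

lemma X_increment_L2:
  assumes "j \<le> k"
  shows "tdist (X k) (X j) \<le> 2 * (Ca * (real (k - j) * \<delta>))\<^sup>2 + 2 * Cb\<^sup>2 * (real (k - j) * \<delta>)"
proof -
  obtain n where k: "k = j + n" using assms le_Suc_ex by blast
  define S where "S \<omega> = (\<Sum>i=j..<j+n. b i \<omega> * incr \<delta> i \<omega>)" for \<omega>
  define A where "A \<omega> = (\<Sum>i=j..<j+n. a i \<omega> * \<delta>)" for \<omega>
  have "\<bar>A \<omega>\<bar> \<le> Ca * (real n * \<delta>)" for \<omega>
  proof -
    have "\<bar>A \<omega>\<bar> \<le> (\<Sum>i=j..<j+n. \<bar>a i \<omega> * \<delta>\<bar>)" unfolding A_def by (rule sum_abs)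
    also have "\<dots> \<le> (\<Sum>i=j..<j+n. Ca * \<delta>)"
      using a_bound \<delta>_pos by (intro sum_mono) (auto simp: abs_mult)
    finally show ?thesis by (simp add: mult_ac)
  qed
  then have A: "(A \<omega>)\<^sup>2 \<le> (Ca * (real n * \<delta>))\<^sup>2" for \<omega>
    using Ca_nonneg \<delta>_pos by (auto simp: power2_le_iff_abs_le)
  have XS: "X k \<omega> - X j \<omega> = A \<omega> + S \<omega>" for \<omega>
  proof -
    have "X k \<omega> - X j \<omega> = (\<Sum>i=j..<j+n. a i \<omega> * \<delta> + b i \<omega> * incr \<delta> i \<omega>)"
      unfolding X_def k using sum.union_disjoint[of "{..<j}" "{j..<j+n}" "\<lambda>i. a i \<omega> * \<delta> + b i \<omega> * incr \<delta> i \<omega>"]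
      by (simp add: ivl_disj_un ivl_disj_int)
    then show ?thesis unfolding A_def S_def by (simp add: sum.distrib)
  qed
  note L = martingale_part_L2[of j n, folded S_def]
  have "tdist (X k) (X j) \<le> expectation (\<lambda>\<omega>. 2 * (Ca * (real n * \<delta>))\<^sup>2 + 2 * (S \<omega>)\<^sup>2)"
  proof (rule integral_mono)
    show "trunc_sq (X k \<omega> - X j \<omega>) \<le> 2 * (Ca * (real n * \<delta>))\<^sup>2 + 2 * (S \<omega>)\<^sup>2" for \<omega>
    proof -
      have "trunc_sq (X k \<omega> - X j \<omega>) \<le> 2 * trunc_sq (A \<omega>) + 2 * trunc_sq (S \<omega>)"
        unfolding XS by (rule trunc_sq_add)
      also have "\<dots> \<le> 2 * (Ca * (real n * \<delta>))\<^sup>2 + 2 * (S \<omega>)\<^sup>2"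
        using A[of \<omega>] by (intro add_mono mult_left_mono) (auto intro: min.coboundedI2)
      finally show ?thesis .
    qed
  qed (use L in \<open>auto intro: integrable_trunc\<close>)
  also have "\<dots> = 2 * (Ca * (real n * \<delta>))\<^sup>2 + 2 * expectation (\<lambda>\<omega>. (S \<omega>)\<^sup>2)"
    using L by (simp add: prob_space)
  finally show ?thesis using L k by (simp add: mult.assoc)
qed

abbreviation "gain r f k \<omega> \<equiv> D k \<omega> * (exp (- r * \<delta>) * f (X (Suc k) \<omega>) - f (X k \<omega>))"

text \<open>The expectation of \<open>step_bound\<close> over the event that the scheme still runs.
  What remains is \<delta> times a quantity governed by \<eta>, by the distance of scheme and
  solution, and by \<delta> itself.\<close>

lemma one_step:
  fixes f f' f'' :: "real \<Rightarrow> real"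
  assumes tf: "test_function f f' f'' K"
    and super: "\<And>z. z \<in> {0..m} \<Longrightarrow> f' z * drift z + f'' z * (vol z)\<^sup>2 / 2 - r * f z \<le> 0"
    and mod: "\<And>x z. z \<in> {0..m} \<Longrightarrow> \<bar>f x - f z\<bar> \<le> \<eta> + C * trunc_sq (x - z)"
      "\<And>x z. z \<in> {0..m} \<Longrightarrow> \<bar>f' x - f' z\<bar> \<le> \<eta> + C * trunc_sq (x - z)"
      "\<And>x z. z \<in> {0..m} \<Longrightarrow> \<bar>f'' x - f'' z\<bar> \<le> \<eta> + C * trunc_sq (x - z)"
    and C: "C \<ge> 0" and eta: "\<eta> \<ge> 0" and r: "r > 0" "r * \<delta> \<le> 1" and d1: "\<delta> \<le> 1"
  shows "expectation (gain r f k) \<le>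
    \<delta> * ((Ca + Cb\<^sup>2 / 2 + r + 2 * Ca\<^sup>2 + 2 * Cb\<^sup>2) *
           (\<eta> + 3 / 2 * C * expectation (\<lambda>\<omega>. D k \<omega> * trunc_sq (X k \<omega> - Z (real k * \<delta>) \<omega>)))
         + (K * Ca\<^sup>2 / 2 + K * r\<^sup>2 + 8 * C * (Ca ^ 4 + 3 * Cb ^ 4)) * \<delta>)"
proof -
  interpret test_function f f' f'' K by (rule tf)
  define N where "N \<omega> = trunc_sq (X k \<omega> - Z (real k * \<delta>) \<omega>)" for \<omega>
  define K0 where "K0 = Ca + Cb\<^sup>2 / 2 + r"
  define K1 where "K1 = Ca + Cb\<^sup>2 / 2 + r + 2 * Ca\<^sup>2 + 2 * Cb\<^sup>2"
  define c4 where "c4 = K * Ca\<^sup>2 / 2 + K * r\<^sup>2"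
  define c5 where "c5 = K * Ca\<^sup>2 / 2 + K * r\<^sup>2 + 8 * C * (Ca ^ 4 + 3 * Cb ^ 4)"
  \<comment> \<open>\<open>G0\<close>, \<open>W2\<close>, \<open>W5\<close>, \<open>W6\<close>
    collect the past factors of the powers 0, 1, 2, 4 of the increment. The last term of
    \<open>G0\<close> is the compensator of the squared increment and cancels the first term of
    \<open>W5\<close> in expectation.\<close>
  define G0 where "G0 \<omega> = D k \<omega> * (\<delta> * K0 * (\<eta> + C * N \<omega>) + c4 * \<delta>\<^sup>2 + (\<eta> + 3 / 2 * C * N \<omega>) * (2 * Ca\<^sup>2 * \<delta>\<^sup>2) + 8 * C * (Ca ^ 4 * \<delta> ^ 4))
     - f'' (X k \<omega>) * (b k \<omega>)\<^sup>2 / 2 * \<delta>" for \<omega>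
  define W2 where "W2 \<omega> = f' (X k \<omega>) * b k \<omega> + f'' (X k \<omega>) * a k \<omega> * b k \<omega> * \<delta>" for \<omega>
  define W5 where "W5 \<omega> = f'' (X k \<omega>) * (b k \<omega>)\<^sup>2 / 2 + D k \<omega> * ((\<eta> + 3 / 2 * C * N \<omega>) * (2 * Cb\<^sup>2))" for \<omega>
  define W6 where "W6 \<omega> = D k \<omega> * (8 * C * Cb ^ 4)" for \<omega>
  define L where "L \<omega> = gain r f k \<omega>" for \<omega>
  define R where "R \<omega> = \<delta> * (K1 * (\<eta> + 3 / 2 * C * (D k \<omega> * N \<omega>)) + c5 * \<delta>)" for \<omega>
  have nn: "0 \<le> Ca" "0 \<le> Cb" "0 \<le> K" "0 \<le> K0" "0 \<le> K1" "0 \<le> c4" "0 \<le> c5" "0 < \<delta>"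
    using Ca_nonneg Cb_nonneg K_nonneg r C \<delta>_pos by (auto simp: K0_def K1_def c4_def c5_def)
  have N0: "0 \<le> N \<omega>" for \<omega> unfolding N_def by simp
  have Nb: "bdd k N"
  proof -
    have [measurable]: "(\<lambda>\<omega>. X k \<omega> - Z (real k * \<delta>) \<omega>) \<in> borel_measurable (\<G> k)"
      using X_\<G> Z_\<G>[of k k] by auto
    show ?thesis unfolding N_def by (rule bdd_rv_comp[where K=1]) auto
  qed
  have fb: "bdd k (\<lambda>\<omega>. f (X k \<omega>))" "bdd k (\<lambda>\<omega>. f' (X k \<omega>))" "bdd k (\<lambda>\<omega>. f'' (X k \<omega>))"
    by (rule bdd_rv_comp[where K=K], rule f_meas, use f_bound f'_bound f''_bound in simp, rule X_\<G>)+
  note bi = bdd_rv_intros Nb fb D_bdd a_bdd b_bdd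
  have G0b: "bdd k G0" unfolding G0_def by (intro bi)
  have W2b: "bdd k W2" unfolding W2_def by (intro bi)
  have W5b: "bdd k W5" unfolding W5_def by (intro bi)
  have W6b: "bdd k W6" unfolding W6_def by (intro bi)
  have Rb: "bdd k R" unfolding R_def by (intro bi)
  have DNb: "bdd k (\<lambda>\<omega>. D k \<omega> * N \<omega>)" by (intro bi)
  have XS: "X (Suc k) \<omega> = X k \<omega> + (a k \<omega> * \<delta> + b k \<omega> * incr \<delta> k \<omega>)" for \<omega> by (simp add: X_def)
  have pw: "exp (r * \<delta>) * L \<omega> \<le> G0 \<omega> + W2 \<omega> * incr \<delta> k \<omega> + W5 \<omega> * (incr \<delta> k \<omega>)\<^sup>2 + W6 \<omega> * incr \<delta> k \<omega> ^ 4" for \<omega>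
  proof (cases "D k \<omega> = 0")
    case True
    then show ?thesis by (simp add: L_def G0_def W2_def W5_def W6_def a_def b_def)
  next
    case False
    then have D1: "D k \<omega> = 1" using D_01 by blast
    define z where "z = Z (real k * \<delta>) \<omega>"
    have z: "z \<in> {0..m}" using False unfolding D_def z_def by auto
    have ab: "a k \<omega> = drift z" "b k \<omega> = vol z" using D1 by (auto simp: a_def b_def z_def)
    have su: "f' z * a k \<omega> + f'' z * (b k \<omega>)\<^sup>2 / 2 - r * f z \<le> 0" using super[OF z] ab by simp
    show ?thesis
      using step_bound[where x = "X k \<omega>" and \<xi> = "incr \<delta> k \<omega>",
        OF z su mod(1)[OF z] mod(2)[OF z] mod(3)[OF z] C eta \<delta>_pos r(2,1) a_bound b_bound]
      unfolding L_def G0_def W2_def W5_def W6_def D1 XS N_def z_def[symmetric] K0_def[symmetric] c4_def[symmetric]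
      by (simp add: algebra_simps diff_divide_distrib)
  qed
  have Lb: "integrable M L"
  proof (rule integrable_const_bound[where B="2 * K"])
    show "AE \<omega> in M. norm (L \<omega>) \<le> 2 * K"
    proof (rule AE_I2)
      fix \<omega>
      have "\<bar>exp (- r * \<delta>) * f (X (Suc k) \<omega>)\<bar> \<le> 1 * K"
        unfolding abs_mult using f_bound r nn by (intro mult_mono) auto
      then have "\<bar>exp (- r * \<delta>) * f (X (Suc k) \<omega>) - f (X k \<omega>)\<bar> \<le> 2 * K"
        using f_bound[of "X k \<omega>"] by linarith
      then show "norm (L \<omega>) \<le> 2 * K"
        using D_01[of k \<omega>] nn unfolding L_def by auto
    qed
    show "L \<in> borel_measurable M" unfolding L_def by measurable
  qed
  note ints = bdd_rv_integrable[OF G0b] incr_integrable1[OF bdd_rv_meas[OF W2b] bdd_rv_integrable[OF W2b]] incr_expectation(1)[OF bdd_rv_meas[OF W5b] bdd_rv_integrable[OF W5b], of 2] incr_expectation(1)[OF bdd_rv_meas[OF W6b] bdd_rv_integrable[OF W6b], of 4]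
  have "exp (r * \<delta>) * expectation L = expectation (\<lambda>\<omega>. exp (r * \<delta>) * L \<omega>)" by simp
  also have "\<dots> \<le> expectation (\<lambda>\<omega>. G0 \<omega> + W2 \<omega> * incr \<delta> k \<omega> + W5 \<omega> * (incr \<delta> k \<omega>)\<^sup>2 + W6 \<omega> * incr \<delta> k \<omega> ^ 4)"
    using ints Lb pw by (intro integral_mono Bochner_Integration.integrable_add) auto
  also have "\<dots> = expectation G0 + \<delta> * expectation W5 + 3 * \<delta>\<^sup>2 * expectation W6"
    using ints incr_expectation(2)[OF bdd_rv_meas[OF W2b] bdd_rv_integrable[OF W2b]] incr_expectation(3)[OF bdd_rv_meas[OF W5b] bdd_rv_integrable[OF W5b]] incr_expectation(4)[OF bdd_rv_meas[OF W6b] bdd_rv_integrable[OF W6b]]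
    by (simp add: Bochner_Integration.integral_add)
  also have "\<dots> = expectation (\<lambda>\<omega>. G0 \<omega> + \<delta> * W5 \<omega> + 3 * \<delta>\<^sup>2 * W6 \<omega>)"
    using bdd_rv_integrable[OF G0b] bdd_rv_integrable[OF W5b] bdd_rv_integrable[OF W6b] by simp
  also have "\<dots> \<le> expectation R"
  proof (rule integral_mono)
    show "G0 \<omega> + \<delta> * W5 \<omega> + 3 * \<delta>\<^sup>2 * W6 \<omega> \<le> R \<omega>" for \<omega>
    proof (cases "D k \<omega> = 0")
      case True
      then have "G0 \<omega> + \<delta> * W5 \<omega> + 3 * \<delta>\<^sup>2 * W6 \<omega> = 0" by (simp add: G0_def W5_def W6_def b_def)
      moreover have "0 \<le> R \<omega>" unfolding R_def using True nn eta by simp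
      ultimately show ?thesis by simp
    next
      case False
      then have D1: "D k \<omega> = 1" using D_01 by blast
      define Q where "Q = \<eta> + 3 / 2 * C * N \<omega>"
      have Q: "0 \<le> Q" "\<eta> + C * N \<omega> \<le> Q" unfolding Q_def using eta C N0[of \<omega>] by auto
      have d2: "\<delta>\<^sup>2 \<le> \<delta>" using d1 nn by (simp add: power2_eq_square mult_left_le_one_le)
      have d4: "\<delta> ^ 4 \<le> \<delta>\<^sup>2" using d1 nn by (intro power_decreasing) auto
      have "G0 \<omega> + \<delta> * W5 \<omega> + 3 * \<delta>\<^sup>2 * W6 \<omega> =
         \<delta> * K0 * (\<eta> + C * N \<omega>) + c4 * \<delta>\<^sup>2 + Q * (2 * Ca\<^sup>2 * \<delta>\<^sup>2) + 8 * C * (Ca ^ 4 * \<delta> ^ 4) + Q * (2 * Cb\<^sup>2 * \<delta>) + 8 * C * (3 * Cb ^ 4 * \<delta>\<^sup>2)"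
        unfolding G0_def W5_def W6_def D1 Q_def by (simp add: algebra_simps)
      also have "\<dots> \<le> \<delta> * K0 * Q + c4 * \<delta>\<^sup>2 + Q * (2 * Ca\<^sup>2 * \<delta>) + 8 * C * (Ca ^ 4 * \<delta>\<^sup>2) + Q * (2 * Cb\<^sup>2 * \<delta>) + 8 * C * (3 * Cb ^ 4 * \<delta>\<^sup>2)"
        using Q d2 d4 nn C by (intro add_mono mult_left_mono order_refl) auto
      also have "\<dots> = R \<omega>"
        unfolding R_def D1 c5_def c4_def K1_def K0_def Q_def[symmetric] mult_1 by (simp add: algebra_simps power2_eq_square)
      finally show ?thesis .
    qed
  qed (use bdd_rv_integrable[OF G0b] bdd_rv_integrable[OF W5b] bdd_rv_integrable[OF W6b] bdd_rv_integrable[OF Rb] in auto)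
  also have "\<dots> = \<delta> * (K1 * (\<eta> + 3 / 2 * C * expectation (\<lambda>\<omega>. D k \<omega> * N \<omega>)) + c5 * \<delta>)"
    unfolding R_def using bdd_rv_integrable[OF DNb] by (simp add: prob_space)
  finally have fin: "exp (r * \<delta>) * expectation L \<le> \<delta> * (K1 * (\<eta> + 3 / 2 * C * expectation (\<lambda>\<omega>. D k \<omega> * N \<omega>)) + c5 * \<delta>)" .
  have "0 \<le> expectation (\<lambda>\<omega>. D k \<omega> * N \<omega>)"
    using N0 D_nonneg by (intro integral_nonneg_AE) auto
  then have rhs: "0 \<le> \<delta> * (K1 * (\<eta> + 3 / 2 * C * expectation (\<lambda>\<omega>. D k \<omega> * N \<omega>)) + c5 * \<delta>)"
    using nn eta C by auto
  have "expectation L \<le> \<delta> * (K1 * (\<eta> + 3 / 2 * C * expectation (\<lambda>\<omega>. D k \<omega> * N \<omega>)) + c5 * \<delta>)"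
  proof (cases "expectation L \<le> 0")
    case False
    then have "1 * expectation L \<le> exp (r * \<delta>) * expectation L"
      using r nn by (intro mult_right_mono) auto
    then show ?thesis using fin by simp
  qed (use rhs in simp)
  then show ?thesis unfolding L_def N_def K1_def c5_def .
qed

text \<open>Discounting follows the clock of the scheme: the sum of the \<open>D i\<close> counts
  the steps actually made, so \<open>U\<close> is frozen together with \<open>X\<close>.\<close>

definition U :: "real \<Rightarrow> (real \<Rightarrow> real) \<Rightarrow> nat \<Rightarrow> 'a \<Rightarrow> real" where
  "U r f n \<omega> = exp (- r * (\<delta> * (\<Sum>i<n. D i \<omega>))) * f (X n \<omega>)"

text \<open>Where \<open>D n\<close> is 1 all earlier \<open>D i\<close> are 1 too, so the discount
  factor of the increment is deterministic and leaves the expectation.\<close>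

lemma U_step: "U r f (Suc n) \<omega> = U r f n \<omega> + exp (- r * (\<delta> * real n)) * (D n \<omega> * (exp (- r * \<delta>) * f (X (Suc n) \<omega>) - f (X n \<omega>)))"
proof (cases "D n \<omega> = 0")
  case True
  then show ?thesis by (simp add: U_def X_def a_def b_def)
next
  case False
  then have D1: "D n \<omega> = 1" using D_01 by blast
  have "D i \<omega> = 1" if "i < n" for i by (rule D_mono[OF _ D1]) (use that in simp)
  then have "(\<Sum>i<n. D i \<omega>) = real n" by simp
  then show ?thesis using D1 by (simp add: U_def algebra_simps flip: exp_add)
qed

lemma U_expectation:
  fixes f f' f'' :: "real \<Rightarrow> real"
  assumes tf: "test_function f f' f'' K" and r: "r > 0"
    and step: "\<And>k. k < n \<Longrightarrow> expectation (gain r f k) \<le> \<delta> * c"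
    and c: "c \<ge> 0"
  shows "integrable M (U r f n) \<and> expectation (U r f n) \<le> f y + real n * \<delta> * c"
proof -
  interpret test_function f f' f'' K by (rule tf)
  have Um: "U r f k \<in> borel_measurable M" for k unfolding U_def[abs_def] by measurable
  have ex: "exp (- r * (\<delta> * (\<Sum>i<k. D i \<omega>))) \<le> 1" for k \<omega>
    using r \<delta>_pos D_nonneg by (auto intro!: mult_nonneg_nonneg sum_nonneg)
  have Ui: "integrable M (U r f k)" for k
  proof (rule integrable_const_bound[where B=K])
    show "AE \<omega> in M. norm (U r f k \<omega>) \<le> K"
    proof (rule AE_I2)
      fix \<omega>
      have "\<bar>exp (- r * (\<delta> * (\<Sum>i<k. D i \<omega>))) * f (X k \<omega>)\<bar> \<le> 1 * K"
        unfolding abs_mult using ex[of \<omega> k] f_bound[of "X k \<omega>"] by (intro mult_mono) auto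
      then show "norm (U r f k \<omega>) \<le> K" by (simp add: U_def)
    qed
  qed (rule Um)
  have "k \<le> n \<Longrightarrow> expectation (U r f k) \<le> f y + real k * \<delta> * c" for k
  proof (induction k)
    case 0 then show ?case by (simp add: U_def[abs_def] X_def prob_space)
  next
    case (Suc k)
    define L where "L \<omega> = gain r f k \<omega>" for \<omega>
    have UL: "U r f (Suc k) \<omega> = U r f k \<omega> + exp (- r * (\<delta> * real k)) * L \<omega>" for \<omega>
      unfolding L_def by (rule U_step)
    \<comment> \<open>Integrability of the gain is read off from the bounded \<open>U\<close> by
      undoing the discount.\<close>
    have "integrable M (\<lambda>\<omega>. exp (r * (\<delta> * real k)) * (U r f (Suc k) \<omega> - U r f k \<omega>))" using Ui by auto
    also have "(\<lambda>\<omega>. exp (r * (\<delta> * real k)) * (U r f (Suc k) \<omega> - U r f k \<omega>)) = L"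
      unfolding UL by (auto simp: mult.assoc[symmetric] exp_add[symmetric])
    finally have Li: "integrable M L" .
    have "expectation (U r f (Suc k)) = expectation (U r f k) + exp (- r * (\<delta> * real k)) * expectation L"
      unfolding UL using Ui Li by simp
    also have "exp (- r * (\<delta> * real k)) * expectation L \<le> exp (- r * (\<delta> * real k)) * (\<delta> * c)"
      using step[of k] Suc.prems unfolding L_def by (intro mult_left_mono) auto
    also have "\<dots> \<le> 1 * (\<delta> * c)"
      using r \<delta>_pos c by (intro mult_right_mono) auto
    finally show ?case using Suc by (simp add: algebra_simps)
  qed
  then show ?thesis using Ui by blast
qed

section \<open>Distance between scheme and solution\<close>

lemma AE_grid: "AE \<omega> in M. \<forall>i. Y (real i * \<delta>) \<omega> = Z (real i * \<delta>) \<omega>"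
  using \<delta>_pos by (auto simp: AE_all_countable intro!: Z_eq)

lemma X_eq_euler:
  assumes "\<forall>i. Y (real i * \<delta>) \<omega> = Z (real i * \<delta>) \<omega>" "\<And>i. i < j \<Longrightarrow> D i \<omega> = 1"
  shows "X j \<omega> = euler \<delta> j \<omega>"
  unfolding X_def euler_def using assms by (intro arg_cong2[where f="(+)"] sum.cong refl) (auto simp: a_def b_def)

text \<open>The path goes from \<open>X k\<close> back to an earlier step \<open>j\<close>, where
  \<open>X j\<close> is \<open>euler\<close> because the scheme is still running at
  \<open>k\<close>, then to \<open>Y\<close> at step \<open>j\<close>, and forward to
  \<open>Y\<close> at step \<open>k\<close>, which is \<open>Z\<close> almost surely. Two uses of
  the quasi-triangle inequality give the factors 2, 4, 4. In the application \<open>j\<close> is the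
  preceding coarse point.\<close>

lemma grid_error:
  assumes "j \<le> k"
  shows "expectation (\<lambda>\<omega>. D k \<omega> * trunc_sq (X k \<omega> - Z (real k * \<delta>) \<omega>)) \<le>
    2 * tdist (X k) (X j) + 4 * tdist (euler \<delta> j) (Y (real j * \<delta>))
      + 4 * tdist (Y (real j * \<delta>)) (Y (real k * \<delta>))"
proof -
  have ZM[measurable]: "Z (real k * \<delta>) \<in> borel_measurable M" using \<delta>_pos by (intro Z_meas) auto
  have "expectation (\<lambda>\<omega>. D k \<omega> * trunc_sq (X k \<omega> - Z (real k * \<delta>) \<omega>)) \<le>
    expectation (\<lambda>\<omega>. 2 * trunc_sq (X k \<omega> - X j \<omega>) + 4 * trunc_sq (euler \<delta> j \<omega> - Y (real j * \<delta>) \<omega>)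
      + 4 * trunc_sq (Y (real j * \<delta>) \<omega> - Y (real k * \<delta>) \<omega>))"
  proof (rule integral_mono_AE)
    show "integrable M (\<lambda>\<omega>. D k \<omega> * trunc_sq (X k \<omega> - Z (real k * \<delta>) \<omega>))"
    proof (rule integrable_const_bound[where B=1])
      show "AE \<omega> in M. norm (D k \<omega> * trunc_sq (X k \<omega> - Z (real k * \<delta>) \<omega>)) \<le> 1"
      proof (rule AE_I2)
        fix \<omega> show "norm (D k \<omega> * trunc_sq (X k \<omega> - Z (real k * \<delta>) \<omega>)) \<le> 1"
          using D_01[of k \<omega>] by (elim disjE) simp_all
      qed
    qed measurable
    show "AE \<omega> in M. D k \<omega> * trunc_sq (X k \<omega> - Z (real k * \<delta>) \<omega>) \<le>
       2 * trunc_sq (X k \<omega> - X j \<omega>) + 4 * trunc_sq (euler \<delta> j \<omega> - Y (real j * \<delta>) \<omega>)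
      + 4 * trunc_sq (Y (real j * \<delta>) \<omega> - Y (real k * \<delta>) \<omega>)"
      using AE_grid
    proof eventually_elim
      case (elim \<omega>)
      show ?case
      proof (cases "D k \<omega> = 0")
        case True
        then show ?thesis by (simp add: add_nonneg_nonneg)
      next
        case False
        then have D1: "D k \<omega> = 1" using D_01 by blast
        have e: "X j \<omega> = euler \<delta> j \<omega>"
          by (rule X_eq_euler[OF elim]) (use D_mono[OF _ D1] assms in auto)
        have "trunc_sq (X k \<omega> - Z (real k * \<delta>) \<omega>) =
          trunc_sq ((X k \<omega> - X j \<omega>) + ((euler \<delta> j \<omega> - Y (real j * \<delta>) \<omega>) + (Y (real j * \<delta>) \<omega> - Y (real k * \<delta>) \<omega>)))"
          using elim e by simp
        also have "\<dots> \<le> 2 * trunc_sq (X k \<omega> - X j \<omega>) + 2 * (2 * trunc_sq (euler \<delta> j \<omega> - Y (real j * \<delta>) \<omega>)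
            + 2 * trunc_sq (Y (real j * \<delta>) \<omega> - Y (real k * \<delta>) \<omega>))"
          by (intro order_trans[OF trunc_sq_add] add_mono mult_left_mono trunc_sq_add) auto
        finally show ?thesis using D1 by simp
      qed
    qed
  qed (intro Bochner_Integration.integrable_add integrable_mult_right integrable_trunc, measurable)
  also have "\<dots> = 2 * tdist (X k) (X j) + 4 * tdist (euler \<delta> j) (Y (real j * \<delta>))
      + 4 * tdist (Y (real j * \<delta>)) (Y (real k * \<delta>))"
    by (simp add: integrable_trunc)
  finally show ?thesis .
qed

end

section \<open>Dynkin's inequality\<close>

context cir
begin

lemma stopping_measurable:
  assumes "\<And>t. 0 \<le> t \<Longrightarrow> {\<omega> \<in> space M. \<tau> \<omega> \<le> t} \<in> sets (\<F> t)" "\<And>\<omega>. \<omega> \<in> space M \<Longrightarrow> 0 \<le> \<tau> \<omega>"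
  shows "\<tau> \<in> borel_measurable M"
  unfolding borel_measurable_iff_le
proof
  fix t :: real
  show "{\<omega> \<in> space M. \<tau> \<omega> \<le> t} \<in> events"
  proof (cases "0 \<le> t")
    case True
    then show ?thesis using assms(1) nat_filtration_subset[of B M t] by auto
  next
    case False
    then have e: "{\<omega> \<in> space M. \<tau> \<omega> \<le> t} = {}" using assms(2) by force
    show ?thesis unfolding e by simp
  qed
qed

text \<open>A countable range reduces the claim to measurability of each single
  \<open>Y t\<close>.\<close>

lemma Y_at_measurable:
  fixes \<tau> :: "'a \<Rightarrow> real"
  assumes [measurable]: "\<tau> \<in> borel_measurable M" and I: "\<And>\<omega>. \<omega> \<in> space M \<Longrightarrow> \<tau> \<omega> \<in> I" "countable I"
  shows "(\<lambda>\<omega>. Y (\<tau> \<omega>) \<omega>) \<in> borel_measurable M"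
proof (rule measurable_compose_countable'[where f=Y and g=\<tau> and I=I])
  show "\<tau> \<in> measurable M (count_space I)"
  proof (subst measurable_count_space_eq_countable[OF I(2)], intro conjI ballI)
    show "\<tau> \<in> space M \<rightarrow> I" using I by auto
    show "\<tau> -` {t} \<inter> space M \<in> events" for t by measurable
  qed
qed (use I in auto)

text \<open>The order of choice is the point: \<open>q\<close> depends on the modulus of
  \<open>Y\<close> and on \<open>\<delta>0\<close>, and \<open>l\<close> comes last, when only
  finitely many coarse times are left. The share \<open>\<epsilon> / (J * q + 1)\<close> makes the
  errors of all coarse times add up to at most \<epsilon>.\<close>

lemma fine_mesh:
  assumes "0 < \<epsilon>" "0 < \<delta>0" "0 < h"
  shows "\<exists>q l. 0 < q \<and> 0 < l \<and> h / real q \<le> \<delta>0 \<and>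
    (\<forall>j\<le>J * q. tdist (euler (h / real q / real l) (j * l)) (Y (real j * (h / real q))) \<le> \<epsilon> / real (J * q + 1)) \<and>
    (\<forall>s\<in>{0..real J * h}. \<forall>s'\<in>{0..real J * h}. \<bar>s - s'\<bar> \<le> h / real q \<longrightarrow> tdist (Y s) (Y s') \<le> \<epsilon>)"
proof -
  have "0 \<le> real J * h" using assms by simp
  from Y_modulus[OF assms(1) this] obtain d where d: "d > 0"
    "\<And>s s'. s \<in> {0..real J * h} \<Longrightarrow> s' \<in> {0..real J * h} \<Longrightarrow> \<bar>s - s'\<bar> < d \<Longrightarrow> tdist (Y s) (Y s') < \<epsilon>"
    by blast
  obtain q where q: "h / min d \<delta>0 < real q" using reals_Archimedean2 by blast
  let ?E = "\<lambda>l j. tdist (euler (h / real q / real l) (j * l)) (Y (real j * (h / real q)))"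
  have md: "0 < min d \<delta>0" using d assms by simp
  then have "0 < h / min d \<delta>0" using assms by simp
  then have q0: "0 < real q" using q by linarith
  have hq: "h / real q < min d \<delta>0" using q unfolding pos_divide_less_eq[OF md] pos_divide_less_eq[OF q0] by (simp only: mult.commute)
  \<comment> \<open>Finiteness of the coarse grid turns pointwise convergence into a simultaneous
    bound.\<close>
  have "\<forall>\<^sub>F l in sequentially. \<forall>j\<in>{..J * q}. ?E l j < \<epsilon> / real (J * q + 1)"
  proof (rule eventually_ball_finite, simp, intro ballI)
    fix j
    have "0 < real (J * q + 1)" by linarith
    then have "0 < h / real q" "0 < \<epsilon> / real (J * q + 1)" using assms q0 by (auto simp del: of_nat_add of_nat_mult)
    then show "\<forall>\<^sub>F l in sequentially. ?E l j < \<epsilon> / real (J * q + 1)"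
      using order_tendstoD(2)[OF euler_tendsto] by blast
  qed
  then have "\<forall>\<^sub>F l in sequentially. 0 < l \<and> (\<forall>j\<in>{..J * q}. ?E l j < \<epsilon> / real (J * q + 1))"
    using eventually_gt_at_top[of "0::nat"] by eventually_elim simp
  then obtain l where l: "0 < l" "\<And>j. j \<le> J * q \<Longrightarrow> ?E l j < \<epsilon> / real (J * q + 1)"
    unfolding eventually_sequentially by auto
  show ?thesis
    using q0 l hq d(2) by (intro exI[of _ q] exI[of _ l]) (auto intro!: less_imp_le)
qed

text \<open>On \<open>G\<close> the path stays below \<open>m\<close> up to \<tau>, so the scheme is
  stopped by \<tau> alone and ends near the solution. Off \<open>G\<close> only the lower bound
  \<open>- c0\<close> is used: the supersolutions have \<open>c0 = 0\<close>, and for the hitting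
  times the probability of the complement tends to 0. Rational times keep \<open>G\<close> a
  countable condition, and they contain all grid times because \<open>h\<close> is rational.\<close>

lemma dynkin:
  fixes \<tau> :: "'a \<Rightarrow> real" and f f' f'' :: "real \<Rightarrow> real"
  assumes tf: "test_function f f' f'' K"
    and super: "\<And>z. z \<in> {0..m} \<Longrightarrow> f' z * drift z + f'' z * (vol z)\<^sup>2 / 2 - r * f z \<le> 0"
    and r: "r > 0" and m: "m \<ge> 0" and h: "h > 0" "h \<in> \<rat>"
    and low: "\<And>x. - c0 \<le> f x" "c0 \<ge> 0"
    and stop: "\<And>t. 0 \<le> t \<Longrightarrow> {\<omega> \<in> space M. \<tau> \<omega> \<le> t} \<in> sets (\<F> t)"
    and grid: "\<And>\<omega>. \<omega> \<in> space M \<Longrightarrow> \<exists>j\<le>J. \<tau> \<omega> = real j * h"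
    and G: "G \<in> events" "\<And>\<omega> s. \<omega> \<in> G \<Longrightarrow> s \<in> \<rat> \<Longrightarrow> 0 \<le> s \<Longrightarrow> s \<le> \<tau> \<omega> \<Longrightarrow> Y s \<omega> \<le> m"
  shows "integrable M (\<lambda>\<omega>. indicator G \<omega> * (exp (- r * \<tau> \<omega>) * f (Y (\<tau> \<omega>) \<omega>)))"
    and "expectation (\<lambda>\<omega>. indicator G \<omega> * (exp (- r * \<tau> \<omega>) * f (Y (\<tau> \<omega>) \<omega>))) \<le> f y + c0 * (1 - prob G)"
proof -
  interpret test_function f f' f'' K by (rule tf)
  define A where "A = \<mu> * (\<theta> + m)"
  define B' where "B' = \<sigma> * sqrt m"
  define K1 where "K1 = A + B'\<^sup>2 / 2 + r + 2 * A\<^sup>2 + 2 * B'\<^sup>2"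
  have AB: "0 \<le> A" "0 \<le> B'" "0 \<le> K1" using params m r by (auto simp: A_def B'_def K1_def)
  \<comment> \<open>The factor of \<eta> in the total error: the horizon times the error per unit
    time, one \<eta> for replacing the scheme by the solution at time \<tau>, and one for
    \<open>C * \<epsilon> \<le> \<eta>\<close>.\<close>
  define W where "W = real J * h * (15 * K1 + 1) + 2"
  have W: "W > 0" unfolding W_def using AB h by (intro add_nonneg_pos mult_nonneg_nonneg) auto
  let ?L = "\<lambda>\<omega>. indicator G \<omega> * (exp (- r * \<tau> \<omega>) * f (Y (\<tau> \<omega>) \<omega>))"
  have tau0: "0 \<le> \<tau> \<omega>" if "\<omega> \<in> space M" for \<omega> using grid[OF that] h by auto
  have taum[measurable]: "\<tau> \<in> borel_measurable M" by (rule stopping_measurable[OF stop tau0])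
  have [measurable]: "(\<lambda>\<omega>. Y (\<tau> \<omega>) \<omega>) \<in> borel_measurable M"
    by (rule Y_at_measurable[where I="(\<lambda>j. real j * h) ` {..J}"]) (use grid in auto)
  note G(1)[measurable]
  have Lint: "integrable M ?L"
  proof (rule integrable_const_bound[where B=K])
    show "AE \<omega> in M. norm (?L \<omega>) \<le> K"
    proof (rule AE_I2)
      fix \<omega> assume "\<omega> \<in> space M"
      then have "\<bar>indicat_real G \<omega>\<bar> * (exp (- r * \<tau> \<omega>) * \<bar>f (Y (\<tau> \<omega>) \<omega>)\<bar>) \<le> 1 * (1 * K)"
        using r tau0 f_bound K_nonneg by (intro mult_mono) (auto simp: indicator_def)
      then show "norm (?L \<omega>) \<le> K" by (simp add: abs_mult)
    qed
  qed measurable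
  have key: "expectation ?L \<le> f y + c0 * (1 - prob G) + \<eta> * W" if eta: "\<eta> > 0" for \<eta>
  proof -
    obtain C1 C2 C3 where C123: "C1 \<ge> 0" "C2 \<ge> 0" "C3 \<ge> 0"
      and mod: "\<And>z x. z \<in> {0..m} \<Longrightarrow> \<bar>f x - f z\<bar> \<le> \<eta> + C1 * trunc_sq (x - z)"
       "\<And>z x. z \<in> {0..m} \<Longrightarrow> \<bar>f' x - f' z\<bar> \<le> \<eta> + C2 * trunc_sq (x - z)"
       "\<And>z x. z \<in> {0..m} \<Longrightarrow> \<bar>f'' x - f'' z\<bar> \<le> \<eta> + C3 * trunc_sq (x - z)"
      using bounded_continuous_modulus[OF f_cont f_bound eta, of m]
        bounded_continuous_modulus[OF f'_cont f'_bound eta, of m]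
        bounded_continuous_modulus[OF f''_cont f''_bound eta, of m] by blast
    define C where "C = C1 + C2 + C3"
    have C: "C \<ge> 0" "C1 \<le> C" "C2 \<le> C" "C3 \<le> C" unfolding C_def using C123 by auto
    have up: "\<eta> + C' * trunc_sq x \<le> \<eta> + C * trunc_sq x" if "C' \<le> C" for C' x
      using that by (intro add_left_mono mult_right_mono) auto
    have modC: "\<And>x z. z \<in> {0..m} \<Longrightarrow> \<bar>f x - f z\<bar> \<le> \<eta> + C * trunc_sq (x - z)"
       "\<And>x z. z \<in> {0..m} \<Longrightarrow> \<bar>f' x - f' z\<bar> \<le> \<eta> + C * trunc_sq (x - z)"
       "\<And>x z. z \<in> {0..m} \<Longrightarrow> \<bar>f'' x - f'' z\<bar> \<le> \<eta> + C * trunc_sq (x - z)"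
      by (rule order_trans[OF mod(1) up[OF C(2)]] order_trans[OF mod(2) up[OF C(3)]] order_trans[OF mod(3) up[OF C(4)]]; assumption)+
    define c5 where "c5 = K * A\<^sup>2 / 2 + K * r\<^sup>2 + 8 * C * (A ^ 4 + 3 * B' ^ 4)"
    have c5: "c5 \<ge> 0" unfolding c5_def using K_nonneg C AB by auto
    define \<epsilon> where "\<epsilon> = \<eta> / (C + 1)"
    have eps: "\<epsilon> > 0" "C * \<epsilon> \<le> \<eta>" unfolding \<epsilon>_def using eta C by (auto simp: field_simps)
    \<comment> \<open>The four bounds serve, in this order: squares of times below the times
      themselves, the linearisation of the exponential, the motion of the scheme inside a coarse
      cell, and the quadratic term in \<open>one_step\<close>.\<close>
    define \<delta>0 where "\<delta>0 = min (min 1 (1 / r)) (min (\<epsilon> / (4 * (A\<^sup>2 + B'\<^sup>2) + 1)) (\<eta> / (c5 + 1)))"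
    have den: "0 < 4 * (A\<^sup>2 + B'\<^sup>2) + 1" by (intro add_nonneg_pos) auto
    have d0: "\<delta>0 > 0" unfolding \<delta>0_def using r eps eta c5 den by simp
    have d0': "\<delta>0 \<le> 1" "r * \<delta>0 \<le> 1" "4 * (A\<^sup>2 + B'\<^sup>2) * \<delta>0 \<le> \<epsilon>" "c5 * \<delta>0 \<le> \<eta>"
    proof -
      show "\<delta>0 \<le> 1" unfolding \<delta>0_def by simp
      have "\<delta>0 \<le> 1 / r" unfolding \<delta>0_def by simp
      then show "r * \<delta>0 \<le> 1" using r by (simp add: field_simps)
      have "\<delta>0 \<le> \<epsilon> / (4 * (A\<^sup>2 + B'\<^sup>2) + 1)" unfolding \<delta>0_def by simp
      then have "(4 * (A\<^sup>2 + B'\<^sup>2) + 1) * \<delta>0 \<le> \<epsilon>" using den by (simp add: pos_le_divide_eq mult.commute)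
      then show "4 * (A\<^sup>2 + B'\<^sup>2) * \<delta>0 \<le> \<epsilon>" using d0 by (simp add: distrib_right)
      have "\<delta>0 \<le> \<eta> / (c5 + 1)" unfolding \<delta>0_def by simp
      then have "(c5 + 1) * \<delta>0 \<le> \<eta>" using c5 by (simp add: pos_le_divide_eq mult.commute)
      then show "c5 * \<delta>0 \<le> \<eta>" using d0 by (simp add: distrib_right)
    qed
    obtain q l where ql: "0 < q" "0 < l" "h / real q \<le> \<delta>0"
      and eu: "\<And>j. j \<le> J * q \<Longrightarrow> tdist (euler (h / real q / real l) (j * l)) (Y (real j * (h / real q))) \<le> \<epsilon> / real (J * q + 1)"
      and ym: "\<And>s s'. s \<in> {0..real J * h} \<Longrightarrow> s' \<in> {0..real J * h} \<Longrightarrow> \<bar>s - s'\<bar> \<le> h / real q \<Longrightarrow> tdist (Y s) (Y s') \<le> \<epsilon>"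
      using fine_mesh[OF eps(1) d0 h(1), of J] by blast
    define h' where "h' = h / real q"
    define \<delta> where "\<delta> = h' / real l"
    have h': "0 < h'" "h' \<le> \<delta>0" "real q * h' = h" using ql h unfolding h'_def by auto
    have lh: "real l * \<delta> = h'" unfolding \<delta>_def using ql by simp
    have dpos: "\<delta> > 0" unfolding \<delta>_def using h' ql by simp
    have dle: "\<delta> \<le> h'" unfolding \<delta>_def using h' ql by (simp add: field_simps)
    have dQ: "\<delta> \<in> \<rat>" unfolding \<delta>_def h'_def using h(2) by auto
    interpret S: scheme M B \<mu> \<theta> \<sigma> y Y \<tau> m \<delta>
      using stop m dpos by unfold_locales auto
    have SA: "S.Ca = A" "S.Cb = B'" by (simp_all add: S.Ca_def S.Cb_def A_def B'_def)
    define n where "n = J * q * l"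
    have nd: "real n * \<delta> = real J * h" unfolding n_def using lh h' by (simp add: mult.assoc)
    have jl: "real (j * l) * \<delta> = real j * h'" for j using lh by (simp add: mult.assoc)
    have eu': "tdist (euler \<delta> (j * l)) (Y (real (j * l) * \<delta>)) \<le> \<epsilon> / real (J * q + 1)" if "j \<le> J * q" for j
      using eu[OF that] unfolding jl unfolding \<delta>_def h'_def .
    have e1: "\<epsilon> / real (J * q + 1) \<le> \<epsilon>"
    proof -
      have "1 \<le> real (J * q + 1)" by linarith
      then show ?thesis using divide_left_mono[of 1 "real (J * q + 1)" \<epsilon>] eps by (simp del: of_nat_add of_nat_mult)
    qed
    \<comment> \<open>Taken through the last coarse point before \<open>k\<close>, found by
      \<open>k div l\<close>. The 9 is 1 + 4 + 4: motion of the scheme, error at the coarse point,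
      motion of the solution.\<close>
    have nk: "expectation (\<lambda>\<omega>. S.D k \<omega> * trunc_sq (S.X k \<omega> - Z (real k * \<delta>) \<omega>)) \<le> 9 * \<epsilon>" if "k < n" for k
    proof -
      define j where "j = k div l"
      have jk: "j * l \<le> k" "k - j * l \<le> l" unfolding j_def using ql by (auto simp: minus_div_mult_eq_mod less_imp_le)
      have jJ: "j \<le> J * q" unfolding j_def using that ql unfolding n_def
        by (metis div_le_mono less_imp_le nonzero_mult_div_cancel_right not_gr0)
      define x where "x = real (k - j * l) * \<delta>"
      have "real (k - j * l) * \<delta> \<le> real l * \<delta>"
        using jk(2) dpos by (intro mult_right_mono of_nat_mono) auto
      then have x: "0 \<le> x" "x \<le> h'" unfolding x_def lh using dpos by auto
      have T: "real k * \<delta> \<in> {0..real J * h}" "real (j * l) * \<delta> \<in> {0..real J * h}"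
      proof -
        have "real i * \<delta> \<in> {0..real J * h}" if "i \<le> n" for i
          using mult_right_mono[OF of_nat_mono[OF that], of \<delta>] dpos unfolding nd[symmetric] by simp
        then show "real k * \<delta> \<in> {0..real J * h}" "real (j * l) * \<delta> \<in> {0..real J * h}"
          using that jk by (auto simp del: of_nat_mult)
      qed
      have "\<bar>real (j * l) * \<delta> - real k * \<delta>\<bar> = x"
        using x(1) jk(1) unfolding x_def by (simp add: of_nat_diff left_diff_distrib)
      then have w: "tdist (Y (real (j * l) * \<delta>)) (Y (real k * \<delta>)) \<le> \<epsilon>"
        using ym[OF T(2,1)] x unfolding h'_def by simp
      have "tdist (S.X k) (S.X (j * l)) \<le> 2 * (A * x)\<^sup>2 + 2 * B'\<^sup>2 * x"
        using S.X_increment_L2[OF jk(1)] unfolding SA x_def .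
      also have "\<dots> = 2 * A\<^sup>2 * (x * x) + 2 * B'\<^sup>2 * x" by (simp add: power_mult_distrib power2_eq_square)
      also have "\<dots> \<le> 2 * A\<^sup>2 * (1 * x) + 2 * B'\<^sup>2 * x"
        using x h' d0' by (intro add_mono mult_left_mono mult_right_mono) auto
      also have "\<dots> = 2 * (A\<^sup>2 + B'\<^sup>2) * x" by (simp add: algebra_simps)
      also have "\<dots> \<le> 2 * (A\<^sup>2 + B'\<^sup>2) * \<delta>0" using x h' by (intro mult_left_mono) auto
      finally have "2 * tdist (S.X k) (S.X (j * l)) \<le> \<epsilon>"
        using d0'(3) by (simp add: algebra_simps)
      with S.grid_error[OF jk(1)] w eu'[OF jJ] e1 show ?thesis by simp
    qed
    \<comment> \<open>The 15 rounds up 1 + 9 * 3/2; the extra 1 pays for the quadratic term.\<close>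
    define c where "c = (15 * K1 + 1) * \<eta>"
    have step: "expectation (S.gain r f k) \<le> \<delta> * c" if "k < n" for k
    proof -
      have rd: "r * \<delta> \<le> 1"
      proof -
        have "r * \<delta> \<le> r * \<delta>0" using r dle h' by (intro mult_left_mono) auto
        then show ?thesis using d0' by simp
      qed
      have "expectation (S.gain r f k) \<le>
        \<delta> * (K1 * (\<eta> + 3 / 2 * C * expectation (\<lambda>\<omega>. S.D k \<omega> * trunc_sq (S.X k \<omega> - Z (real k * \<delta>) \<omega>))) + c5 * \<delta>)"
        unfolding K1_def c5_def SA[symmetric]
        by (rule S.one_step[OF tf super modC C(1) _ r rd]) (use eta dle h' d0' in auto)
      also have "\<dots> \<le> \<delta> * (K1 * (\<eta> + 3 / 2 * C * (9 * \<epsilon>)) + c5 * \<delta>0)"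
        using nk[OF that] dpos AB C c5 dle h' by (intro mult_left_mono add_mono order_refl) auto
      also have "\<dots> \<le> \<delta> * (K1 * (15 * \<eta>) + \<eta>)"
      proof (intro mult_left_mono add_mono)
        show "\<eta> + 3 / 2 * C * (9 * \<epsilon>) \<le> 15 * \<eta>" using eps(2) eta by simp
      qed (use dpos AB d0' in auto)
      also have "\<dots> = \<delta> * c" unfolding c_def by (simp add: algebra_simps)
      finally show ?thesis .
    qed
    have c: "c \<ge> 0" unfolding c_def using AB eta by simp
    note Uexp = S.U_expectation[OF tf r step c, of n]
    \<comment> \<open>The coarse point at which \<tau> falls is random, so the error there is
      bounded by the sum over all coarse points.\<close>
    define E where "E j \<omega> = trunc_sq (euler \<delta> (j * l) \<omega> - Y (real (j * l) * \<delta>) \<omega>)" for j \<omega>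
    have Ei: "integrable M (E j)" for j unfolding E_def by (rule integrable_trunc) measurable
    have E0: "0 \<le> E j \<omega>" for j \<omega> unfolding E_def by simp
    have "expectation ?L \<le> expectation (\<lambda>\<omega>. S.U r f n \<omega> + c0 * (1 - indicator G \<omega>) + \<eta> + C * (\<Sum>j\<le>J * q. E j \<omega>))"
    proof (rule integral_mono_AE)
      show "integrable M ?L" by (rule Lint)
      show "integrable M (\<lambda>\<omega>. S.U r f n \<omega> + c0 * (1 - indicator G \<omega>) + \<eta> + C * (\<Sum>j\<le>J * q. E j \<omega>))"
        using Uexp Ei G(1) by (auto simp: emeasure_eq_measure)
      show "AE \<omega> in M. ?L \<omega> \<le> S.U r f n \<omega> + c0 * (1 - indicator G \<omega>) + \<eta> + C * (\<Sum>j\<le>J * q. E j \<omega>)"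
        using S.AE_grid AE_space
      proof eventually_elim
        case (elim \<omega>)
        have S0: "0 \<le> C * (\<Sum>j\<le>J * q. E j \<omega>)" using C E0 by (intro mult_nonneg_nonneg sum_nonneg) auto
        show ?case
        proof (cases "\<omega> \<in> G")
          case False
          have ex: "exp (- r * (\<delta> * (\<Sum>i<n. S.D i \<omega>))) \<le> 1"
            using r dpos S.D_nonneg by (auto intro!: mult_nonneg_nonneg sum_nonneg)
          have "exp (- r * (\<delta> * (\<Sum>i<n. S.D i \<omega>))) * (- c0) \<le> S.U r f n \<omega>"
            unfolding S.U_def using low by (intro mult_left_mono) auto
          moreover have "exp (- r * (\<delta> * (\<Sum>i<n. S.D i \<omega>))) * c0 \<le> 1 * c0"
            using ex low by (intro mult_right_mono) auto
          ultimately have "- c0 \<le> S.U r f n \<omega>" by simp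
          then show ?thesis using False S0 eta by simp
        next
          case True
          obtain j0 where j0: "j0 \<le> J" "\<tau> \<omega> = real j0 * h" using grid elim by blast
          \<comment> \<open>The exact index of \<tau> on the fine grid, available because
            \<open>h\<close> is a multiple of \<delta>.\<close>
          define \<kappa> where "\<kappa> = j0 * q * l"
          have kt: "real \<kappa> * \<delta> = \<tau> \<omega>" unfolding \<kappa>_def j0(2) using lh h' by (simp add: mult.assoc)
          have kn: "\<kappa> \<le> n" unfolding \<kappa>_def n_def using j0 by simp
          have D1: "S.D i \<omega> = 1" if "i < \<kappa>" for i
          proof -
            have "real i * \<delta> < \<tau> \<omega>" unfolding kt[symmetric] using that dpos by simp
            moreover have "Z (real i' * \<delta>) \<omega> \<in> {0..m}" if "i' \<le> i" for i'
            proof -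
              have le: "real i' * \<delta> \<le> \<tau> \<omega>" "0 \<le> real i' * \<delta>" "real i' * \<delta> \<in> \<rat>"
                unfolding kt[symmetric] using that \<open>i < \<kappa>\<close> dpos dQ by (auto intro!: mult_right_mono)
              have "Y (real i' * \<delta>) \<omega> \<le> m" by (rule G(2)[OF True le(3,2,1)])
              moreover have "0 \<le> Y (real i' * \<delta>) \<omega>" by (rule Y_nonneg[OF elim(2) le(2)])
              ultimately show ?thesis using elim(1) by simp
            qed
            ultimately show ?thesis by (auto simp: S.D_def)
          qed
          have D0: "S.D i \<omega> = 0" if "\<kappa> \<le> i" for i
          proof -
            have "\<tau> \<omega> \<le> real i * \<delta>" unfolding kt[symmetric] using that dpos by (intro mult_right_mono) auto
            then show ?thesis by (simp add: S.D_def)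
          qed
          have split: "(\<Sum>i<n. g i) = (\<Sum>i<\<kappa>. g i)" if "\<And>i. \<kappa> \<le> i \<Longrightarrow> g i = 0" for g :: "nat \<Rightarrow> real"
            by (rule sum.mono_neutral_right) (use kn that in \<open>auto simp: not_less\<close>)
          have Dsum: "(\<Sum>i<n. S.D i \<omega>) = real \<kappa>" using split[of "\<lambda>i. S.D i \<omega>"] D0 D1 by simp
          have "S.X n \<omega> = S.X \<kappa> \<omega>"
            unfolding S.X_def using split[of "\<lambda>i. S.a i \<omega> * \<delta> + S.b i \<omega> * incr \<delta> i \<omega>"] D0
            by (simp add: S.a_def S.b_def)
          also have "\<dots> = euler \<delta> \<kappa> \<omega>" by (rule S.X_eq_euler[OF elim(1) D1])
          finally have Xn: "S.X n \<omega> = euler \<delta> \<kappa> \<omega>" .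
          have Un: "S.U r f n \<omega> = exp (- r * \<tau> \<omega>) * f (euler \<delta> \<kappa> \<omega>)"
            unfolding S.U_def Dsum Xn using kt by (simp add: mult.commute)
          have tQ: "\<tau> \<omega> \<in> \<rat>" unfolding j0(2) using h by auto
          have z: "Y (\<tau> \<omega>) \<omega> \<in> {0..m}"
            using G(2)[OF True tQ tau0[OF elim(2)] order_refl] Y_nonneg[OF elim(2) tau0[OF elim(2)]] by simp
          have "f (Y (\<tau> \<omega>) \<omega>) - f (euler \<delta> \<kappa> \<omega>) \<le> \<eta> + C * trunc_sq (euler \<delta> \<kappa> \<omega> - Y (\<tau> \<omega>) \<omega>)"
            using modC(1)[OF z, of "euler \<delta> \<kappa> \<omega>"] by linarith
          also have "trunc_sq (euler \<delta> \<kappa> \<omega> - Y (\<tau> \<omega>) \<omega>) = E (j0 * q) \<omega>"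
            unfolding E_def \<kappa>_def[symmetric] kt ..
          also have "E (j0 * q) \<omega> \<le> (\<Sum>j\<le>J * q. E j \<omega>)"
            using j0 E0 by (intro member_le_sum) auto
          finally have df: "f (Y (\<tau> \<omega>) \<omega>) - f (euler \<delta> \<kappa> \<omega>) \<le> \<eta> + C * (\<Sum>j\<le>J * q. E j \<omega>)"
            using C by (simp add: mult_left_mono)
          have "exp (- r * \<tau> \<omega>) * (f (Y (\<tau> \<omega>) \<omega>) - f (euler \<delta> \<kappa> \<omega>)) \<le> exp (- r * \<tau> \<omega>) * (\<eta> + C * (\<Sum>j\<le>J * q. E j \<omega>))"
            by (rule mult_left_mono[OF df]) simp
          also have "\<dots> \<le> 1 * (\<eta> + C * (\<Sum>j\<le>J * q. E j \<omega>))"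
            using r tau0[OF elim(2)] eta S0 by (intro mult_right_mono) auto
          finally show ?thesis using True Un by (simp add: right_diff_distrib)
        qed
      qed
    qed
    also have "\<dots> = expectation (S.U r f n) + c0 * (1 - prob G) + \<eta> + C * (\<Sum>j\<le>J * q. expectation (E j))"
    proof -
      have iG: "integrable M (\<lambda>\<omega>. 1 - indicat_real G \<omega>)" "integrable M (indicat_real G)"
        using G(1) by (auto simp: emeasure_eq_measure)
      have iE: "integrable M (\<lambda>\<omega>. \<Sum>j\<le>J * q. E j \<omega>)" using Ei by auto
      have "expectation (\<lambda>\<omega>. \<Sum>j\<le>J * q. E j \<omega>) = (\<Sum>j\<le>J * q. expectation (E j))"
        using Ei by (simp add: Bochner_Integration.integral_sum)
      moreover have "expectation (\<lambda>\<omega>. 1 - indicat_real G \<omega>) = 1 - prob G"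
        using iG(2) G(1) by (simp add: prob_space)
      ultimately show ?thesis using Uexp iG(1) iE by (simp add: prob_space)
    qed
    also have "\<dots> \<le> (f y + real n * \<delta> * c) + c0 * (1 - prob G) + \<eta> + C * \<epsilon>"
    proof (intro add_mono mult_left_mono order_refl)
      have "(\<Sum>j\<le>J * q. expectation (E j)) \<le> (\<Sum>j\<le>J * q. \<epsilon> / real (J * q + 1))"
        unfolding E_def by (intro sum_mono eu') auto
      also have "\<dots> = real (J * q + 1) * (\<epsilon> / real (J * q + 1))"
        unfolding sum_constant card_atMost by (simp only: Suc_eq_plus1)
      also have "\<dots> = \<epsilon>" by (simp only: nonzero_mult_div_cancel_left of_nat_eq_0_iff times_divide_eq_right)
      finally show "(\<Sum>j\<le>J * q. expectation (E j)) \<le> \<epsilon>" .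
    qed (use Uexp C low(2) in auto)
    also have "\<dots> \<le> f y + c0 * (1 - prob G) + \<eta> * W"
      unfolding nd c_def W_def using eps(2) by (simp add: algebra_simps)
    finally show ?thesis .
  qed
  show "integrable M ?L" by (rule Lint)
  show "expectation ?L \<le> f y + c0 * (1 - prob G)"
  proof (rule field_le_epsilon)
    fix e :: real assume "0 < e"
    then show "expectation ?L \<le> f y + c0 * (1 - prob G) + e"
      using key[of "e / W"] W by simp
  qed
qed

end

section \<open>Kummer's equation and smooth cutoffs\<close>

definition powser :: "(nat \<Rightarrow> real) \<Rightarrow> real \<Rightarrow> real" where
  "powser d x = (\<Sum>n. d n * x ^ n)"

definition kummer_coeff :: "real \<Rightarrow> real \<Rightarrow> nat \<Rightarrow> real" where
  "kummer_coeff a b n = pochhammer a n / (pochhammer b n * fact n)"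

lemma kummerM_powser: "kummerM a b = powser (kummer_coeff a b)"
  unfolding kummerM_def powser_def kummer_coeff_def by (auto simp: fun_eq_iff)

lemma kummer_coeff_pos: "0 < a \<Longrightarrow> 0 < b \<Longrightarrow> 0 < kummer_coeff a b n"
  unfolding kummer_coeff_def by (simp add: pochhammer_pos)

text \<open>Kummer's equation read off coefficient by coefficient; the same recurrence feeds the
  ratio test.\<close>

lemma kummer_coeff_Suc:
  "0 < a \<Longrightarrow> 0 < b \<Longrightarrow> real (Suc n) * (b + real n) * kummer_coeff a b (Suc n) = (a + real n) * kummer_coeff a b n"
proof -
  assume "0 < a" "0 < b"
  then have "pochhammer b n > 0" "b + real n > 0" by (auto simp: pochhammer_pos)
  then show ?thesis unfolding kummer_coeff_def pochhammer_Suc fact_Suc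
    by (simp add: divide_simps del: of_nat_Suc)
qed

lemma kummer_summable:
  assumes "0 < a" "0 < b"
  shows "summable (\<lambda>n. kummer_coeff a b n * x ^ n)"
proof -
  \<comment> \<open>The quotient of consecutive coefficients is at most
    \<open>(1 + a / b) / (n + 1)\<close>, so beyond this \<open>N\<close> the ratio is at most
    1/2.\<close>
  obtain N where N: "2 * \<bar>x\<bar> * (1 + a / b) < real N" using reals_Archimedean2 by blast
  show ?thesis
  proof (rule summable_ratio_test[where c="1 / 2" and N=N])
    fix n assume n: "N \<le> n"
    let ?c = "kummer_coeff a b"
    have bn: "0 < b + real n" "0 < real (Suc n)" using assms by auto
    have "(a + real n) \<le> (1 + a / b) * (b + real n)" using assms by (simp add: field_simps)
    then have "\<bar>x\<bar> * (a + real n) \<le> \<bar>x\<bar> * ((1 + a / b) * (b + real n))" by (rule mult_left_mono) simp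
    also have "\<dots> = (2 * \<bar>x\<bar> * (1 + a / b)) * (b + real n) / 2" by simp
    also have "\<dots> \<le> real (Suc n) * (b + real n) / 2"
      using N n bn by (intro divide_right_mono mult_right_mono) auto
    finally have le: "\<bar>x\<bar> * (a + real n) \<le> real (Suc n) * (b + real n) / 2" .
    have "(real (Suc n) * (b + real n)) * (?c (Suc n) * \<bar>x\<bar>) = \<bar>x\<bar> * (real (Suc n) * (b + real n) * ?c (Suc n))"
      by (simp only: mult_ac)
    also have "\<dots> = (\<bar>x\<bar> * (a + real n)) * ?c n"
      unfolding kummer_coeff_Suc[OF assms] by (simp only: mult.assoc)
    also have "\<dots> \<le> (real (Suc n) * (b + real n) / 2) * ?c n"
      using le kummer_coeff_pos[OF assms, of n] by (intro mult_right_mono) auto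
    finally have "(real (Suc n) * (b + real n)) * (?c (Suc n) * \<bar>x\<bar>) \<le> (real (Suc n) * (b + real n)) * (1 / 2 * ?c n)"
      by simp
    then have "?c (Suc n) * \<bar>x\<bar> \<le> 1 / 2 * ?c n"
      using bn by (subst (asm) mult_le_cancel_left_pos) auto
    then have "?c (Suc n) * \<bar>x\<bar> * \<bar>x\<bar> ^ n \<le> 1 / 2 * ?c n * \<bar>x\<bar> ^ n" by (rule mult_right_mono) simp
    then show "norm (?c (Suc n) * x ^ Suc n) \<le> 1 / 2 * norm (?c n * x ^ n)"
      using kummer_coeff_pos[OF assms] by (simp add: abs_mult power_abs abs_of_pos mult.assoc)
  qed simp
qed

definition entire_coeff :: "(nat \<Rightarrow> real) \<Rightarrow> bool" where
  "entire_coeff d \<longleftrightarrow> (\<forall>x. summable (\<lambda>n. d n * x ^ n))"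

lemma entire_diffs: "entire_coeff d \<Longrightarrow> entire_coeff (diffs d)"
  unfolding entire_coeff_def by (auto intro: termdiff_converges_all)

lemma powser_deriv: "entire_coeff d \<Longrightarrow> (powser d has_real_derivative powser (diffs d) x) (at x)"
  unfolding entire_coeff_def powser_def[abs_def] by (rule termdiffs_strong_converges_everywhere) blast

lemma powser_ge:
  assumes "entire_coeff d" "\<And>n. 0 \<le> d n" "0 \<le> x"
  shows "d 0 \<le> powser d x"
proof -
  have "sum (\<lambda>n. d n * x ^ n) {0} \<le> (\<Sum>n. d n * x ^ n)"
    using assms unfolding entire_coeff_def by (intro sum_le_suminf) auto
  then show ?thesis by (simp add: powser_def)
qed

lemma powser_sums: "entire_coeff d \<Longrightarrow> (\<lambda>n. d n * x ^ n) sums powser d x"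
  unfolding entire_coeff_def powser_def by (auto intro: summable_sums)

lemma powser_shift_sums: "entire_coeff d \<Longrightarrow> (\<lambda>n. (if n = 0 then 0 else d (n - 1)) * x ^ n) sums (x * powser d x)"
proof -
  assume "entire_coeff d"
  from sums_mult[OF powser_sums[OF this], of x x]
  have "(\<lambda>n. (if Suc n = 0 then 0 else d (Suc n - 1)) * x ^ Suc n) sums (x * powser d x)"
    by (simp add: mult_ac)
  from sums_Suc[OF this] show ?thesis by simp
qed

lemma kummer_ode:
  assumes "0 < a" "0 < b"
  defines "d \<equiv> kummer_coeff a b"
  shows "x * powser (diffs (diffs d)) x + (b - x) * powser (diffs d) x = a * powser d x"
proof -
  have e: "entire_coeff d" using kummer_summable[OF assms(1,2)] unfolding entire_coeff_def d_def by blast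
  note e1 = entire_diffs[OF e] and e2 = entire_diffs[OF entire_diffs[OF e]]
  have "(\<lambda>n. (if n = 0 then 0 else diffs (diffs d) (n - 1)) * x ^ n + b * (diffs d n * x ^ n)
      - (if n = 0 then 0 else diffs d (n - 1)) * x ^ n)
    sums (x * powser (diffs (diffs d)) x + b * powser (diffs d) x - x * powser (diffs d) x)"
    by (intro sums_add sums_diff sums_mult powser_shift_sums powser_sums e1 e2)
  moreover have "(if n = 0 then 0 else diffs (diffs d) (n - 1)) * x ^ n + b * (diffs d n * x ^ n)
      - (if n = 0 then 0 else diffs d (n - 1)) * x ^ n = a * (d n * x ^ n)" for n
  proof -
    have "(if n = 0 then 0 else diffs (diffs d) (n - 1)) + b * diffs d n - (if n = 0 then 0 else diffs d (n - 1)) = a * d n"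
      using kummer_coeff_Suc[OF assms(1,2), of n, folded d_def]
      by (cases n) (auto simp: diffs_def algebra_simps)
    from arg_cong[OF this, of "\<lambda>t. t * x ^ n"] show ?thesis by (simp add: algebra_simps)
  qed
  ultimately have "(\<lambda>n. a * (d n * x ^ n)) sums (x * powser (diffs (diffs d)) x + b * powser (diffs d) x - x * powser (diffs d) x)"
    by simp
  from sums_unique2[OF this sums_mult[OF powser_sums[OF e]]] show ?thesis
    by (simp add: algebra_simps)
qed

text \<open>All coefficients of the series and of its derivatives are positive, so on the half-line
  each function is at least its constant term. The uniform \<kappa> below the second derivative
  later forces the free boundary to exist.\<close>

lemma cirF_solution:
  fixes \<mu> \<theta> \<sigma> r :: real
  assumes p: "\<mu> > 0" "\<theta> > 0" "\<sigma> > 0" "r > 0"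
  shows "\<exists>F1 F2 \<kappa>. (\<forall>x. (cirF \<mu> \<theta> \<sigma> r has_real_derivative F1 x) (at x)) \<and> (\<forall>x. (F1 has_real_derivative F2 x) (at x)) \<and>
    continuous_on UNIV F2 \<and> (\<forall>x. F1 x * (\<mu> * (\<theta> - x)) + F2 x * (\<sigma>\<^sup>2 * x) / 2 - r * cirF \<mu> \<theta> \<sigma> r x = 0) \<and>
    \<kappa> > 0 \<and> (\<forall>x\<ge>0. 1 \<le> cirF \<mu> \<theta> \<sigma> r x \<and> 0 < F1 x \<and> \<kappa> \<le> F2 x)"
proof -
  define a b k where "a = r / \<mu>" "b = 2 * \<mu> * \<theta> / \<sigma>\<^sup>2" "k = 2 * \<mu> / \<sigma>\<^sup>2"
  have pos: "a > 0" "b > 0" "k > 0" unfolding a_b_k_def using p by auto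
  define d where "d = kummer_coeff a b"
  have e: "entire_coeff d" using kummer_summable[OF pos(1,2)] unfolding entire_coeff_def d_def by blast
  note e1 = entire_diffs[OF e]
  note e2 = entire_diffs[OF e1]
  define F1 where "F1 x = powser (diffs d) (k * x) * k" for x
  define F2 where "F2 x = powser (diffs (diffs d)) (k * x) * k * k" for x
  have F: "cirF \<mu> \<theta> \<sigma> r = (\<lambda>x. powser d (k * x))"
    unfolding cirF_def kummerM_powser d_def a_b_k_def by (auto simp: fun_eq_iff)
  have ch: "((\<lambda>x. powser q (k * x)) has_real_derivative powser (diffs q) (k * x) * k) (at x)" if "entire_coeff q" for q x
    by (rule DERIV_chain2[where g="\<lambda>x. k * x", OF powser_deriv[OF that]]) (auto intro!: derivative_eq_intros)
  have D0: "(cirF \<mu> \<theta> \<sigma> r has_real_derivative F1 x) (at x)" for x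
    unfolding F F1_def by (rule ch[OF e])
  have D1: "(F1 has_real_derivative F2 x) (at x)" for x
    unfolding F1_def[abs_def] F2_def by (rule DERIV_cmult_right[OF ch[OF e1]])
  have D2: "(F2 has_real_derivative powser (diffs (diffs (diffs d))) (k * x) * k * k * k) (at x)" for x
    unfolding F2_def[abs_def] by (intro DERIV_cmult_right ch[OF e2])
  then have cont: "continuous_on UNIV F2"
    by (intro DERIV_continuous_on) (auto intro: has_field_derivative_at_within)
  have ode: "F1 x * (\<mu> * (\<theta> - x)) + F2 x * (\<sigma>\<^sup>2 * x) / 2 - r * cirF \<mu> \<theta> \<sigma> r x = 0" for x
  proof -
    \<comment> \<open>With these identities the CIR equation at \<open>x\<close> is \<mu> times
      Kummer's equation at \<open>k * x\<close>.\<close>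
    have k: "k * \<sigma>\<^sup>2 = 2 * \<mu>" "k * \<theta> = b" "r = \<mu> * a" unfolding a_b_k_def using p by auto
    have "F2 x * (\<sigma>\<^sup>2 * x) / 2 = powser (diffs (diffs d)) (k * x) * k * x * (k * \<sigma>\<^sup>2) / 2"
      unfolding F2_def by (simp add: mult_ac)
    also have "\<dots> = \<mu> * ((k * x) * powser (diffs (diffs d)) (k * x))" unfolding k(1) by simp
    finally have 1: "F2 x * (\<sigma>\<^sup>2 * x) / 2 = \<mu> * ((k * x) * powser (diffs (diffs d)) (k * x))" .
    have "F1 x * (\<mu> * (\<theta> - x)) = \<mu> * ((k * \<theta> - k * x) * powser (diffs d) (k * x))"
      unfolding F1_def by (simp add: algebra_simps)
    then have 2: "F1 x * (\<mu> * (\<theta> - x)) = \<mu> * ((b - k * x) * powser (diffs d) (k * x))" unfolding k(2) .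
    have 3: "r * cirF \<mu> \<theta> \<sigma> r x = \<mu> * (a * powser d (k * x))" by (subst F) (simp add: k(3))
    show ?thesis unfolding 1 2 3
      using kummer_ode[OF pos(1,2), of "k * x", folded d_def] by (simp flip: distrib_left right_diff_distrib add: add.commute)
  qed
  have dpos: "0 < d n" for n unfolding d_def by (rule kummer_coeff_pos[OF pos(1,2)])
  have d1: "0 < diffs d n" "0 < diffs (diffs d) n" for n using dpos by (auto simp: diffs_def)
  have d00: "d 0 = 1" by (simp add: d_def kummer_coeff_def)
  have "1 \<le> cirF \<mu> \<theta> \<sigma> r x \<and> 0 < F1 x \<and> diffs (diffs d) 0 * k * k \<le> F2 x" if "x \<ge> 0" for x
  proof -
    have "0 \<le> k * x" using that pos by simp
    then have "d 0 \<le> powser d (k * x)" "diffs d 0 \<le> powser (diffs d) (k * x)" "diffs (diffs d) 0 \<le> powser (diffs (diffs d)) (k * x)"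
      by (rule powser_ge[OF e less_imp_le[OF dpos]] powser_ge[OF e1 less_imp_le[OF d1(1)]]
          powser_ge[OF e2 less_imp_le[OF d1(2)]])+
    then show ?thesis using d1(1)[of 0] pos unfolding F F1_def F2_def d00 by (auto intro!: mult_right_mono mult_pos_pos)
  qed
  then show ?thesis using D0 D1 cont ode d1(2)[of 0] pos
    by (intro exI[of _ F1] exI[of _ F2] exI[of _ "diffs (diffs d) 0 * k * k"]) auto
qed

section \<open>Glueing and bounded smooth cutoffs\<close>

lemma DERIV_glue:
  fixes g h g' h' :: "real \<Rightarrow> real"
  assumes g: "\<And>x. (g has_real_derivative g' x) (at x)" and h: "\<And>x. (h has_real_derivative h' x) (at x)"
    and p: "g p = h p" "g' p = h' p"
  shows "((\<lambda>x. if x \<le> p then g x else h x) has_real_derivative (if x \<le> p then g' x else h' x)) (at x)"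
proof -
  consider "x < p" | "x > p" | "x = p" by linarith
  then show ?thesis
  proof cases
    case 1
    have "((\<lambda>x. if x \<le> p then g x else h x) has_real_derivative g' x) (at x)"
      by (rule has_field_derivative_transform_within_open[OF g, of "{..<p}"]) (use 1 in auto)
    then show ?thesis using 1 by simp
  next
    case 2
    have "((\<lambda>x. if x \<le> p then g x else h x) has_real_derivative h' x) (at x)"
      by (rule has_field_derivative_transform_within_open[OF h, of "{p<..}"]) (use 2 in auto)
    then show ?thesis using 2 by simp
  next
    case 3
    let ?f = "\<lambda>x. if x \<le> p then g x else h x"
    have "((\<lambda>y. (?f y - ?f p) / (y - p)) \<longlongrightarrow> g' p) (at p)"
    proof (rule filterlim_split_at)
      have "((\<lambda>y. (g y - g p) / (y - p)) \<longlongrightarrow> g' p) (at_left p)"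
        using g[of p] unfolding has_field_derivative_iff by (rule filterlim_at_split[THEN iffD1, THEN conjunct1])
      then show "((\<lambda>y. (?f y - ?f p) / (y - p)) \<longlongrightarrow> g' p) (at_left p)"
        by (rule Lim_transform_eventually) (auto simp: eventually_at_filter)
      have "((\<lambda>y. (h y - h p) / (y - p)) \<longlongrightarrow> h' p) (at_right p)"
        using h[of p] unfolding has_field_derivative_iff by (rule filterlim_at_split[THEN iffD1, THEN conjunct2])
      then show "((\<lambda>y. (?f y - ?f p) / (y - p)) \<longlongrightarrow> g' p) (at_right p)"
        unfolding p(2) by (rule Lim_transform_eventually) (auto simp: eventually_at_filter p(1))
    qed
    then show ?thesis using 3 unfolding has_field_derivative_iff by simp
  qed
qed

lemma continuous_glue:
  fixes g h :: "real \<Rightarrow> real"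
  assumes "continuous_on UNIV g" "continuous_on UNIV h" "g p = h p"
  shows "continuous_on UNIV (\<lambda>x. if x \<le> p then g x else h x)"
  by (rule continuous_on_cases_le) (use assms in \<open>auto intro: continuous_on_subset continuous_on_id\<close>)

text \<open>Away from \<open>[0, m]\<close> the identity is bent into bounded arctangent branches; both glueing points
  are inflection points of the arctangent, so the result is twice continuously differentiable.\<close>
lemma smooth_clamp:
  fixes d m :: real
  assumes d: "d > 0" and m: "m \<ge> 0"
  shows "\<exists>\<rho> \<rho>1 \<rho>2. (\<forall>x. (\<rho> has_real_derivative \<rho>1 x) (at x)) \<and> (\<forall>x. (\<rho>1 has_real_derivative \<rho>2 x) (at x)) \<and>
    continuous_on UNIV \<rho>2 \<and> (\<forall>x. \<rho> x \<in> {- 2 * d..m + 2} \<and> \<bar>\<rho>1 x\<bar> \<le> 1 \<and> \<bar>\<rho>2 x\<bar> \<le> 1 + 1 / d) \<and>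
    (\<forall>x\<in>{0..m}. \<rho> x = x \<and> \<rho>1 x = 1 \<and> \<rho>2 x = 0)"
proof -
  let ?B = "\<lambda>e x. e * arctan (x / e)" and ?B1 = "\<lambda>e x. 1 / (1 + (x / e)\<^sup>2)" and ?B2 = "\<lambda>e x. - 2 * (x / e) / (1 + (x / e)\<^sup>2)\<^sup>2 / e"
  have nz: "1 + t\<^sup>2 \<noteq> 0" "0 < 1 + t\<^sup>2" for t :: real
    by (simp_all add: add_pos_nonneg) (smt (verit) zero_le_power2)
  have B: "(?B e has_real_derivative ?B1 e x) (at x)" "(?B1 e has_real_derivative ?B2 e x) (at x)" if "e > 0" for e x :: real
  proof -
    show "(?B e has_real_derivative ?B1 e x) (at x)"
      using that nz(1)[of "x / e"] by (auto intro!: derivative_eq_intros simp: inverse_eq_divide)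
    show "(?B1 e has_real_derivative ?B2 e x) (at x)"
      using that nz(1)[of "x / e"] by (auto intro!: derivative_eq_intros simp: power2_eq_square divide_simps)
  qed
  have Bc: "continuous_on UNIV (?B2 e)" if "e > 0" for e :: real
    using that nz by (intro continuous_intros) auto
  define h h1 h2 where "h x = (if x \<le> m then x else m + ?B 1 (x - m))"
     "h1 x = (if x \<le> m then 1 else ?B1 1 (x - m))" "h2 x = (if x \<le> m then 0 else ?B2 1 (x - m))" for x
  have sh: "((\<lambda>x. ?B 1 (x - m)) has_real_derivative ?B1 1 (x - m)) (at x)"
    "((\<lambda>x. ?B1 1 (x - m)) has_real_derivative ?B2 1 (x - m)) (at x)" for x
    using DERIV_shift[of "?B 1" "?B1 1 (x - m)" x "- m"] B(1)[of 1 "x - m"]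
      DERIV_shift[of "?B1 1" "?B2 1 (x - m)" x "- m"] B(2)[of 1 "x - m"] by simp_all
  have hD: "(h has_real_derivative h1 x) (at x)" for x
  proof -
    have "((\<lambda>x. m + ?B 1 (x - m)) has_real_derivative 0 + ?B1 1 (x - m)) (at x)" for x
      by (rule DERIV_add[OF DERIV_const sh(1)])
    then show ?thesis unfolding h_h1_h2_def[abs_def] by (intro DERIV_glue) auto
  qed
  have hD1: "(h1 has_real_derivative h2 x) (at x)" for x
  proof -
    note sh(2)
    then show ?thesis unfolding h_h1_h2_def[abs_def] by (intro DERIV_glue) auto
  qed
  have hc: "continuous_on UNIV h2"
    unfolding h_h1_h2_def[abs_def] by (rule continuous_glue) (use nz in \<open>auto intro!: continuous_intros\<close>)
  \<comment> \<open>The left branch has scale \<open>d\<close>, so that the values fall below 0 by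
    at most \<open>2 * d\<close>; above \<open>m\<close> the scale 1 is enough.\<close>
  define \<rho> \<rho>1 \<rho>2 where "\<rho> x = (if x \<le> 0 then ?B d x else h x)"
     "\<rho>1 x = (if x \<le> 0 then ?B1 d x else h1 x)" "\<rho>2 x = (if x \<le> 0 then ?B2 d x else h2 x)" for x
  have h0: "h 0 = 0" "h1 0 = 1" "h2 0 = 0" using m by (auto simp: h_h1_h2_def)
  have D: "(\<rho> has_real_derivative \<rho>1 x) (at x)" for x
    unfolding \<rho>_\<rho>1_\<rho>2_def[abs_def] by (rule DERIV_glue[OF B(1)[OF d] hD]) (simp_all add: h0)
  have D1: "(\<rho>1 has_real_derivative \<rho>2 x) (at x)" for x
    unfolding \<rho>_\<rho>1_\<rho>2_def[abs_def] by (rule DERIV_glue[OF B(2)[OF d] hD1]) (simp_all add: h0)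
  have c: "continuous_on UNIV \<rho>2"
    unfolding \<rho>_\<rho>1_\<rho>2_def[abs_def] by (rule continuous_glue[OF Bc[OF d] hc]) (simp add: h0)
  have at: "\<bar>arctan t\<bar> \<le> 2" "0 \<le> t \<Longrightarrow> 0 \<le> arctan t" "t \<le> 0 \<Longrightarrow> arctan t \<le> 0" for t :: real
    using arctan_bounded[of t] pi_less_4 by (auto simp: abs_le_iff)
  have b1: "\<bar>?B1 e x\<bar> \<le> 1" for e x :: real
    using nz(2)[of "x / e"] by (simp add: abs_of_pos divide_le_eq)
  have b2: "\<bar>?B2 e x\<bar> \<le> 1 / e" if "e > 0" for e x :: real
  proof -
    define t where "t = x / e"
    have "2 * \<bar>t\<bar> \<le> 1 + t\<^sup>2" using sum_squares_bound[of 1 "\<bar>t\<bar>"] by simp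
    also have "\<dots> \<le> (1 + t\<^sup>2)\<^sup>2" by (rule self_le_power) auto
    finally have "\<bar>- 2 * t / (1 + t\<^sup>2)\<^sup>2\<bar> \<le> 1" using nz[of t] by (simp add: abs_mult divide_le_eq)
    moreover have "\<bar>u / e\<bar> \<le> 1 / e" if "\<bar>u\<bar> \<le> 1" for u
      using divide_right_mono[OF that, of e] \<open>e > 0\<close> by (simp add: abs_divide)
    ultimately show ?thesis unfolding t_def[symmetric] by blast
  qed
  have "\<rho> x \<in> {- 2 * d..m + 2} \<and> \<bar>\<rho>1 x\<bar> \<le> 1 \<and> \<bar>\<rho>2 x\<bar> \<le> 1 + 1 / d" for x
  proof (cases "x \<le> 0")
    case True
    have "\<bar>arctan (x / d)\<bar> \<le> 2" by (rule at(1))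
    then have "d * (- 2) \<le> d * arctan (x / d)" using d by (intro mult_left_mono) auto
    moreover have "d * arctan (x / d) \<le> 0" using d True by (intro mult_nonneg_nonpos at(3)) (auto simp: divide_nonpos_pos)
    ultimately show ?thesis using True b1[of x d] b2[OF d, of x] m d unfolding \<rho>_\<rho>1_\<rho>2_def by auto
  next
    case False
    show ?thesis
    proof (cases "x \<le> m")
      case True
      then show ?thesis using False m d unfolding \<rho>_\<rho>1_\<rho>2_def h_h1_h2_def by auto
    next
      case gt: False
      have "\<rho> x = m + arctan (x - m)" "\<rho>1 x = ?B1 1 (x - m)" "\<rho>2 x = ?B2 1 (x - m)"
        using False gt unfolding \<rho>_\<rho>1_\<rho>2_def h_h1_h2_def by auto
      moreover have "\<bar>?B2 1 (x - m)\<bar> \<le> 1 + 1 / d" by (rule order_trans[OF b2[OF zero_less_one]]) (use d in simp)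
      moreover have "- 2 * d \<le> m + arctan (x - m)" "m + arctan (x - m) \<le> m + 2"
        using at(1)[of "x - m"] at(2)[of "x - m"] gt m d by (linarith, simp only: abs_le_iff, linarith)
      ultimately show ?thesis using b1[of "x - m" 1] by simp
    qed
  qed
  moreover have "\<rho> x = x \<and> \<rho>1 x = 1 \<and> \<rho>2 x = 0" if "x \<in> {0..m}" for x
    using that by (cases "x = 0") (auto simp: \<rho>_\<rho>1_\<rho>2_def h_h1_h2_def)
  ultimately show ?thesis using D D1 c by blast
qed

text \<open>The cutoff acts on the argument, so every value of \<open>f\<close> is a value of
  \<open>w\<close> on \<open>[- d, m + 2]\<close> and sign information on \<open>w\<close> passes to
  \<open>f\<close> on the whole line.\<close>

lemma test_function_cutoff:
  fixes w w1 w2 :: "real \<Rightarrow> real"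
  assumes w: "\<And>x. (w has_real_derivative w1 x) (at x)" "\<And>x. (w1 has_real_derivative w2 x) (at x)" "continuous_on UNIV w2"
    and d: "d > 0" and m: "m \<ge> 0"
  shows "\<exists>f f1 f2 K. test_function f f1 f2 K \<and> (\<forall>x. f x \<in> w ` {- d..m + 2}) \<and>
    (\<forall>z\<in>{0..m}. f z = w z \<and> f1 z = w1 z \<and> f2 z = w2 z)"
proof -
  \<comment> \<open>\<open>smooth_clamp\<close> may go below 0 by twice its parameter.\<close>
  have "0 < d / 2" using d by simp
  from smooth_clamp[OF this m] obtain \<rho> \<rho>1 \<rho>2 where H: "\<forall>x. (\<rho> has_real_derivative \<rho>1 x) (at x)"
    "\<forall>x. (\<rho>1 has_real_derivative \<rho>2 x) (at x)" "continuous_on UNIV \<rho>2"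
    "\<forall>x. \<rho> x \<in> {- 2 * (d / 2)..m + 2} \<and> \<bar>\<rho>1 x\<bar> \<le> 1 \<and> \<bar>\<rho>2 x\<bar> \<le> 1 + 1 / (d / 2)"
    "\<forall>x\<in>{0..m}. \<rho> x = x \<and> \<rho>1 x = 1 \<and> \<rho>2 x = 0" by blast
  have \<rho>: "\<And>x. (\<rho> has_real_derivative \<rho>1 x) (at x)"
    "\<And>x. (\<rho>1 has_real_derivative \<rho>2 x) (at x)" "continuous_on UNIV \<rho>2"
    "\<And>x. \<rho> x \<in> {- d..m + 2}" "\<And>x. \<bar>\<rho>1 x\<bar> \<le> 1" "\<And>x. \<bar>\<rho>2 x\<bar> \<le> 1 + 1 / (d / 2)"
    "\<And>x. x \<in> {0..m} \<Longrightarrow> \<rho> x = x \<and> \<rho>1 x = 1 \<and> \<rho>2 x = 0" using H by auto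
  have wc: "continuous_on UNIV w" "continuous_on UNIV w1" and \<rho>c: "continuous_on UNIV \<rho>" "continuous_on UNIV \<rho>1"
    using w \<rho> by (auto intro!: DERIV_continuous_on intro: has_field_derivative_at_within)
  have bd: "\<exists>L\<ge>0. \<forall>x\<in>{- d..m + 2}. \<bar>g x\<bar> \<le> L" if "continuous_on UNIV g" for g :: "real \<Rightarrow> real"
  proof -
    have "compact (g ` {- d..m + 2})"
      by (rule compact_continuous_image[OF continuous_on_subset[OF that]]) auto
    then obtain L where "\<forall>x\<in>g ` {- d..m + 2}. norm x \<le> L" "L > 0"
      using compact_imp_bounded bounded_pos by blast
    then show ?thesis by (intro exI[of _ L]) auto
  qed
  obtain L0 L1 L2 where L: "L0 \<ge> 0" "L1 \<ge> 0" "L2 \<ge> 0" "\<And>x. x \<in> {- d..m + 2} \<Longrightarrow> \<bar>w x\<bar> \<le> L0"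
    "\<And>x. x \<in> {- d..m + 2} \<Longrightarrow> \<bar>w1 x\<bar> \<le> L1" "\<And>x. x \<in> {- d..m + 2} \<Longrightarrow> \<bar>w2 x\<bar> \<le> L2"
    using bd[OF wc(1)] bd[OF wc(2)] bd[OF w(3)] by blast
  define R where "R = 1 + 1 / (d / 2)"
  have R: "R \<ge> 0" unfolding R_def using d by simp
  define f where "f x = w (\<rho> x)" for x
  define f1 where "f1 x = w1 (\<rho> x) * \<rho>1 x" for x
  define f2 where "f2 x = (w2 (\<rho> x) * \<rho>1 x) * \<rho>1 x + \<rho>2 x * w1 (\<rho> x)" for x
  have "test_function f f1 f2 (L0 + L1 + L2 + R * L1)"
  proof
    fix x
    show "(f has_real_derivative f1 x) (at x)"
      unfolding f_def[abs_def] f1_def by (rule DERIV_chain2[OF w(1) \<rho>(1)])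
    show "(f1 has_real_derivative f2 x) (at x)"
      unfolding f1_def[abs_def] f2_def by (rule DERIV_mult[OF DERIV_chain2[OF w(2) \<rho>(1)] \<rho>(2)])
    have RL: "0 \<le> R * L1" using R L by simp
    have b0: "\<bar>w (\<rho> x)\<bar> \<le> L0" and b1: "\<bar>w1 (\<rho> x)\<bar> \<le> L1" and b2: "\<bar>w2 (\<rho> x)\<bar> \<le> L2" using L \<rho>(4) by auto
    show "\<bar>f x\<bar> \<le> L0 + L1 + L2 + R * L1" using b0 L RL unfolding f_def by linarith
    have "\<bar>f1 x\<bar> \<le> L1 * 1" unfolding f1_def abs_mult using b1 \<rho>(5) L by (intro mult_mono) auto
    then show "\<bar>f1 x\<bar> \<le> L0 + L1 + L2 + R * L1" using L RL by linarith
    have "\<bar>w2 (\<rho> x) * \<rho>1 x * \<rho>1 x\<bar> \<le> (L2 * 1) * 1" unfolding abs_mult using b2 \<rho>(5) L by (intro mult_mono) auto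
    moreover have "\<bar>\<rho>2 x * w1 (\<rho> x)\<bar> \<le> R * L1" unfolding abs_mult R_def using b1 \<rho>(6) L d by (intro mult_mono) auto
    ultimately show "\<bar>f2 x\<bar> \<le> L0 + L1 + L2 + R * L1" unfolding f2_def using L by linarith
  next
    show "continuous_on UNIV f2" unfolding f2_def[abs_def]
      by (intro continuous_intros \<rho>c \<rho>(3) continuous_on_compose2[OF w(3) \<rho>c(1)] continuous_on_compose2[OF wc(2) \<rho>c(1)]) auto
  qed
  moreover have "f z = w z \<and> f1 z = w1 z \<and> f2 z = w2 z" if "z \<in> {0..m}" for z
    using \<rho>(7)[OF that] by (simp add: f_def f1_def f2_def)
  ultimately show ?thesis using \<rho>(4) unfolding f_def by blast
qed

section \<open>The free boundary\<close>

lemma convex_above_tangent: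
  fixes g g' g'' :: "real \<Rightarrow> real"
  assumes "\<And>x. (g has_real_derivative g' x) (at x)" "\<And>x. (g' has_real_derivative g'' x) (at x)"
    and "\<And>x. 0 \<le> x \<Longrightarrow> 0 \<le> g'' x" and "0 < p" "0 \<le> x"
  shows "g p + g' p * (x - p) \<le> g x"
proof -
  have "convex_on {0..} g"
    by (rule f''_ge0_imp_convex[where f'=g' and f''=g'']) (use assms in auto)
  then have "g' p * (x - p) \<le> g x - g p"
    using assms by (intro convex_on_imp_above_tangent[of "{0..}" g p x])
       (auto intro: has_field_derivative_at_within connected_Ici)
  then show ?thesis by simp
qed

locale free_boundary =
  fixes \<mu> \<theta> \<sigma> r c :: real and F F1 F2 :: "real \<Rightarrow> real" and \<kappa> :: real
  assumes par: "\<mu> > 0" "\<theta> > 0" "\<sigma> > 0" "r > 0" "c > 0"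
    and F_deriv: "\<And>x. (F has_real_derivative F1 x) (at x)" and F1_deriv: "\<And>x. (F1 has_real_derivative F2 x) (at x)"
    and F2_cont: "continuous_on UNIV F2"
    and ode: "\<And>x. F1 x * (\<mu> * (\<theta> - x)) + F2 x * (\<sigma>\<^sup>2 * x) / 2 - r * F x = 0"
    and \<kappa>: "\<kappa> > 0"
    and F_pos: "\<And>x. 0 \<le> x \<Longrightarrow> 1 \<le> F x" and F1_pos: "\<And>x. 0 \<le> x \<Longrightarrow> 0 < F1 x" and F2_pos: "\<And>x. 0 \<le> x \<Longrightarrow> \<kappa> \<le> F2 x"
begin

text \<open>The function \<open>g\<close> is positive at \<open>c\<close>, and beyond
  \<open>c + 1\<close> it decreases at least at rate \<kappa>, so it has a zero \<open>b\<close>. At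
  such a zero the equation reads \<open>F1 b * ((\<mu> + r) * b - (\<mu> * \<theta> + r * c)) = F2 b
  * \<sigma>^2 * b / 2\<close>, and convexity of \<open>F\<close> places \<open>b\<close> above the
  second threshold.\<close>

lemma exists_boundary: "\<exists>b. max c ((\<mu> * \<theta> + r * c) / (\<mu> + r)) < b \<and> F b = (b - c) * F1 b"
proof -
  define g where "g x = F x - (x - c) * F1 x" for x
  have gD: "(g has_real_derivative - ((x - c) * F2 x)) (at x)" for x
    unfolding g_def[abs_def] by (auto intro!: derivative_eq_intros F_deriv F1_deriv)
  have gc: "g c > 0" unfolding g_def using F_pos[of c] par by simp
  have "\<exists>x>c. g x \<le> 0"
  proof (cases "g (c + 1) \<le> 0")
    case False
    \<comment> \<open>Far enough for a decrease at rate \<kappa> to use up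
      \<open>g (c + 1)\<close>.\<close>
    define x where "x = c + 1 + g (c + 1) / \<kappa>"
    have x: "c + 1 < x" unfolding x_def using False \<kappa> by simp
    obtain \<xi> where xi: "c + 1 < \<xi>" "\<xi> < x" "g x - g (c + 1) = (x - (c + 1)) * - ((\<xi> - c) * F2 \<xi>)"
      using MVT2[OF x, of g "\<lambda>x. - ((x - c) * F2 x)"] gD by blast
    have "1 * \<kappa> \<le> (\<xi> - c) * F2 \<xi>" using xi F2_pos[of \<xi>] par \<kappa> by (intro mult_mono) auto
    then have "(x - (c + 1)) * - ((\<xi> - c) * F2 \<xi>) \<le> (x - (c + 1)) * - \<kappa>" using x by (intro mult_left_mono) auto
    also have "\<dots> = - g (c + 1)" unfolding x_def using \<kappa> by simp
    finally have "g x \<le> 0" using xi(3) by simp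
    then show ?thesis using x by (intro exI[of _ x]) auto
  qed (auto intro: exI[of _ "c + 1"])
  then obtain x where x: "x > c" "g x \<le> 0" by blast
  have "continuous_on {c..x} g"
    using gD by (intro DERIV_continuous_on) (auto intro: has_field_derivative_at_within)
  then obtain b where b: "c \<le> b" "b \<le> x" "g b = 0"
    using IVT2'[of g x 0 c] gc x by auto
  then have bc: "c < b" using gc by (cases "b = c") auto
  have eq: "F b = (b - c) * F1 b" using b(3) unfolding g_def by simp
  have b0: "0 < b" using bc par by simp
  have "0 < F2 b * (\<sigma>\<^sup>2 * b) / 2" using F2_pos[of b] \<kappa> b0 par by simp
  also have "\<dots> = r * F b - F1 b * (\<mu> * (\<theta> - b))" using ode[of b] by simp
  also have "\<dots> = F1 b * ((\<mu> + r) * b - (\<mu> * \<theta> + r * c))" unfolding eq by (simp add: algebra_simps)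
  finally have "0 < (\<mu> + r) * b - (\<mu> * \<theta> + r * c)" using F1_pos[of b] b0 by (simp add: zero_less_mult_iff)
  then have "(\<mu> * \<theta> + r * c) / (\<mu> + r) < b" using par by (simp add: pos_divide_less_eq mult.commute)
  then show ?thesis using bc eq by auto
qed

section \<open>Smooth fit and the smoothed supersolutions\<close>

context
  fixes b :: real
  assumes b: "max c ((\<mu> * \<theta> + r * c) / (\<mu> + r)) < b" and eq: "F b = (b - c) * F1 b"
begin

definition "K0 = (b - c) / F b"

lemma b_gt: "c < b" "0 < b" and K0_pos: "0 < K0" and K0_F: "K0 * F b = b - c" "K0 * F1 b = 1"
proof -
  show 1: "c < b" "0 < b" using b par by auto
  have "F b > 0" "F1 b > 0" using F_pos[of b] F1_pos[of b] 1 by auto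
  then show "0 < K0" "K0 * F b = b - c" "K0 * F1 b = 1"
    unfolding K0_def using 1 eq by (auto simp: divide_simps)
qed

lemma F_majorant: "0 \<le> x \<Longrightarrow> x - c \<le> K0 * F x"
proof -
  assume x: "0 \<le> x"
  have "0 \<le> K0 * F2 z" if "0 \<le> z" for z using F2_pos[OF that] \<kappa> K0_pos by simp
  then have "K0 * F b + K0 * F1 b * (x - b) \<le> K0 * F x"
    by (intro convex_above_tangent[where g'="\<lambda>x. K0 * F1 x" and g''="\<lambda>x. K0 * F2 x"] DERIV_cmult F_deriv F1_deriv b_gt x)
  then show ?thesis using K0_F by simp
qed

definition "A0 = K0 * F2 b"

lemma A0_pos: "0 < A0" unfolding A0_def using K0_pos F2_pos[of b] \<kappa> b_gt by auto

text \<open>The equation for \<open>F\<close> at \<open>b\<close> under smooth fit,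
  \<open>K0 * F b = b - c\<close> and \<open>K0 * F1 b = 1\<close>. The first-order part of the
  generator on \<open>x - c\<close> at \<open>b\<close> is thus minus the diffusion term of the left
  branch, which leaves exactly the room for the second derivative to be continuous.\<close>

lemma A0_eq: "A0 * (\<sigma>\<^sup>2 * b) / 2 = (\<mu> + r) * b - (\<mu> * \<theta> + r * c)"
proof -
  have "K0 * (F1 b * (\<mu> * (\<theta> - b)) + F2 b * (\<sigma>\<^sup>2 * b) / 2 - r * F b) = 0" using ode[of b] by simp
  then have "(K0 * F1 b) * (\<mu> * (\<theta> - b)) + A0 * (\<sigma>\<^sup>2 * b) / 2 - r * (K0 * F b) = 0"
    unfolding A0_def by (simp add: algebra_simps)
  then show ?thesis unfolding K0_F by (simp add: algebra_simps)
qed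

text \<open>The value function is only once continuously differentiable at \<open>b\<close>. Letting the second derivative
  decay exponentially from its left limit keeps the supersolution property, because the
  generator applied to \<open>x - c\<close> is strictly negative on \<open>[b, \<infinity>)\<close>.\<close>
definition "W e x = (if x \<le> b then K0 * F x else x - c + A0 * e\<^sup>2 * (exp (- (x - b) / e) - 1 + (x - b) / e))"
definition "W1 e x = (if x \<le> b then K0 * F1 x else 1 + A0 * e * (1 - exp (- (x - b) / e)))"
definition "W2 e x = (if x \<le> b then K0 * F2 x else A0 * exp (- (x - b) / e))"

lemma exp_remainder_nonneg: "0 \<le> exp (- s / e) - 1 + s / e" for s e :: real
  using exp_ge_add_one_self[of "- s / e", unfolded minus_divide_left[symmetric]] by (simp only: minus_divide_left[symmetric])

lemma W_deriv:
  assumes "e > 0"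
  shows "(W e has_real_derivative W1 e x) (at x)" "(W1 e has_real_derivative W2 e x) (at x)"
    "continuous_on UNIV (W2 e)"
proof -
  show "(W e has_real_derivative W1 e x) (at x)"
    unfolding W_def[abs_def] W1_def
  proof (rule DERIV_glue)
    show "((\<lambda>x. x - c + A0 * e\<^sup>2 * (exp (- (x - b) / e) - 1 + (x - b) / e)) has_real_derivative
       1 + A0 * e * (1 - exp (- (x - b) / e))) (at x)" for x
      using assms by (auto intro!: derivative_eq_intros simp: field_simps power2_eq_square)
  qed (use K0_F in \<open>auto intro!: DERIV_cmult F_deriv\<close>)
  show "(W1 e has_real_derivative W2 e x) (at x)"
    unfolding W1_def[abs_def] W2_def
  proof (rule DERIV_glue)
    show "((\<lambda>x. 1 + A0 * e * (1 - exp (- (x - b) / e))) has_real_derivative A0 * exp (- (x - b) / e)) (at x)" for x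
      using assms by (auto intro!: derivative_eq_intros simp: field_simps)
  qed (use K0_F in \<open>auto intro!: DERIV_cmult F1_deriv simp: A0_def\<close>)
  show "continuous_on UNIV (W2 e)"
    unfolding W2_def[abs_def]
    by (rule continuous_glue) (use assms F2_cont in \<open>auto intro!: continuous_intros simp: A0_def\<close>)
qed

lemma W_ge:
  assumes "e > 0" "0 \<le> x"
  shows "x - c \<le> W e x" "0 < W e x"
proof -
  have "0 \<le> A0 * e\<^sup>2 * (exp (- (x - b) / e) - 1 + (x - b) / e)"
    using A0_pos by (intro mult_nonneg_nonneg exp_remainder_nonneg) auto
  then show "x - c \<le> W e x" using F_majorant[OF assms(2)] by (auto simp: W_def)
  show "0 < W e x"
  proof (cases "x \<le> b")
    case True
    then show ?thesis using K0_pos F_pos[OF assms(2)] by (simp add: W_def)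
  next
    case False
    then show ?thesis using \<open>x - c \<le> W e x\<close> b_gt by simp
  qed
qed

text \<open>Beyond \<open>b\<close> the smoothing adds a diffusion term with the growing factor
  \<open>b + s\<close> and a positive drift term \<open>A0 * e * (1 - q) * \<mu> * \<theta>\<close>.
  Exponential decay outweighs the growth when \<open>2 * e \<le> b\<close>, and the slack it leaves
  pays for the drift term when \<open>4 * \<mu> * \<theta> * e \<le> \<sigma>^2 * b\<close>. By
  \<open>A0_eq\<close> what is left is at most \<open>- (\<mu> + r) * s\<close>.\<close>

lemma W_super:
  assumes e: "e > 0" "2 * e \<le> b" "4 * \<mu> * \<theta> * e \<le> \<sigma>\<^sup>2 * b" and x: "0 \<le> x"
  shows "W1 e x * (\<mu> * (\<theta> - x)) + W2 e x * (\<sigma>\<^sup>2 * x) / 2 - r * W e x \<le> 0"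
proof (cases "x \<le> b")
  case True
  have "K0 * (F1 x * (\<mu> * (\<theta> - x)) + F2 x * (\<sigma>\<^sup>2 * x) / 2 - r * F x) = 0" using ode[of x] by simp
  then show ?thesis using True unfolding W_def W1_def W2_def by (simp add: algebra_simps)
next
  case False
  define s where "s = x - b"
  have s: "0 < s" "x = b + s" unfolding s_def using False by auto
  define q where "q = exp (- s / e)"
  have q: "0 < q" "q < 1" unfolding q_def using s e by auto
  \<comment> \<open>The square root of \<open>q\<close>: one factor \<open>h\<close> absorbs the
    growth of \<open>b + s\<close>, the other provides the slack \<open>b * (1 - h)\<close>.\<close>
  define h where "h = exp (- s / (2 * e))"
  have hq: "q = h * h" unfolding h_def q_def using e by (simp add: exp_add[symmetric])
  have h: "0 < h" "h < 1" unfolding h_def using s e by auto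
  have "(b + s) * q \<le> b * h"
  proof -
    have "1 + s / b \<le> exp (s / b)" by (rule exp_ge_add_one_self)
    also have "\<dots> \<le> exp (s / (2 * e))" using s e b_gt by (simp add: frac_le)
    finally have "(1 + s / b) * h \<le> exp (s / (2 * e)) * h" using h by (intro mult_right_mono) auto
    also have "\<dots> = 1" unfolding h_def by (simp add: exp_add[symmetric])
    finally have "b * ((1 + s / b) * h) * h \<le> b * 1 * h" using b_gt h by (intro mult_right_mono mult_left_mono) auto
    moreover have "b * ((1 + s / b) * h) * h = (b + s) * q" using b_gt by (simp add: hq field_simps)
    ultimately show ?thesis by simp
  qed
  moreover have "b / 2 * (1 - q) \<le> b * (1 - h)"
  proof -
    have "1 - q = (1 - h) * (1 + h)" unfolding hq by (simp add: algebra_simps)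
    also have "\<dots> \<le> (1 - h) * 2" using h by (intro mult_left_mono) auto
    finally have "b / 2 * (1 - q) \<le> b / 2 * ((1 - h) * 2)" using b_gt by (intro mult_left_mono) auto
    then show ?thesis by (simp add: algebra_simps)
  qed
  ultimately have key: "(b + s) * q \<le> b - b / 2 * (1 - q)" by (simp add: algebra_simps)
  have "A0 * q * (\<sigma>\<^sup>2 * (b + s)) / 2 = A0 * \<sigma>\<^sup>2 / 2 * ((b + s) * q)" by simp
  also have "\<dots> \<le> A0 * \<sigma>\<^sup>2 / 2 * (b - b / 2 * (1 - q))" using key A0_pos by (intro mult_left_mono) auto
  also have "\<dots> = A0 * (\<sigma>\<^sup>2 * b) / 2 - A0 * (1 - q) * (\<sigma>\<^sup>2 * b) / 4" by (simp add: field_simps)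
  also have "\<dots> \<le> A0 * (\<sigma>\<^sup>2 * b) / 2 - A0 * (1 - q) * (4 * \<mu> * \<theta> * e) / 4"
    using e(3) A0_pos q by (intro diff_left_mono divide_right_mono mult_left_mono) auto
  finally have diff: "A0 * q * (\<sigma>\<^sup>2 * (b + s)) / 2 \<le> A0 * (\<sigma>\<^sup>2 * b) / 2 - A0 * e * (1 - q) * (\<mu> * \<theta>)"
    by (simp add: mult_ac)
  have psi: "0 \<le> A0 * e\<^sup>2 * (q - 1 + s / e)"
    unfolding q_def using A0_pos by (intro mult_nonneg_nonneg exp_remainder_nonneg) auto
  have neg: "0 \<le> A0 * e * (1 - q) * (\<mu> * x)" using A0_pos e q par x by auto
  have "W1 e x * (\<mu> * (\<theta> - x)) + W2 e x * (\<sigma>\<^sup>2 * x) / 2 - r * W e x =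
     \<mu> * (\<theta> - x) + A0 * e * (1 - q) * (\<mu> * \<theta>) - A0 * e * (1 - q) * (\<mu> * x) + A0 * q * (\<sigma>\<^sup>2 * (b + s)) / 2 - r * (x - c)
      - r * (A0 * e\<^sup>2 * (q - 1 + s / e))"
    using False unfolding W_def W1_def W2_def q_def s_def by (simp add: algebra_simps)
  also have "\<dots> \<le> \<mu> * (\<theta> - x) + A0 * (\<sigma>\<^sup>2 * b) / 2 - r * (x - c)"
    using diff neg mult_nonneg_nonneg[OF less_imp_le[OF par(4)] psi] by linarith
  also have "\<dots> = - ((\<mu> + r) * s)" unfolding A0_eq s(2) by (simp add: algebra_simps)
  also have "\<dots> \<le> 0" using par s by simp
  finally show ?thesis .
qed

lemma W_tendsto: "b \<le> x \<Longrightarrow> ((\<lambda>e. W e x) \<longlongrightarrow> x - c) (at_right 0)"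
proof (cases "x = b")
  case True
  then show ?thesis using K0_F by (simp add: W_def)
next
  case False
  assume "b \<le> x"
  then have x: "b < x" using False by simp
  have up: "\<forall>\<^sub>F e in at_right 0. W e x \<le> x - c + A0 * (x - b) * e"
    unfolding eventually_at_filter
  proof (intro always_eventually allI impI)
    fix e :: real assume "e \<noteq> 0" "e \<in> {0<..}"
    then have e: "e > 0" by simp
    have "exp (- (x - b) / e) \<le> 1" using e x by (simp add: divide_nonpos_pos)
    then have "A0 * e\<^sup>2 * (exp (- (x - b) / e) - 1 + (x - b) / e) \<le> A0 * e\<^sup>2 * ((x - b) / e)"
      using A0_pos by (intro mult_left_mono) auto
    also have "\<dots> = A0 * (x - b) * e" using e by (simp add: power2_eq_square)
    finally show "W e x \<le> x - c + A0 * (x - b) * e" using x by (simp add: W_def)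
  qed
  have lo: "\<forall>\<^sub>F e in at_right 0. x - c \<le> W e x"
    unfolding eventually_at_filter using W_ge(1)[of _ x] x b_gt by (intro always_eventually) auto
  have "((\<lambda>e. x - c + A0 * (x - b) * e) \<longlongrightarrow> x - c + A0 * (x - b) * 0) (at_right 0)"
    by (intro tendsto_intros)
  then show ?thesis by (intro tendsto_sandwich[OF lo up tendsto_const]) simp
qed

end
end

section \<open>Upper and lower bounds\<close>

lemma ceiling_grid:
  fixes N :: nat
  assumes "0 < N" "0 \<le> x"
  shows "x \<le> real (nat \<lceil>x * real N\<rceil>) / real N" "real (nat \<lceil>x * real N\<rceil>) / real N \<le> x + 1 / real N"
proof -
  have N: "0 < real N" "0 \<le> x * real N" using assms by auto
  have r: "real (nat \<lceil>x * real N\<rceil>) = of_int \<lceil>x * real N\<rceil>"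
    using N(2) ceiling_mono[of 0 "x * real N"] by simp
  show "x \<le> real (nat \<lceil>x * real N\<rceil>) / real N"
    unfolding r using N by (simp add: pos_le_divide_eq)
  have "of_int \<lceil>x * real N\<rceil> \<le> x * real N + 1" by linarith
  then have "of_int \<lceil>x * real N\<rceil> / real N \<le> (x * real N + 1) / real N" using N by (intro divide_right_mono) auto
  also have "\<dots> = x + 1 / real N" using N by (simp add: add_divide_distrib)
  finally show "real (nat \<lceil>x * real N\<rceil>) / real N \<le> x + 1 / real N" unfolding r .
qed

context cir
begin

text \<open>Rational times make this a countable intersection of events, and \<open>dynkin\<close>
  asks for no others.\<close>

definition running_le :: "('a \<Rightarrow> real) \<Rightarrow> real \<Rightarrow> 'a set" where
  "running_le \<tau> m = {\<omega> \<in> space M. \<forall>q::rat. 0 \<le> real_of_rat q \<and> real_of_rat q \<le> \<tau> \<omega> \<longrightarrow> Y (real_of_rat q) \<omega> \<le> m}"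

lemma running_le_events:
  assumes [measurable]: "\<tau> \<in> borel_measurable M"
  shows "running_le \<tau> m \<in> events"
  unfolding running_le_def by measurable

lemma running_leD: "\<omega> \<in> running_le \<tau> m \<Longrightarrow> s \<in> \<rat> \<Longrightarrow> 0 \<le> s \<Longrightarrow> s \<le> \<tau> \<omega> \<Longrightarrow> Y s \<omega> \<le> m"
  unfolding running_le_def by (auto elim!: Rats_cases)

text \<open>Stated for the nonnegative integral because no integrability of the payoff is at hand;
  \<open>ennreal\<close> cuts off the negative part. The supersolution is positive, so Fatou's lemma
  removes the discretisation, the time horizon and the cap on the path together.\<close>

lemma supersolution_bound:
  fixes w w1 w2 :: "real \<Rightarrow> real"
  assumes w: "\<And>x. (w has_real_derivative w1 x) (at x)" "\<And>x. (w1 has_real_derivative w2 x) (at x)" "continuous_on UNIV w2"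
    and super: "\<And>x. 0 \<le> x \<Longrightarrow> w1 x * drift x + w2 x * (\<sigma>\<^sup>2 * x) / 2 - r * w x \<le> 0"
    and ge: "\<And>x. 0 \<le> x \<Longrightarrow> x - c \<le> w x" and pos: "\<And>x. 0 \<le> x \<Longrightarrow> 0 < w x"
    and r: "r > 0" and \<tau>: "\<tau> \<in> stopping_times M B"
  shows "(\<integral>\<^sup>+\<omega>. ennreal (stop_payoff Y r c \<tau> \<omega>) \<partial>M) \<le> ennreal (w y)"
proof -
  have wc: "continuous_on UNIV w" using w(1) by (auto intro!: DERIV_continuous_on intro: has_field_derivative_at_within)
  \<comment> \<open>Positivity of \<open>w\<close> extends slightly below 0, so the cutoff can be
    nonnegative everywhere and \<open>dynkin\<close> applies with \<open>c0 = 0\<close>.\<close>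
  have "\<forall>\<^sub>F x in at 0. 0 < w x"
    using order_tendstoD(1)[of w "w 0" "at 0" 0] pos[of 0] wc
    by (auto simp: continuous_on_def)
  then obtain d0 where d0: "d0 > 0" "\<And>x. x \<noteq> 0 \<Longrightarrow> \<bar>x\<bar> < d0 \<Longrightarrow> 0 < w x"
    unfolding eventually_at by (auto simp: dist_real_def)
  define d where "d = d0 / 2"
  have d: "d > 0" "\<And>x. - d \<le> x \<Longrightarrow> 0 \<le> w x"
  proof -
    show "d > 0" using d0 by (simp add: d_def)
    fix x assume "- d \<le> x"
    then show "0 \<le> w x" using d0(2)[of x] pos[of x] d0(1) unfolding d_def by (cases "0 \<le> x") auto
  qed
  \<comment> \<open>The offset keeps the starting point inside every \<open>[0, k n]\<close>, where
    the cutoff equals \<open>w\<close>.\<close>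
  define n0 where "n0 = nat \<lceil>y\<rceil>"
  have n0: "y \<le> real n0" unfolding n0_def by linarith
  define k where "k n = n + n0" for n
  define N where "N n = Suc (k n)" for n
  \<comment> \<open>Rounding up to the mesh \<open>1 / N n\<close> preserves the stopping property;
    the cap \<open>k n\<close> bounds the time. Horizon, cap on the path and fineness all grow with
    \<open>n\<close>.\<close>
  define S where "S n \<omega> = (if \<tau> \<omega> \<le> ereal (real (k n)) then real (nat \<lceil>real_of_ereal (\<tau> \<omega>) * real (N n)\<rceil>) / real (N n) else real (k n))" for n \<omega>
  define G where "G n = running_le (S n) (real (k n))" for n
  define u where "u n \<omega> = indicat_real (G n) \<omega> * (exp (- r * S n \<omega>) * w (Y (S n \<omega>) \<omega>))" for n \<omega>
  have N0: "0 < real (N n)" "0 < N n" for n by (auto simp: N_def)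
  have \<tau>0: "0 \<le> \<tau> \<omega>" if "\<omega> \<in> space M" for \<omega> using \<tau> that by (simp add: stopping_times_def)
  have fin: "\<exists>T\<ge>0. \<tau> \<omega> = ereal T" if "\<omega> \<in> space M" "\<tau> \<omega> \<le> ereal t" for \<omega> t
    using \<tau>0[OF that(1)] that(2) by (cases "\<tau> \<omega>") auto
  have grid: "\<exists>j\<le>k n * N n. S n \<omega> = real j * (1 / real (N n))" if ws: "\<omega> \<in> space M" for n \<omega>
  proof (cases "\<tau> \<omega> \<le> ereal (real (k n))")
    case True
    obtain T where T: "T \<ge> 0" "\<tau> \<omega> = ereal T" using fin[OF ws True] by blast
    then have "T * real (N n) \<le> real (k n * N n)" using True N0[of n] by simp
    then have "\<lceil>T * real (N n)\<rceil> \<le> int (k n * N n)" by (simp add: ceiling_le_iff)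
    then show ?thesis using True T by (intro exI[of _ "nat \<lceil>T * real (N n)\<rceil>"]) (auto simp: S_def nat_le_iff)
  next
    case False
    then show ?thesis using N0[of n] by (intro exI[of _ "k n * N n"]) (auto simp: S_def)
  qed
  have stop: "{\<omega> \<in> space M. S n \<omega> \<le> t} \<in> sets (\<F> t)" if t: "0 \<le> t" for n t
  proof (cases "real (k n) \<le> t")
    case True
    have "S n \<omega> \<le> t" if w: "\<omega> \<in> space M" for \<omega>
    proof -
      obtain j where j: "j \<le> k n * N n" "S n \<omega> = real j * (1 / real (N n))" using grid[OF w] by blast
      have "real j \<le> real (k n) * real (N n)" using j(1) by (metis of_nat_le_iff of_nat_mult)
      then have "S n \<omega> \<le> real (k n)" unfolding j(2) using N0[of n] by (simp add: pos_divide_le_eq)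
      then show ?thesis using True by simp
    qed
    then have "{\<omega> \<in> space M. S n \<omega> \<le> t} = space (\<F> t)" by auto
    then show ?thesis by (metis sets.top)
  next
    case False
    \<comment> \<open>The last grid point not after \<open>t\<close>: before the cap, the rounded
      time is at most \<open>t\<close> exactly when \<tau> is at most \<open>s\<close>.\<close>
    define s where "s = real_of_int \<lfloor>t * real (N n)\<rfloor> / real (N n)"
    have s: "0 \<le> s" "s \<le> t" unfolding s_def using t N0[of n] by (auto simp: pos_divide_le_eq)
    have "S n \<omega> \<le> t \<longleftrightarrow> \<tau> \<omega> \<le> ereal s" if w: "\<omega> \<in> space M" for \<omega>
    proof (cases "\<tau> \<omega> \<le> ereal (real (k n))")
      case True
      obtain T where T: "T \<ge> 0" "\<tau> \<omega> = ereal T" using fin[OF w True] by blast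
      have "S n \<omega> \<le> t \<longleftrightarrow> real (nat \<lceil>T * real (N n)\<rceil>) \<le> t * real (N n)"
        using True T N0[of n] by (simp add: S_def pos_divide_le_eq)
      also have "real (nat \<lceil>T * real (N n)\<rceil>) = of_int \<lceil>T * real (N n)\<rceil>"
        using T N0[of n] ceiling_mono[of 0 "T * real (N n)"] by simp
      also have "of_int \<lceil>T * real (N n)\<rceil> \<le> t * real (N n) \<longleftrightarrow> T * real (N n) \<le> of_int \<lfloor>t * real (N n)\<rfloor>"
        by (simp add: le_floor_iff[symmetric] ceiling_le_iff)
      also have "\<dots> \<longleftrightarrow> \<tau> \<omega> \<le> ereal s" unfolding T s_def using N0[of n] by (simp add: pos_le_divide_eq)
      finally show ?thesis .
    next
      case F: False
      have "\<not> \<tau> \<omega> \<le> ereal s" using F s False by (meson ereal_less_eq(3) linear order_trans)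
      then show ?thesis using F False by (simp add: S_def)
    qed
    then have "{\<omega> \<in> space M. S n \<omega> \<le> t} = {\<omega> \<in> space M. \<tau> \<omega> \<le> ereal s}" by auto
    moreover have "{\<omega> \<in> space M. \<tau> \<omega> \<le> ereal s} \<in> sets (\<F> s)" using \<tau> s(1) by (simp add: stopping_times_def)
    ultimately show ?thesis using nat_filtration_mono[OF s(2), of M B] by auto
  qed
  have S0: "0 \<le> S n \<omega>" for n \<omega> unfolding S_def by auto
  have Sm: "S n \<in> borel_measurable M" for n by (rule stopping_measurable[OF stop S0])
  have Gm: "G n \<in> events" for n unfolding G_def by (rule running_le_events[OF Sm])
  have SQ: "S n \<omega> \<in> \<rat>" for n \<omega> unfolding S_def by auto
  have bound: "u n \<in> borel_measurable M \<and> (\<integral>\<^sup>+\<omega>. ennreal (u n \<omega>) \<partial>M) \<le> ennreal (w y)" for n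
  proof -
    obtain f f1 f2 K where f: "test_function f f1 f2 K" "\<forall>x. f x \<in> w ` {- d..real (k n) + 2}"
      "\<forall>z\<in>{0..real (k n)}. f z = w z \<and> f1 z = w1 z \<and> f2 z = w2 z"
      using test_function_cutoff[OF w d(1), of "real (k n)"] by auto
    have f0: "- 0 \<le> f x" for x using f(2) d(2) by (metis atLeastAtMost_iff image_iff minus_zero)
    have sup: "f1 z * drift z + f2 z * (vol z)\<^sup>2 / 2 - r * f z \<le> 0" if "z \<in> {0..real (k n)}" for z
      using super[of z] f(3) that by (auto simp: power_mult_distrib)
    have h: "0 < 1 / real (N n)" "1 / real (N n) \<in> \<rat>" using N0[of n] by auto
    have m: "0 \<le> real (k n)" by simp
    have GD: "Y s \<omega> \<le> real (k n)" if "\<omega> \<in> G n" "s \<in> \<rat>" "0 \<le> s" "s \<le> S n \<omega>" for \<omega> s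
      using running_leD that unfolding G_def by blast
    let ?l = "\<lambda>\<omega>. indicat_real (G n) \<omega> * (exp (- r * S n \<omega>) * f (Y (S n \<omega>) \<omega>))"
    have dy: "integrable M ?l"
      by (rule dynkin(1)[OF f(1) sup r m h f0 order_refl stop grid Gm GD])
    have dy2: "expectation ?l \<le> f y + 0 * (1 - prob (G n))"
      by (rule dynkin(2)[OF f(1) sup r m h f0 order_refl stop grid Gm GD])
    have eq: "indicat_real (G n) \<omega> * (exp (- r * S n \<omega>) * f (Y (S n \<omega>) \<omega>)) = u n \<omega>" if "\<omega> \<in> space M" for \<omega>
    proof (cases "\<omega> \<in> G n")
      case True
      have "Y (S n \<omega>) \<omega> \<le> real (k n)"
        by (rule running_leD[OF True[unfolded G_def] SQ S0 order_refl])
      then show ?thesis using f(3) Y_nonneg[OF that S0] by (simp add: u_def)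
    qed (simp add: u_def)
    have ui: "integrable M (u n)"
    proof -
      have "integrable M ?l = integrable M (u n)"
        by (rule Bochner_Integration.integrable_cong[OF refl eq])
      then show ?thesis using dy by simp
    qed
    have "expectation (u n) = expectation ?l"
      using eq by (intro Bochner_Integration.integral_cong) auto
    also have "\<dots> \<le> w y" using dy2 f(3) params n0 by (simp add: k_def)
    finally have "expectation (u n) \<le> w y" .
    moreover have "(\<integral>\<^sup>+\<omega>. ennreal (u n \<omega>) \<partial>M) = ennreal (expectation (u n))"
    proof (rule nn_integral_eq_integral[OF ui], rule AE_I2)
      fix \<omega> assume "\<omega> \<in> space M"
      then have "0 \<le> w (Y (S n \<omega>) \<omega>)" by (intro less_imp_le pos Y_nonneg S0)
      then show "0 \<le> u n \<omega>" unfolding u_def by simp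
    qed
    ultimately show ?thesis using ui by (auto intro: ennreal_leI)
  qed
  have lim: "ennreal (stop_payoff Y r c \<tau> \<omega>) \<le> liminf (\<lambda>n. ennreal (u n \<omega>))" if ws: "\<omega> \<in> space M" for \<omega>
  proof (cases "\<tau> \<omega> = \<infinity>")
    case True
    then show ?thesis by (simp add: stop_payoff_def)
  next
    case False
    then obtain T where T: "T \<ge> 0" "\<tau> \<omega> = ereal T" using \<tau>0[OF ws] by (cases "\<tau> \<omega>") auto
    have kinf: "\<forall>\<^sub>F n in sequentially. x \<le> real (k n)" for x
    proof -
      obtain n1 :: nat where "x \<le> real n1" using real_arch_simple by blast
      then show ?thesis unfolding eventually_sequentially k_def by (intro exI[of _ n1]) auto
    qed
    have near: "\<forall>\<^sub>F n in sequentially. T \<le> S n \<omega> \<and> S n \<omega> \<le> T + 1 / real (Suc n)"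
      using kinf[of T]
    proof eventually_elim
      case (elim n)
      then have e: "S n \<omega> = real (nat \<lceil>T * real (N n)\<rceil>) / real (N n)" using T by (simp add: S_def)
      have "1 / real (N n) \<le> 1 / real (Suc n)" by (intro divide_left_mono) (auto simp: N_def k_def)
      then show ?case unfolding e using ceiling_grid[OF N0(2) T(1), of n] by linarith
    qed
    have "(\<lambda>n. T + 1 / real (Suc n)) \<longlonglongrightarrow> T + 0"
      by (intro tendsto_add tendsto_const LIMSEQ_Suc[OF lim_1_over_n])
    then have ub: "(\<lambda>n. T + 1 / real (Suc n)) \<longlonglongrightarrow> T" by simp
    have tl: "(\<lambda>n. S n \<omega>) \<longlonglongrightarrow> T"
    proof (rule tendsto_sandwich[OF _ _ tendsto_const ub])
      show "\<forall>\<^sub>F n in sequentially. T \<le> S n \<omega>" using near by eventually_elim simp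
      show "\<forall>\<^sub>F n in sequentially. S n \<omega> \<le> T + 1 / real (Suc n)" using near by eventually_elim simp
    qed
    have Yl: "(\<lambda>n. Y (S n \<omega>) \<omega>) \<longlonglongrightarrow> Y T \<omega>"
      by (rule continuous_on_tendsto_compose[OF Y_cont[OF ws] tl]) (use T S0 in auto)
    have "isCont w (Y T \<omega>)" using wc by (simp add: continuous_on_eq_continuous_at)
    then have wl: "(\<lambda>n. exp (- r * S n \<omega>) * w (Y (S n \<omega>) \<omega>)) \<longlonglongrightarrow> exp (- r * T) * w (Y T \<omega>)"
      by (intro tendsto_mult tendsto_exp tendsto_const tl isCont_tendsto_compose[OF _ Yl])
    \<comment> \<open>A single path is bounded on \<open>[0, T + 1]\<close>, hence lies in
      \<open>G n\<close> once \<open>k n\<close> exceeds the bound.\<close>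
    have "compact ((\<lambda>t. Y t \<omega>) ` {0..T + 1})"
      by (rule compact_continuous_image[OF continuous_on_subset[OF Y_cont[OF ws]]]) auto
    then obtain L where L: "\<And>t. t \<in> {0..T + 1} \<Longrightarrow> Y t \<omega> \<le> L"
      using compact_imp_bounded bounded_imp_bdd_above unfolding bdd_above_def by (metis imageI)
    have inG: "\<forall>\<^sub>F n in sequentially. \<omega> \<in> G n"
      using near kinf[of L]
    proof eventually_elim
      case (elim n)
      have "1 / real (Suc n) \<le> 1" by simp
      then have "Y q \<omega> \<le> real (k n)" if "0 \<le> q" "q \<le> S n \<omega>" for q
      proof -
        have "q \<le> T + 1" using that(2) elim(1) \<open>1 / real (Suc n) \<le> 1\<close> by linarith
        then have "Y q \<omega> \<le> L" using that(1) by (intro L) simp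
        then show ?thesis using elim(2) by simp
      qed
      then show ?case using ws by (auto simp: G_def running_le_def)
    qed
    then have "\<forall>\<^sub>F n in sequentially. exp (- r * S n \<omega>) * w (Y (S n \<omega>) \<omega>) = u n \<omega>"
      by eventually_elim (simp add: u_def)
    with wl have "(\<lambda>n. u n \<omega>) \<longlonglongrightarrow> exp (- r * T) * w (Y T \<omega>)" by (rule Lim_transform_eventually)
    then have "liminf (\<lambda>n. ennreal (u n \<omega>)) = ennreal (exp (- r * T) * w (Y T \<omega>))"
      by (intro lim_imp_Liminf tendsto_ennrealI) auto
    moreover have "stop_payoff Y r c \<tau> \<omega> \<le> exp (- r * T) * w (Y T \<omega>)"
      unfolding stop_payoff_def using T ge[OF Y_nonneg[OF ws T(1)]] by (auto intro!: mult_left_mono)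
    ultimately show ?thesis by (simp add: ennreal_leI)
  qed
  have "(\<integral>\<^sup>+\<omega>. ennreal (stop_payoff Y r c \<tau> \<omega>) \<partial>M) \<le> (\<integral>\<^sup>+\<omega>. liminf (\<lambda>n. ennreal (u n \<omega>)) \<partial>M)"
    by (rule nn_integral_mono[OF lim])
  also have "\<dots> \<le> liminf (\<lambda>n. \<integral>\<^sup>+\<omega>. ennreal (u n \<omega>) \<partial>M)"
  proof (rule nn_integral_liminf)
    fix n
    have [measurable]: "u n \<in> borel_measurable M" using bound by blast
    show "(\<lambda>\<omega>. ennreal (u n \<omega>)) \<in> borel_measurable M" by measurable
  qed
  also have "\<dots> \<le> liminf (\<lambda>n. ennreal (w y))"
    using bound by (intro Liminf_mono always_eventually) auto
  also have "\<dots> = ennreal (w y)" by (simp add: Liminf_const)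
  finally show ?thesis .
qed

text \<open>\<open>dynkin\<close> for the cutoff of \<open>- F\<close> gives
  \<open>F y \<le> F b * E exp (- r * \<tau> n)\<close> up to the complement of \<open>G n\<close>,
  and stopping at level \<open>a\<close> earns at least \<open>a - c\<close>. The gap between
  \<open>a\<close> and \<open>b\<close> lets the grid notice the path before it exceeds
  \<open>b\<close>, so \<open>F\<close> of the path stays below \<open>F b\<close> until the
  stop.\<close>

lemma hitting_bound:
  fixes F F1 F2 :: "real \<Rightarrow> real"
  assumes F: "\<And>x. (F has_real_derivative F1 x) (at x)" "\<And>x. (F1 has_real_derivative F2 x) (at x)" "continuous_on UNIV F2"
    and ode: "\<And>x. 0 \<le> x \<Longrightarrow> F1 x * drift x + F2 x * (\<sigma>\<^sup>2 * x) / 2 - r * F x = 0"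
    and mono: "\<And>x. 0 \<le> x \<Longrightarrow> x \<le> b \<Longrightarrow> F x \<le> F b" and Fb: "0 < F b"
    and r: "r > 0" and yb: "y < b" and a: "c < a" "a < b"
    and fin: "\<And>\<tau>. \<tau> \<in> stopping_times M B \<Longrightarrow> (\<integral>\<^sup>+\<omega>. ennreal (stop_payoff Y r c \<tau> \<omega>) \<partial>M) < \<infinity>"
    and L: "\<And>\<tau>. \<tau> \<in> stopping_times M B \<Longrightarrow> expectation (stop_payoff Y r c \<tau>) \<le> L"
  shows "(a - c) * F y / F b \<le> L"
proof -
  have b0: "0 \<le> b" using yb params by simp
  have dF: "((\<lambda>x. - F x) has_real_derivative - F1 x) (at x)" "((\<lambda>x. - F1 x) has_real_derivative - F2 x) (at x)" for x
    using F by (auto intro: DERIV_minus)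
  have cF: "continuous_on UNIV (\<lambda>x. - F2 x)" using F(3) by (intro continuous_intros)
  obtain f f1 f2 K where f: "test_function f f1 f2 K"
    "\<forall>z\<in>{0..b}. f z = - F z \<and> f1 z = - F1 z \<and> f2 z = - F2 z"
    using test_function_cutoff[OF dF cF zero_less_one b0] by blast
  interpret T: test_function f f1 f2 K by (rule f(1))
  have low: "- K \<le> f x" for x using T.f_bound[of x] by (simp add: abs_le_iff)
  have sup: "f1 z * drift z + f2 z * (vol z)\<^sup>2 / 2 - r * f z \<le> 0" if "z \<in> {0..b}" for z
    using ode[of z] f(2) that by (auto simp: power_mult_distrib)
  define N J where "N n = Suc n" "J n = n * N n" for n
  have N0: "0 < real (N n)" for n by (simp add: N_J_def)
  have JN: "real (J n) / real (N n) = real n" for n using N0[of n] by (simp add: N_J_def(2))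
  define P where "P n k \<omega> \<longleftrightarrow> a \<le> Z (real k / real (N n)) \<omega>" for n k \<omega>
  \<comment> \<open>The alternative \<open>k = J n\<close> caps the search at time
    \<open>n\<close>.\<close>
  define H where "H n \<omega> = (LEAST k. P n k \<omega> \<or> k = J n)" for n \<omega>
  define \<tau> where "\<tau> n \<omega> = real (H n \<omega>) * (1 / real (N n))" for n \<omega>
  \<comment> \<open>Without a hit the player never stops: stopping at the horizon could pay a
    negative amount, while \<infinity> pays 0.\<close>
  define R where "R n \<omega> = (if P n (H n \<omega>) \<omega> then ereal (\<tau> n \<omega>) else \<infinity>)" for n \<omega>
  have HP: "P n (H n \<omega>) \<omega> \<or> H n \<omega> = J n" for n \<omega>
    unfolding H_def by (rule LeastI[of _ "J n"]) simp
  have Hle: "H n \<omega> \<le> k" if "P n k \<omega> \<or> k = J n" for n k \<omega>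
    unfolding H_def using that by (rule Least_le)
  have H_le_iff: "H n \<omega> \<le> k0 \<longleftrightarrow> (\<exists>k\<le>k0. P n k \<omega> \<or> k = J n)" for n \<omega> k0
    using HP Hle order_trans by blast
  have HJ: "H n \<omega> \<le> J n" for n \<omega> using Hle by blast
  have \<tau>_le: "\<tau> n \<omega> \<le> t \<longleftrightarrow> H n \<omega> \<le> nat \<lfloor>t * real (N n)\<rfloor>" if "0 \<le> t" for n \<omega> t
  proof -
    have "0 \<le> t * real (N n)" using that N0[of n] by simp
    then show ?thesis unfolding \<tau>_def using N0[of n] by (simp add: pos_divide_le_eq le_floor_iff le_nat_iff)
  qed
  have \<tau>0: "0 \<le> \<tau> n \<omega>" and \<tau>Q: "\<tau> n \<omega> \<in> \<rat>" and \<tau>n: "\<tau> n \<omega> \<le> real n" for n \<omega>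
  proof -
    show "0 \<le> \<tau> n \<omega>" "\<tau> n \<omega> \<in> \<rat>" by (auto simp: \<tau>_def)
    have "\<tau> n \<omega> \<le> real (J n) / real (N n)" unfolding \<tau>_def using HJ[of n \<omega>] by (simp add: divide_right_mono)
    then show "\<tau> n \<omega> \<le> real n" unfolding JN .
  qed
  have Pm: "{\<omega> \<in> space M. P n k \<omega>} \<in> sets (\<F> t)" if "0 \<le> t" "k \<le> nat \<lfloor>t * real (N n)\<rfloor>" for n k t
  proof -
    have "0 \<le> t * real (N n)" using that N0[of n] by simp
    then have "real k \<le> t * real (N n)" using that(2) by (simp add: le_nat_iff le_floor_iff)
    then have le: "real k / real (N n) \<le> t" using N0[of n] by (simp add: pos_divide_le_eq)
    have "Z (real k / real (N n)) \<in> borel_measurable (\<F> t)"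
      by (rule measurable_nat_filtration_mono[OF le Z_filt]) simp
    from measurable_sets[OF this, of "{a..}"] show ?thesis
      by (simp add: P_def vimage_def Int_def conj_commute)
  qed
  have stop: "{\<omega> \<in> space M. \<tau> n \<omega> \<le> t} \<in> sets (\<F> t)" if t: "0 \<le> t" for n t
  proof -
    let ?k = "nat \<lfloor>t * real (N n)\<rfloor>"
    have "{\<omega> \<in> space (\<F> t). P n k \<omega> \<or> k = J n} \<in> sets (\<F> t)" if "k \<in> {..?k}" for k
    proof (rule sets.sets_Collect_disj)
      show "{\<omega> \<in> space (\<F> t). P n k \<omega>} \<in> sets (\<F> t)" using Pm[OF t, of k n] that by simp
    qed (rule sets.sets_Collect_const)
    then have "{\<omega> \<in> space (\<F> t). \<exists>k\<in>{..?k}. P n k \<omega> \<or> k = J n} \<in> sets (\<F> t)"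
      by (rule sets.sets_Collect_finite_Ex[OF _ finite_atMost])
    moreover have "\<tau> n \<omega> \<le> t \<longleftrightarrow> (\<exists>k\<in>{..?k}. P n k \<omega> \<or> k = J n)" for \<omega>
      unfolding \<tau>_le[OF t] by (subst H_le_iff) auto
    ultimately show ?thesis by simp
  qed
  have P_ex: "P n (H n \<omega>) \<omega> \<longleftrightarrow> (\<exists>k\<le>J n. P n k \<omega>)" for n \<omega>
    using HP[of n \<omega>] HJ[of n \<omega>] Hle[of n _ \<omega>] by (metis le_antisym)
  have st: "R n \<in> stopping_times M B" for n
    unfolding stopping_times_def
  proof (intro CollectI conjI ballI allI impI)
    show "0 \<le> R n \<omega>" for \<omega> using \<tau>0 by (simp add: R_def)
    fix t :: real assume t: "0 \<le> t"
    let ?k = "nat \<lfloor>t * real (N n)\<rfloor>"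
    have "R n \<omega> \<le> ereal t \<longleftrightarrow> (\<exists>k\<in>{..min (J n) ?k}. P n k \<omega>)" for \<omega>
    proof
      assume "R n \<omega> \<le> ereal t"
      then have "P n (H n \<omega>) \<omega>" "\<tau> n \<omega> \<le> t" by (auto simp: R_def split: if_splits)
      then show "\<exists>k\<in>{..min (J n) ?k}. P n k \<omega>" using HJ \<tau>_le[OF t] by auto
    next
      assume "\<exists>k\<in>{..min (J n) ?k}. P n k \<omega>"
      then obtain k where k: "k \<le> J n" "k \<le> ?k" "P n k \<omega>" by auto
      then have "P n (H n \<omega>) \<omega>" using P_ex by blast
      moreover have "\<tau> n \<omega> \<le> t" using \<tau>_le[OF t] Hle[of n k \<omega>] k by auto
      ultimately show "R n \<omega> \<le> ereal t" by (simp add: R_def)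
    qed
    moreover have "{\<omega> \<in> space (\<F> t). \<exists>k\<in>{..min (J n) ?k}. P n k \<omega>} \<in> sets (\<F> t)"
    proof (rule sets.sets_Collect_finite_Ex)
      show "{\<omega> \<in> space (\<F> t). P n k \<omega>} \<in> sets (\<F> t)" if "k \<in> {..min (J n) ?k}" for k
        using Pm[OF t, of k n] that by simp
    qed (rule finite_atMost)
    ultimately show "{\<omega> \<in> space M. R n \<omega> \<le> ereal t} \<in> sets (\<F> t)" by simp
  qed
  have grid: "\<exists>j\<le>J n. \<tau> n \<omega> = real j * (1 / real (N n))" for n \<omega> using HJ by (auto simp: \<tau>_def)
  have \<tau>m[measurable]: "\<tau> n \<in> borel_measurable M" for n by (rule stopping_measurable[OF stop \<tau>0])
  have Y\<tau>[measurable]: "(\<lambda>\<omega>. Y (\<tau> n \<omega>) \<omega>) \<in> borel_measurable M" for n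
    by (rule Y_at_measurable[where I="(\<lambda>j. real j * (1 / real (N n))) ` {..J n}"]) (use grid in auto)
  define G where "G n = running_le (\<tau> n) b" for n
  have Gm: "G n \<in> events" for n unfolding G_def by (rule running_le_events[OF \<tau>m])
  have GD: "Y s \<omega> \<le> b" if "\<omega> \<in> G n" "s \<in> \<rat>" "0 \<le> s" "s \<le> \<tau> n \<omega>" for n \<omega> s
    using running_leD that unfolding G_def by blast
  have ei: "integrable M (\<lambda>\<omega>. exp (- r * \<tau> n \<omega>))" for n
    using r \<tau>0 by (intro integrable_const_bound[where B=1]) auto
  have disc: "F y - K * (1 - prob (G n)) \<le> F b * expectation (\<lambda>\<omega>. exp (- r * \<tau> n \<omega>))" for n
  proof -
    have h: "0 < 1 / real (N n)" "1 / real (N n) \<in> \<rat>" using N0[of n] by auto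
    let ?l = "\<lambda>\<omega>. indicat_real (G n) \<omega> * (exp (- r * \<tau> n \<omega>) * f (Y (\<tau> n \<omega>) \<omega>))"
    have i: "integrable M ?l"
      by (rule dynkin(1)[OF f(1) sup r b0 h low T.K_nonneg stop grid Gm GD])
    have e: "expectation ?l \<le> f y + K * (1 - prob (G n))"
      by (rule dynkin(2)[OF f(1) sup r b0 h low T.K_nonneg stop grid Gm GD])
    have "- (F b * expectation (\<lambda>\<omega>. exp (- r * \<tau> n \<omega>))) = expectation (\<lambda>\<omega>. - F b * exp (- r * \<tau> n \<omega>))"
      by simp
    also have "\<dots> \<le> expectation ?l"
    proof (rule integral_mono[OF _ i])
      show "integrable M (\<lambda>\<omega>. - F b * exp (- r * \<tau> n \<omega>))" using ei by (rule integrable_mult_right)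
      show "- F b * exp (- r * \<tau> n \<omega>) \<le> ?l \<omega>" if ws: "\<omega> \<in> space M" for \<omega>
      proof (cases "\<omega> \<in> G n")
        case True
        have "Y (\<tau> n \<omega>) \<omega> \<in> {0..b}"
          using GD[OF True \<tau>Q \<tau>0 order_refl] Y_nonneg[OF ws \<tau>0] by simp
        then have "- F b \<le> f (Y (\<tau> n \<omega>) \<omega>)" using f(2) mono by auto
        then have "exp (- r * \<tau> n \<omega>) * - F b \<le> exp (- r * \<tau> n \<omega>) * f (Y (\<tau> n \<omega>) \<omega>)" by (rule mult_left_mono) simp
        then show ?thesis using True by (simp add: mult.commute)
      next
        case False
        then show ?thesis using Fb by simp
      qed
    qed
    also have "\<dots> \<le> f y + K * (1 - prob (G n))" by (rule e)
    also have "f y = - F y" using f(2) params yb by auto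
    finally show ?thesis by simp
  qed
  \<comment> \<open>All grid times are rational, so one null set serves all grids.\<close>
  have AEZ: "AE \<omega> in M. \<forall>q::rat. 0 \<le> real_of_rat q \<longrightarrow> Y (real_of_rat q) \<omega> = Z (real_of_rat q) \<omega>"
    unfolding AE_all_countable
  proof
    fix q :: rat
    show "AE \<omega> in M. 0 \<le> real_of_rat q \<longrightarrow> Y (real_of_rat q) \<omega> = Z (real_of_rat q) \<omega>"
      using Z_eq[of "real_of_rat q"] by (cases "0 \<le> real_of_rat q") auto
  qed
  have AEg: "AE \<omega> in M. \<forall>k n. Y (real k / real (N n)) \<omega> = Z (real k / real (N n)) \<omega>"
    using AEZ
  proof eventually_elim
    case (elim \<omega>)
    show ?case
    proof (intro allI)
      fix k n
      have "real k / real (N n) = real_of_rat (of_nat k / of_nat (N n))" by (simp add: of_rat_divide)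
      then show "Y (real k / real (N n)) \<omega> = Z (real k / real (N n)) \<omega>"
        using elim[rule_format, of "of_nat k / of_nat (N n)"] by (metis divide_nonneg_nonneg of_nat_0_le_iff)
    qed
  qed
  \<comment> \<open>Subtracting \<open>exp (- r * real n)\<close> neutralises the paths without a
    hit, on which \<open>\<tau> n\<close> is \<open>n\<close> and the payoff 0.\<close>
  have pay: "(a - c) * (expectation (\<lambda>\<omega>. exp (- r * \<tau> n \<omega>)) - exp (- r * real n)) \<le> L" for n
  proof -
    have pe: "stop_payoff Y r c (R n) \<omega> = (if \<exists>k\<in>{..J n}. P n k \<omega> then exp (- r * \<tau> n \<omega>) * (Y (\<tau> n \<omega>) \<omega> - c) else 0)" for \<omega>
      using P_ex[of n \<omega>] by (auto simp: stop_payoff_def R_def)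
    have Ps: "{\<omega> \<in> space M. \<exists>k\<in>{..J n}. P n k \<omega>} \<in> events"
    proof (intro sets.sets_Collect_finite_Ex)
      fix k
      have "Z (real k / real (N n)) \<in> borel_measurable M" by (intro Z_meas) simp
      from measurable_sets[OF this, of "{a..}"] show "{\<omega> \<in> space M. P n k \<omega>} \<in> events"
        by (simp add: P_def vimage_def Int_def conj_commute)
    qed simp
    have pm: "stop_payoff Y r c (R n) \<in> borel_measurable M"
      unfolding pe[abs_def] by (rule measurable_If[OF _ _ Ps]) auto
    have ge: "AE \<omega> in M. (a - c) * (exp (- r * \<tau> n \<omega>) - exp (- r * real n)) \<le> stop_payoff Y r c (R n) \<omega>
        \<and> 0 \<le> stop_payoff Y r c (R n) \<omega>"
      using AEg
    proof eventually_elim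
      case (elim \<omega>)
      show ?case
      proof (cases "P n (H n \<omega>) \<omega>")
        case True
        then have p: "stop_payoff Y r c (R n) \<omega> = exp (- r * \<tau> n \<omega>) * (Y (\<tau> n \<omega>) \<omega> - c)"
          unfolding pe using P_ex[of n \<omega>] by auto
        have "Y (\<tau> n \<omega>) \<omega> = Z (real (H n \<omega>) / real (N n)) \<omega>" using elim unfolding \<tau>_def by simp
        then have "a \<le> Y (\<tau> n \<omega>) \<omega>" using True unfolding P_def by simp
        then have "exp (- r * \<tau> n \<omega>) * (a - c) \<le> exp (- r * \<tau> n \<omega>) * (Y (\<tau> n \<omega>) \<omega> - c)" by (intro mult_left_mono) auto
        moreover have "0 \<le> (a - c) * exp (- r * real n)" "0 \<le> exp (- r * \<tau> n \<omega>) * (a - c)" using a by auto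
        moreover have "(a - c) * (exp (- r * \<tau> n \<omega>) - exp (- r * real n)) = exp (- r * \<tau> n \<omega>) * (a - c) - (a - c) * exp (- r * real n)"
          by (simp only: right_diff_distrib mult.commute)
        ultimately show ?thesis unfolding p by (intro conjI) linarith+
      next
        case False
        then have "H n \<omega> = J n" using HP by blast
        then have "\<tau> n \<omega> = real n" using JN[of n] unfolding \<tau>_def by simp
        moreover have "stop_payoff Y r c (R n) \<omega> = 0" unfolding pe using False P_ex[of n \<omega>] by auto
        ultimately show ?thesis by simp
      qed
    qed
    \<comment> \<open>The payoff is almost surely nonnegative, so the finite integral of its
      positive part is enough.\<close>
    have pi: "integrable M (stop_payoff Y r c (R n))"
    proof (rule integrableI_bounded[OF pm])
      have "(\<integral>\<^sup>+\<omega>. ennreal (norm (stop_payoff Y r c (R n) \<omega>)) \<partial>M) = (\<integral>\<^sup>+\<omega>. ennreal (stop_payoff Y r c (R n) \<omega>) \<partial>M)"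
        by (rule nn_integral_cong_AE) (use ge in eventually_elim, simp)
      then show "(\<integral>\<^sup>+\<omega>. ennreal (norm (stop_payoff Y r c (R n) \<omega>)) \<partial>M) < \<infinity>" using fin[OF st] by simp
    qed
    have "(a - c) * (expectation (\<lambda>\<omega>. exp (- r * \<tau> n \<omega>)) - exp (- r * real n)) =
      expectation (\<lambda>\<omega>. (a - c) * (exp (- r * \<tau> n \<omega>) - exp (- r * real n)))"
      using ei[of n] by (simp add: prob_space)
    also have "\<dots> \<le> expectation (stop_payoff Y r c (R n))"
      by (rule integral_mono_AE[OF _ pi]) (use ge ei in auto)
    also have "\<dots> \<le> L" by (rule L[OF st])
    finally show ?thesis .
  qed
  have inG: "AE \<omega> in M. \<forall>\<^sub>F n in sequentially. \<omega> \<in> G n"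
    using AEg AE_space
  proof eventually_elim
    case (elim \<omega>)
    show ?case
    \<comment> \<open>A path that never exceeds \<open>b\<close> lies in every \<open>G n\<close>.
      Otherwise let \<open>s\<close> be the first time at or above \<open>b\<close>, positive
      because \<open>y < b\<close>: shortly before \<open>s\<close> the path is above
      \<open>a\<close>, and a fine grid has a point there, so the stop comes before
      \<open>s\<close>.\<close>
    proof (cases "\<exists>q\<ge>0. b < Y q \<omega>")
      case False
      then show ?thesis using elim(2) by (auto simp: G_def running_le_def not_less)
    next
      case True
      then obtain q where q: "q \<ge> 0" "b < Y q \<omega>" by blast
      have cont: "continuous_on {0..q} (\<lambda>t. Y t \<omega>)" by (rule continuous_on_subset[OF Y_cont[OF elim(2)]]) auto
      define C where "C = {t \<in> {0..q}. b \<le> Y t \<omega>}"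
      have "closed C" unfolding C_def
        using continuous_closed_preimage[OF cont, of "{b..}"] by (simp add: vimage_def Int_def conj_commute)
      moreover have "bounded C" by (rule bounded_subset[OF bounded_closed_interval[of 0 q]]) (auto simp: C_def)
      ultimately have "compact C" by (simp add: compact_eq_bounded_closed)
      moreover have "q \<in> C" using q by (simp add: C_def)
      ultimately obtain s where s: "s \<in> C" "\<And>t. t \<in> C \<Longrightarrow> s \<le> t"
        using compact_attains_inf[of C] by blast
      have s0: "s \<in> {0..q}" "b \<le> Y s \<omega>" using s(1) by (auto simp: C_def)
      have "s \<noteq> 0" using s0(2) Y_zero[OF elim(2)] yb by auto
      then have sp: "0 < s" using s0 by simp
      have below: "Y t \<omega> < b" if "0 \<le> t" "t < s" for t
        using s(2)[of t] s0 that by (force simp: C_def)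
      have "((\<lambda>t. Y t \<omega>) \<longlongrightarrow> Y s \<omega>) (at s within {0..q})" using cont s0 by (simp add: continuous_on_def)
      then have "\<forall>\<^sub>F t in at s within {0..q}. a < Y t \<omega>"
        by (rule order_tendstoD) (use s0 a in linarith)
      then obtain d where d: "d > 0" "\<And>t. t \<in> {0..q} \<Longrightarrow> t \<noteq> s \<Longrightarrow> dist t s < d \<Longrightarrow> a < Y t \<omega>"
        unfolding eventually_at by blast
      define e where "e = min d s"
      have e: "0 < e" "e \<le> d" "e \<le> s" using d sp by (auto simp: e_def)
      obtain n1 :: nat where n1: "2 / e < real n1" using reals_Archimedean2 by blast
      obtain n2 :: nat where n2: "s < real n2" using reals_Archimedean2 by blast
      have "\<omega> \<in> G n" if n: "max n1 n2 \<le> n" for n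
      proof -
        \<comment> \<open>Rounding \<open>s - e / 2\<close> down on a mesh below
          \<open>e / 2\<close> lands in \<open>(s - e, s - e / 2]\<close>, where the path lies
          between \<open>a\<close> and \<open>b\<close>.\<close>
        define k where "k = nat \<lfloor>(s - e / 2) * real (N n)\<rfloor>"
        have nn: "0 \<le> (s - e / 2) * real (N n)" using e N0[of n] by simp
        have k: "real k \<le> (s - e / 2) * real (N n)" "(s - e / 2) * real (N n) < real k + 1"
          unfolding k_def using nn by linarith+
        define t where "t = real k / real (N n)"
        have t1: "t \<le> s - e / 2" unfolding t_def using k(1) N0[of n] by (simp add: pos_divide_le_eq)
        have "2 / e < real (N n)" using n1 n by (simp add: N_J_def)
        then have "2 < e * real (N n)" using e(1) by (simp add: pos_divide_less_eq mult.commute)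
        then have "(s - e) * real (N n) < real k" using k(2) by (simp add: algebra_simps)
        then have t2: "s - e < t" unfolding t_def using N0[of n] by (simp add: pos_less_divide_eq)
        have t0: "0 \<le> t" unfolding t_def by simp
        have "a < Y t \<omega>" using t0 t1 t2 e s0 by (intro d(2)) (auto simp: dist_real_def)
        then have "P n k \<omega>" using elim(1) unfolding P_def t_def by simp
        then have "H n \<omega> \<le> k" using Hle by blast
        then have "\<tau> n \<omega> \<le> t" unfolding \<tau>_def t_def by (simp add: divide_right_mono)
        then have "\<tau> n \<omega> < s" using t1 e by simp
        then show ?thesis using elim(2) below by (auto simp: G_def running_le_def intro!: less_imp_le)
      qed
      then show ?thesis unfolding eventually_sequentially by blast
    qed
  qed
  have "(\<lambda>n. expectation (indicat_real (G n))) \<longlonglongrightarrow> expectation (\<lambda>_. 1)"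
  proof (rule integral_dominated_convergence[where w="\<lambda>_. 1"])
    show "AE \<omega> in M. (\<lambda>n. indicat_real (G n) \<omega>) \<longlonglongrightarrow> 1"
      using inG
    proof eventually_elim
      case (elim \<omega>)
      then have "\<forall>\<^sub>F n in sequentially. 1 = indicat_real (G n) \<omega>" by eventually_elim simp
      then show ?case by (rule Lim_transform_eventually[OF tendsto_const])
    qed
  qed (use Gm in \<open>auto simp: indicator_def\<close>)
  then have pG: "(\<lambda>n. prob (G n)) \<longlonglongrightarrow> 1" using Gm by (simp add: prob_space)
  have ex0: "(\<lambda>n. exp (- r * real n)) \<longlonglongrightarrow> 0"
  proof -
    have "(\<lambda>n. exp (- r) ^ n) \<longlonglongrightarrow> 0" using r by (intro LIMSEQ_power_zero) simp
    then show ?thesis by (simp add: exp_of_nat_mult[symmetric] mult.commute)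
  qed
  have lim: "(\<lambda>n. (a - c) * ((F y - K * (1 - prob (G n))) / F b - exp (- r * real n))) \<longlonglongrightarrow> (a - c) * ((F y - K * (1 - 1)) / F b - 0)"
    using Fb by (intro tendsto_intros pG ex0) auto
  have "(a - c) * ((F y - K * (1 - prob (G n))) / F b - exp (- r * real n)) \<le> L" for n
  proof -
    have "(F y - K * (1 - prob (G n))) / F b \<le> expectation (\<lambda>\<omega>. exp (- r * \<tau> n \<omega>))"
      using disc[of n] Fb by (simp add: pos_divide_le_eq mult.commute)
    then have "(a - c) * ((F y - K * (1 - prob (G n))) / F b - exp (- r * real n)) \<le> (a - c) * (expectation (\<lambda>\<omega>. exp (- r * \<tau> n \<omega>)) - exp (- r * real n))"
      using a by (intro mult_left_mono) auto
    then show ?thesis using pay[of n] by simp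
  qed
  then have "(a - c) * ((F y - K * (1 - 1)) / F b - 0) \<le> L"
    by (intro LIMSEQ_le_const2[OF lim]) auto
  then show ?thesis by simp
qed

lemma now_payoff:
  "(\<lambda>_. 0) \<in> stopping_times M B" "expectation (stop_payoff Y r c (\<lambda>_. 0)) = y - c"
proof -
  have "{\<omega> \<in> space M. (0::ereal) \<le> ereal t} \<in> sets (\<F> t)" if "0 \<le> t" for t
    using that sets.top[of "\<F> t"] by simp
  then show "(\<lambda>_. 0) \<in> stopping_times M B" by (simp add: stopping_times_def)
  have "expectation (stop_payoff Y r c (\<lambda>_. 0)) = expectation (\<lambda>_. y - c)"
    by (rule Bochner_Integration.integral_cong) (auto simp: stop_payoff_def Y_zero)
  then show "expectation (stop_payoff Y r c (\<lambda>_. 0)) = y - c" by (simp add: prob_space)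
qed

end

theorem theorem3p1:
  fixes \<mu> \<theta> \<sigma> r c :: real
  assumes "\<mu> > 0" and "\<theta> > 0" and "\<sigma> > 0" and "r > 0" and "c > 0"
  shows "\<exists>b. max c ((\<mu> * \<theta> + r * c) / (\<mu> + r)) < b \<and>
     cirF \<mu> \<theta> \<sigma> r b = (b - c) * deriv (cirF \<mu> \<theta> \<sigma> r) b \<and>
     (\<forall>(M::'a measure) B Y y. prob_space M \<and> std_brownian_motion M B \<and> 0 \<le> y \<and>
        cir_solution M B \<mu> \<theta> \<sigma> y Y \<longrightarrow>
        value_fn M B Y r c =
          (if y < b then (b - c) / cirF \<mu> \<theta> \<sigma> r b * cirF \<mu> \<theta> \<sigma> r y else y - c))"
proof -
  define F where "F = cirF \<mu> \<theta> \<sigma> r"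
  obtain F1 F2 \<kappa> where F: "\<forall>x. (F has_real_derivative F1 x) (at x)" "\<forall>x. (F1 has_real_derivative F2 x) (at x)"
    "continuous_on UNIV F2" "\<forall>x. F1 x * (\<mu> * (\<theta> - x)) + F2 x * (\<sigma>\<^sup>2 * x) / 2 - r * F x = 0"
    "\<kappa> > 0" "\<forall>x\<ge>0. 1 \<le> F x \<and> 0 < F1 x \<and> \<kappa> \<le> F2 x"
    using cirF_solution[OF assms(1-4)] unfolding F_def by blast
  interpret FB: free_boundary \<mu> \<theta> \<sigma> r c F F1 F2 \<kappa>
    using assms F by unfold_locales auto
  obtain b where b: "max c ((\<mu> * \<theta> + r * c) / (\<mu> + r)) < b" and eq: "F b = (b - c) * F1 b"
    using FB.exists_boundary by blast
  note W_deriv = FB.W_deriv[OF b eq] and W_ge = FB.W_ge[OF b eq] and W_super = FB.W_super[OF b eq]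
    and W_tendsto = FB.W_tendsto[OF b eq] and b_gt = FB.b_gt[OF b eq]
  have "deriv F b = F1 b" using F(1) by (auto intro: DERIV_imp_deriv)
  then have eqd: "F b = (b - c) * deriv F b" using eq by simp
  have Fb: "0 < F b" using FB.F_pos[of b] b_gt by simp
  have F_mono: "F x \<le> F b" if "0 \<le> x" "x \<le> b" for x
    using F(1) FB.F1_pos that by (intro DERIV_nonneg_imp_nondecreasing[of x b F]) (auto intro!: less_imp_le)
  have val: "value_fn M B Y r c = (if y < b then (b - c) / F b * F y else y - c)"
    if H: "prob_space M" "std_brownian_motion M B" "0 \<le> y" "cir_solution M B \<mu> \<theta> \<sigma> y Y"
    for M :: "'a measure" and B Y y
  proof -
    interpret prob_space M by (rule H(1))
    interpret cir M B \<mu> \<theta> \<sigma> y Y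
      using H assms by unfold_locales auto
    define V where "V = (if y < b then (b - c) / F b * F y else y - c)"
    \<comment> \<open>The two smallness conditions of \<open>W_super\<close>.\<close>
    define e0 where "e0 = min (b / 2) (\<sigma>\<^sup>2 * b / (4 * \<mu> * \<theta>))"
    have e0: "0 < e0" unfolding e0_def using b_gt assms by simp
    have up: "(\<integral>\<^sup>+\<omega>. ennreal (stop_payoff Y r c \<tau> \<omega>) \<partial>M) \<le> ennreal (FB.W b e y)"
      if "0 < e" "e < e0" "\<tau> \<in> stopping_times M B" for e \<tau>
    proof -
      have "e \<le> \<sigma>\<^sup>2 * b / (4 * \<mu> * \<theta>)" using that unfolding e0_def by simp
      then have "4 * \<mu> * \<theta> * e \<le> \<sigma>\<^sup>2 * b" using assms by (simp add: pos_le_divide_eq mult_ac)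
      moreover have "2 * e \<le> b" using that unfolding e0_def by simp
      ultimately show ?thesis
        by (intro supersolution_bound[OF W_deriv[OF that(1)] W_super[OF that(1)] W_ge[OF that(1)] assms(4) that(3)])
    qed
    \<comment> \<open>For \<open>y < b\<close> the smoothed function does not depend on
      \<open>e\<close>; only above \<open>b\<close> is there a limit to take.\<close>
    have Wl: "((\<lambda>e. FB.W b e y) \<longlongrightarrow> V) (at_right 0)"
    proof (cases "y < b")
      case True
      then show ?thesis unfolding V_def by (simp add: FB.W_def[OF b eq] FB.K0_def[OF b eq])
    next
      case False
      then show ?thesis using W_tendsto[of y] by (simp add: V_def)
    qed
    have upper: "expectation (stop_payoff Y r c \<tau>) \<le> V" if \<tau>: "\<tau> \<in> stopping_times M B" for \<tau>
    proof (rule tendsto_lowerbound[OF Wl])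
      have "\<forall>\<^sub>F e in at_right 0. e \<in> {0<..<e0}" using e0 by (rule eventually_at_right_real)
      then show "\<forall>\<^sub>F e in at_right 0. expectation (stop_payoff Y r c \<tau>) \<le> FB.W b e y"
      proof eventually_elim
        case (elim e)
        \<comment> \<open>Nonnegativity also covers the default value 0 of the Bochner integral of a
          payoff that is not integrable.\<close>
        then have "0 \<le> FB.W b e y" using W_ge(2)[of e y] H(3) by simp
        then show ?case using up[of e \<tau>] \<tau> elim by (intro integral_real_bounded) auto
      qed
    qed simp
    have fin: "(\<integral>\<^sup>+\<omega>. ennreal (stop_payoff Y r c \<tau> \<omega>) \<partial>M) < \<infinity>" if "\<tau> \<in> stopping_times M B" for \<tau>
      using up[of "e0 / 2" \<tau>] that e0 by (auto intro: le_less_trans)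
    have ne: "stopping_times M B \<noteq> {}" using now_payoff(1) by blast
    \<comment> \<open>On the reals \<open>SUP\<close> is the supremum only for a nonempty bounded
      family, so both facts must precede the comparison.\<close>
    have bdd: "bdd_above ((\<lambda>\<tau>. expectation (stop_payoff Y r c \<tau>)) ` stopping_times M B)"
      using upper by (intro bdd_aboveI[of _ V]) auto
    have le: "value_fn M B Y r c \<le> V" unfolding value_fn_def by (rule cSUP_least[OF ne upper])
    have ge1: "expectation (stop_payoff Y r c \<tau>) \<le> value_fn M B Y r c" if "\<tau> \<in> stopping_times M B" for \<tau>
      unfolding value_fn_def by (rule cSUP_upper[OF that bdd])
    have ge: "V \<le> value_fn M B Y r c"
    proof (cases "y < b")
      case False
      then show ?thesis using ge1[OF now_payoff(1)] now_payoff(2) by (simp add: V_def)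
    next
      case True
      have low: "(a - c) * F y / F b \<le> value_fn M B Y r c" if "c < a" "a < b" for a
        by (rule hitting_bound[of F F1 F2, OF _ _ F(3) _ F_mono Fb assms(4) True that fin ge1]) (use F in auto)
      \<comment> \<open>Every level below \<open>b\<close> gives a lower bound; letting it rise to
        \<open>b\<close> recovers the factor of the candidate.\<close>
      have "((\<lambda>a. (a - c) * F y / F b) \<longlongrightarrow> (b - c) * F y / F b) (at_left b)"
        using Fb by (intro tendsto_intros) auto
      moreover have "\<forall>\<^sub>F a in at_left b. (a - c) * F y / F b \<le> value_fn M B Y r c"
        using eventually_at_left_real[OF b_gt(1)] by eventually_elim (use low in auto)
      ultimately have "(b - c) * F y / F b \<le> value_fn M B Y r c"
        by (rule tendsto_upperbound) simp
      then show ?thesis using True by (simp add: V_def)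
    qed
    show ?thesis using le ge unfolding V_def by simp
  qed
  show ?thesis
    using b eqd val unfolding F_def by (intro exI[of _ b]) blast
qed

end
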